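(* Let $H$ be a finite dimensional semisimple Hopf algebra over $k$, let $A$ be a dg $H$-module algebra, and let $M$ be a dg $A\#H$-module. Then there is a quasi-isomorphism of dg algebras $$\operatorname{RHom}_A(M,M)\#H\longrightarrow \operatorname{RHom}_{A\#H}(M\otimes H,M\otimes H).$$
   Context: $k$ is an algebraically closed field of characteristic zero; $\otimes=\otimes_k$. A dg algebra is a $\mathbb{Z}$-graded $k$-algebra $A=\bigoplus_n A^n$ with a differential $d$ of degree $1$ with $d(ab)=d(a)b+(-1)^{|a|}a\,d(b)$; dg modules are left dg modules, with $d(am)=d(a)m+(-1)^{|a|}a\,d(m)$. Dg $H$-module algebra: for a Hopf algebra $H$ (with comultiplication written $h\mapsto h_{(1)}\otimes h_{(2)}$ and antipode $S$), a dg algebra $A$ which is a graded $H$-module algebra (each $A^i$ is an $H$-submodule, $h\cdot(ab)=(h_{(1)}\cdot a)(h_{(2)}\cdot b)$, $h\cdot 1=\varepsilon(h)1$) such that $d(h\cdot a)=h\cdot d(a)$. The smash product $A\#H$ is $A\otimes H$ with product $(a\#h)(b\#g)=a(h_{(1)}\cdot b)\#h_{(2)}g$ and differential $d\otimes \mathrm{id}$ ($H$ in degree $0$); it is a dg algebra containing $A$ and $H$, so dg $A\#H$-modules are also dg $A$-modules and complexes of $H$-modules. Hom complexes: $\operatorname{Hom}_A(M,N)=\bigoplus_i\operatorname{Hom}^i_A(M,N)$, where $\operatorname{Hom}_A^i$ consists of the graded $A$-module maps of degree $i$ (with the usual Koszul sign: $f(am)=(-1)^{i|a|}af(m)$), with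 differential $d(f)=d_N\circ f-(-1)^{|f|}f\circ d_M$. The dg algebra $\operatorname{Hom}_A(M,M)$ has multiplication $f*g=(-1)^{|f||g|}g\circ f$ (and similarly over $A\#H$). For dg $A\#H$-modules $M,N$, $H$ acts on $\operatorname{Hom}_A(M,N)$ by $(h\rightharpoonup f)(m)=h_{(2)}f(S^{-1}(h_{(1)})m)$; with this action $\operatorname{Hom}_A(M,M)$ is a dg $H$-module algebra. For a dg $A\#H$-module $M$, $M\otimes H$ is the dg $A\#H$-module with $(a\#h)(m\otimes w)=(a\#h_{(1)})m\otimes h_{(2)}w$ ($H$ in degree $0$). A dg module $P$ over a dg algebra $B$ is K-projective if $\operatorname{Hom}_B(P,-)$ sends acyclic dg modules to acyclic complexes. Let $P\to M$ be a K-projective resolution of the dg $A\#H$-module $M$ (i.e. a quasi-isomorphism with $P$ a K-projective dg $A\#H$-module). Then $\operatorname{RHom}_A(M,M)$ denotes the dg $H$-module algebra $\operatorname{Hom}_A(P,P)$, and $\operatorname{RHom}_{A\#H}(M\otimes H,M\otimes H)$ denotes the dg algebra $\operatorname{Hom}_{A\#H}(P\otimes H,P\otimes H)$. *)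

theory Defs
  imports Complex_Main "HOL-Library.Function_Algebras" "HOL-Library.Nat_Bijection"
    "HOL-Computational_Algebra.Polynomial"
begin

text \<open>
  Vector spaces over \<open>'k\<close> are subspaces (``carriers'') of an ambient type of class
  \<open>ab_group_add\<close> with an explicit scalar multiplication, so that tensor products and
  Hom spaces, which are subspaces of function types, are treated on the same footing as the
  given objects.  Linearity and bilinearity are required on carriers only.
\<close>

definition linear_on ::
  "('k \<Rightarrow> 'v \<Rightarrow> 'v) \<Rightarrow> 'v set \<Rightarrow> ('k \<Rightarrow> 'w \<Rightarrow> 'w) \<Rightarrow> 'w set \<Rightarrow>
    ('v::ab_group_add \<Rightarrow> 'w::ab_group_add) \<Rightarrow> bool" where
  "linear_on sv V sw W f \<longleftrightarrow>
     (\<forall>x\<in>V. f x \<in> W) \<and>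
     (\<forall>x\<in>V. \<forall>y\<in>V. f (x + y) = f x + f y) \<and>
     (\<forall>c. \<forall>x\<in>V. f (sv c x) = sw c (f x))"

definition bilinear_on ::
  "('k \<Rightarrow> 'v \<Rightarrow> 'v) \<Rightarrow> 'v set \<Rightarrow> ('k \<Rightarrow> 'w \<Rightarrow> 'w) \<Rightarrow> 'w set \<Rightarrow> ('k \<Rightarrow> 'u \<Rightarrow> 'u) \<Rightarrow> 'u set \<Rightarrow>
    ('v::ab_group_add \<Rightarrow> 'w::ab_group_add \<Rightarrow> 'u::ab_group_add) \<Rightarrow> bool" where
  "bilinear_on sv V sw W su U f \<longleftrightarrow>
     (\<forall>x\<in>V. linear_on sw W su U (f x)) \<and>
     (\<forall>y\<in>W. linear_on sv V su U (\<lambda>x. f x y))"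


section \<open>Tensor products of vector spaces\<close>

text \<open>
  The tensor product is realised inside the dual of the space of bilinear forms: \<open>v \<otimes> w\<close> is
  evaluation at \<open>(v, w)\<close>, with the junk value 0 on functions that are not bilinear.  The universal
  property is proved in \<open>tlift_tens\<close> and \<open>tlift_linear\<close> below.
\<close>

type_synonym ('v, 'w, 'k) tensor = "('v \<Rightarrow> 'w \<Rightarrow> 'k) \<Rightarrow> 'k"

definition bilinear_form ::
  "('k::field \<Rightarrow> 'v::ab_group_add \<Rightarrow> 'v) \<Rightarrow> ('k \<Rightarrow> 'w::ab_group_add \<Rightarrow> 'w) \<Rightarrow> ('v \<Rightarrow> 'w \<Rightarrow> 'k) \<Rightarrow> bool" where
  "bilinear_form sv sw b \<longleftrightarrow> bilinear_on sv UNIV sw UNIV (*) UNIV b"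

definition tens ::
  "('k::field \<Rightarrow> 'v::ab_group_add \<Rightarrow> 'v) \<Rightarrow> ('k \<Rightarrow> 'w::ab_group_add \<Rightarrow> 'w) \<Rightarrow>
    'v \<Rightarrow> 'w \<Rightarrow> ('v, 'w, 'k) tensor" where
  "tens sv sw v w = (\<lambda>b. if bilinear_form sv sw b then b v w else 0)"

definition tscl :: "'k::field \<Rightarrow> ('v, 'w, 'k) tensor \<Rightarrow> ('v, 'w, 'k) tensor" where
  "tscl c t = (\<lambda>b. c * t b)"

definition tspan ::
  "('k::field \<Rightarrow> 'v::ab_group_add \<Rightarrow> 'v) \<Rightarrow> 'v set \<Rightarrow> ('k \<Rightarrow> 'w::ab_group_add \<Rightarrow> 'w) \<Rightarrow> 'w set \<Rightarrow>
    ('v, 'w, 'k) tensor set" where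
  "tspan sv V sw W = module.span tscl {tens sv sw v w |v w. v \<in> V \<and> w \<in> W}"

text \<open>
  The linear map on \<open>V \<otimes> W\<close> induced by a bilinear map \<open>f\<close> on \<open>V \<times> W\<close>:
  \<open>\<Sum> v\<^sub>i \<otimes> w\<^sub>i \<mapsto> \<Sum> f v\<^sub>i w\<^sub>i\<close>.
\<close>

definition tlift ::
  "('k::field \<Rightarrow> 'v::ab_group_add \<Rightarrow> 'v) \<Rightarrow> 'v set \<Rightarrow> ('k \<Rightarrow> 'w::ab_group_add \<Rightarrow> 'w) \<Rightarrow> 'w set \<Rightarrow>
    ('v \<Rightarrow> 'w \<Rightarrow> 'u::ab_group_add) \<Rightarrow> ('v, 'w, 'k) tensor \<Rightarrow> 'u" where
  "tlift sv V sw W f t =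
     (THE u. \<exists>xs. set xs \<subseteq> V \<times> W \<and>
        t = (\<Sum>(v, w)\<leftarrow>xs. tens sv sw v w) \<and> u = (\<Sum>(v, w)\<leftarrow>xs. f v w))"

lemma vector_space_mult: "vector_space ((*) :: 'k::field \<Rightarrow> 'k \<Rightarrow> 'k)"
  by unfold_locales (auto simp: algebra_simps)

lemma vector_space_fun: "vector_space s \<Longrightarrow> vector_space (\<lambda>c f x. s c (f x))"
  unfolding vector_space_def by (auto simp: fun_eq_iff)

lemma vector_space_tscl: "vector_space (tscl :: 'k::field \<Rightarrow> ('v, 'w, 'k) tensor \<Rightarrow> _)"
  using vector_space_fun[OF vector_space_mult] unfolding tscl_def .

lemma linear_on_UNIV_iff:
  assumes "vector_space s1" "vector_space s2"
  shows "linear_on s1 UNIV s2 UNIV f \<longleftrightarrow> Vector_Spaces.linear s1 s2 f"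
  using assms by (simp add: linear_on_def Vector_Spaces.linear_iff)

lemma linear_on_compose:
  "linear_on s1 U s2 V f \<Longrightarrow> linear_on s2 V s3 W g \<Longrightarrow> linear_on s1 U s3 W (\<lambda>x. g (f x))"
  unfolding linear_on_def by simp

lemma linear_on_subset:
  assumes "Vector_Spaces.linear s1 s2 f" "\<And>x. x \<in> V \<Longrightarrow> f x \<in> W"
  shows "linear_on s1 V s2 W f"
  using assms by (simp add: linear_on_def Vector_Spaces.linear_iff)

lemma exists_projection:
  assumes "vector_space s" "module.subspace s V"
  obtains p where "Vector_Spaces.linear s s p" "range p \<subseteq> V" "\<And>x. x \<in> V \<Longrightarrow> p x = x"
proof -
  interpret vector_space s by fact
  interpret P: vector_space_pair s s by unfold_locales
  show ?thesis
    using P.linear_exists_left_inverse_on[OF linear_id assms(2)] that by (auto simp: id_def)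
qed

lemma exists_functional:
  fixes s :: "'k::field \<Rightarrow> 'u::ab_group_add \<Rightarrow> 'u"
  assumes "vector_space s" "u \<noteq> 0"
  obtains \<phi> where "Vector_Spaces.linear s (*) \<phi>" "\<phi> u \<noteq> 0"
proof -
  interpret vector_space s by fact
  interpret K: vector_space "(*) :: 'k \<Rightarrow> _" by (rule vector_space_mult)
  interpret P: vector_space_pair s "(*) :: 'k \<Rightarrow> _" by unfold_locales
  have i: "independent {u}" using assms(2) by simp
  show ?thesis
    using that[OF P.linear_construct[OF i, of "\<lambda>_. 1"]] P.construct_basis[OF i, of u "\<lambda>_. 1"] by simp
qed

lemma sum_list_fun: "sum_list fs x = (\<Sum>f\<leftarrow>fs. f x)"
  by (induction fs) auto

lemma linear_sum_list:
  "Vector_Spaces.linear s1 s2 \<phi> \<Longrightarrow> \<phi> (sum_list xs) = (\<Sum>x\<leftarrow>xs. \<phi> x)"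
  by (induction xs) (auto simp: module_hom.zero[OF Vector_Spaces.linear.axioms(3)] module_hom.add[OF Vector_Spaces.linear.axioms(3)])

context
  fixes sv :: "'k::field \<Rightarrow> 'v::ab_group_add \<Rightarrow> 'v" and sw :: "'k \<Rightarrow> 'w::ab_group_add \<Rightarrow> 'w"
    and su :: "'k \<Rightarrow> 'u::ab_group_add \<Rightarrow> 'u" and V W U f
  assumes vs: "vector_space sv" "vector_space sw" "vector_space su"
    and sub: "module.subspace sv V" "module.subspace sw W" "module.subspace su U"
    and bil: "bilinear_on sv V sw W su U f"
begin

lemma tlift_unique:
  assumes "set xs \<subseteq> V \<times> W" "set ys \<subseteq> V \<times> W"
    and eq: "(\<Sum>(v, w)\<leftarrow>xs. tens sv sw v w) = (\<Sum>(v, w)\<leftarrow>ys. tens sv sw v w)"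
  shows "(\<Sum>(v, w)\<leftarrow>xs. f v w) = (\<Sum>(v, w)\<leftarrow>ys. f v w)"
proof (rule ccontr)
  assume "\<not> ?thesis"
  then have "(\<Sum>(v, w)\<leftarrow>xs. f v w) - (\<Sum>(v, w)\<leftarrow>ys. f v w) \<noteq> 0" by simp
  from exists_functional[OF vs(3) this] obtain \<phi> :: "'u \<Rightarrow> 'k" where
    phi: "Vector_Spaces.linear su (*) \<phi>" and
    nz: "\<phi> ((\<Sum>(v, w)\<leftarrow>xs. f v w) - (\<Sum>(v, w)\<leftarrow>ys. f v w)) \<noteq> 0" .
  obtain p where p: "Vector_Spaces.linear sv sv p" "range p \<subseteq> V" "\<And>x. x \<in> V \<Longrightarrow> p x = x"
    using exists_projection[OF vs(1) sub(1)] by blast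
  obtain q where q: "Vector_Spaces.linear sw sw q" "range q \<subseteq> W" "\<And>x. x \<in> W \<Longrightarrow> q x = x"
    using exists_projection[OF vs(2) sub(2)] by blast
  define b where "b = (\<lambda>v w. \<phi> (f (p v) (q w)))"
  have pV: "p v \<in> V" and qW: "q w \<in> W" for v w using p q by auto
  have b: "bilinear_form sv sw b"
    using bil phi p(1) q(1) pV qW
    unfolding bilinear_form_def bilinear_on_def linear_on_def b_def Vector_Spaces.linear_iff
    by simp
  have ev: "(\<Sum>(v, w)\<leftarrow>zs. tens sv sw v w) b = \<phi> (\<Sum>(v, w)\<leftarrow>zs. f v w)"
    if "set zs \<subseteq> V \<times> W" for zs
  proof -
    have "(\<Sum>(v, w)\<leftarrow>zs. tens sv sw v w) b = (\<Sum>z\<leftarrow>zs. b (fst z) (snd z))"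
      using b by (simp add: sum_list_fun o_def split_beta tens_def)
    also have "\<dots> = (\<Sum>z\<leftarrow>zs. \<phi> (f (fst z) (snd z)))"
      using that p(3) q(3) by (intro arg_cong[of _ _ sum_list] map_cong) (auto simp: b_def)
    also have "\<dots> = \<phi> (\<Sum>(v, w)\<leftarrow>zs. f v w)"
      by (simp add: linear_sum_list[OF phi] o_def split_beta)
    finally show ?thesis .
  qed
  have "\<phi> (\<Sum>(v, w)\<leftarrow>xs. f v w) = \<phi> (\<Sum>(v, w)\<leftarrow>ys. f v w)"
    using ev[OF assms(1)] ev[OF assms(2)] eq by simp
  then show False
    using nz module_hom.diff[OF Vector_Spaces.linear.axioms(3)[OF phi]] by simp
qed

lemma tlift_sum_list:
  assumes "set xs \<subseteq> V \<times> W"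
  shows "tlift sv V sw W f (\<Sum>(v, w)\<leftarrow>xs. tens sv sw v w) = (\<Sum>(v, w)\<leftarrow>xs. f v w)"
  unfolding tlift_def
proof (rule the_equality)
  show "\<exists>ys. set ys \<subseteq> V \<times> W \<and>
      (\<Sum>(v, w)\<leftarrow>xs. tens sv sw v w) = (\<Sum>(v, w)\<leftarrow>ys. tens sv sw v w) \<and>
      (\<Sum>(v, w)\<leftarrow>xs. f v w) = (\<Sum>(v, w)\<leftarrow>ys. f v w)"
    using assms by (intro exI[of _ xs]) simp
qed (use assms tlift_unique in metis)

lemma tlift_tens: "v \<in> V \<Longrightarrow> w \<in> W \<Longrightarrow> tlift sv V sw W f (tens sv sw v w) = f v w"
  using tlift_sum_list[of "[(v, w)]"] by simp

lemma tens_scale_left: "tens sv sw (sv c v) w = tscl c (tens sv sw v w)"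
  by (rule ext) (simp add: tens_def tscl_def bilinear_form_def bilinear_on_def linear_on_def)

lemma tspan_sum_list:
  assumes "t \<in> tspan sv V sw W"
  obtains xs where "set xs \<subseteq> V \<times> W" "t = (\<Sum>(v, w)\<leftarrow>xs. tens sv sw v w)"
proof -
  interpret T: vector_space "tscl :: 'k \<Rightarrow> ('v, 'w, 'k) tensor \<Rightarrow> _" by (rule vector_space_tscl)
  interpret Sv: vector_space sv by (rule vs)
  from assms have "\<exists>xs. set xs \<subseteq> V \<times> W \<and> t = (\<Sum>(v, w)\<leftarrow>xs. tens sv sw v w)"
    unfolding tspan_def
  proof (induction rule: T.span_induct_alt)
    case base
    show ?case by (rule exI[of _ "[]"]) simp
  next
    case (step c x y)
    then obtain v w xs where *: "x = tens sv sw v w" "v \<in> V" "w \<in> W" "set xs \<subseteq> V \<times> W"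
      "y = (\<Sum>(v, w)\<leftarrow>xs. tens sv sw v w)" by blast
    then show ?case using Sv.subspace_scale[OF sub(1)]
      by (intro exI[of _ "(sv c v, w) # xs"]) (auto simp: tens_scale_left)
  qed
  then show ?thesis using that by blast
qed

lemma tlift_linear: "linear_on tscl (tspan sv V sw W) su U (tlift sv V sw W f)"
proof -
  interpret Sv: vector_space sv by (rule vs)
  interpret Su: vector_space su by (rule vs)
  show ?thesis unfolding linear_on_def
  proof (intro conjI ballI allI)
    fix x assume "x \<in> tspan sv V sw W"
    then obtain xs where xs: "set xs \<subseteq> V \<times> W" "x = (\<Sum>(v, w)\<leftarrow>xs. tens sv sw v w)"
      by (rule tspan_sum_list)
    have "(\<Sum>(v, w)\<leftarrow>xs. f v w) \<in> U" using xs(1)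
      by (induction xs) (use sub(3) bil in
        \<open>auto simp: Su.subspace_0 bilinear_on_def linear_on_def intro!: Su.subspace_add\<close>)
    then show "tlift sv V sw W f x \<in> U" using xs tlift_sum_list by simp
    fix c
    let ?ys = "map (\<lambda>(v, w). (sv c v, w)) xs"
    have ys: "set ?ys \<subseteq> V \<times> W" using xs(1) Sv.subspace_scale[OF sub(1)] by auto
    have "tscl c x = (\<Sum>(v, w)\<leftarrow>?ys. tens sv sw v w)" unfolding xs(2)
      by (induction xs) (auto simp: tens_scale_left, auto simp: tscl_def fun_eq_iff algebra_simps)
    moreover have "(\<Sum>(v, w)\<leftarrow>?ys. f v w) = su c (\<Sum>(v, w)\<leftarrow>xs. f v w)" using xs(1)
      by (induction xs) (use bil in
        \<open>auto simp: bilinear_on_def linear_on_def Su.scale_right_distrib\<close>)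
    ultimately show "tlift sv V sw W f (tscl c x) = su c (tlift sv V sw W f x)"
      using tlift_sum_list[OF ys] tlift_sum_list[OF xs(1)] xs(2) by simp
    fix y assume "y \<in> tspan sv V sw W"
    then obtain zs where zs: "set zs \<subseteq> V \<times> W" "y = (\<Sum>(v, w)\<leftarrow>zs. tens sv sw v w)"
      by (rule tspan_sum_list)
    have xz: "set (xs @ zs) \<subseteq> V \<times> W" using xs(1) zs(1) by simp
    show "tlift sv V sw W f (x + y) = tlift sv V sw W f x + tlift sv V sw W f y"
      using tlift_sum_list[OF xz] tlift_sum_list[OF xs(1)] tlift_sum_list[OF zs(1)] xs(2) zs(2)
      by simp
  qed
qed

end


section \<open>Finite-dimensional semisimple Hopf algebras\<close>

record ('k, 'h) hopf =
  hscl :: "'k \<Rightarrow> 'h \<Rightarrow> 'h"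
  comul :: "'h \<Rightarrow> ('h, 'h, 'k) tensor"
  counit :: "'h \<Rightarrow> 'k"
  antip :: "'h \<Rightarrow> 'h"

abbreviation htens :: "('k::field, 'h::ring_1, 'z) hopf_scheme \<Rightarrow> 'h \<Rightarrow> 'h \<Rightarrow> ('h, 'h, 'k) tensor" where
  "htens H \<equiv> tens (hscl H) (hscl H)"

text \<open>\<open>sweedler H f h\<close> is \<open>\<Sum> f h\<^sub>1 h\<^sub>2\<close> for a bilinear map \<open>f\<close>.\<close>

definition sweedler ::
  "('k::field, 'h::ring_1, 'z) hopf_scheme \<Rightarrow> ('h \<Rightarrow> 'h \<Rightarrow> 'u::ab_group_add) \<Rightarrow> 'h \<Rightarrow> 'u" where
  "sweedler H f h = tlift (hscl H) UNIV (hscl H) UNIV f (comul H h)"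

locale hopf_algebra = vector_space "hscl H"
  for H :: "('k::field, 'h::ring_1) hopf" +
  assumes scl_mult_left: "hscl H c (x * y) = hscl H c x * y"
    and scl_mult_right: "hscl H c (x * y) = x * hscl H c y"
    and comul_linear:
      "linear_on (hscl H) UNIV tscl (tspan (hscl H) UNIV (hscl H) UNIV) (comul H)"
    and coassoc:
      "sweedler H (\<lambda>x y. sweedler H (\<lambda>p q. tens (hscl H) tscl p (htens H q y)) x) h =
       sweedler H (\<lambda>x y. sweedler H (\<lambda>p q. tens (hscl H) tscl x (htens H p q)) y) h"
    and counit_linear: "linear_on (hscl H) UNIV (*) UNIV (counit H)"
    and counit_left: "sweedler H (\<lambda>x y. hscl H (counit H x) y) h = h"
    and counit_right: "sweedler H (\<lambda>x y. hscl H (counit H y) x) h = h"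
    and comul_one: "comul H 1 = htens H 1 1"
    and comul_mult:
      "comul H (g * h) = sweedler H (\<lambda>g1 g2. sweedler H (\<lambda>h1 h2. htens H (g1 * h1) (g2 * h2)) h) g"
    and counit_one: "counit H 1 = 1"
    and counit_mult: "counit H (g * h) = counit H g * counit H h"
    and antip_linear: "linear_on (hscl H) UNIV (hscl H) UNIV (antip H)"
    and antip_left: "sweedler H (\<lambda>x y. antip H x * y) h = hscl H (counit H h) 1"
    and antip_right: "sweedler H (\<lambda>x y. x * antip H y) h = hscl H (counit H h) 1"

definition finite_dim :: "('k::field, 'h::ring_1) hopf \<Rightarrow> bool" where
  "finite_dim H \<longleftrightarrow> (\<exists>B. finite B \<and> module.span (hscl H) B = UNIV)"

definition left_ideal :: "'h::ring_1 set \<Rightarrow> bool" where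
  "left_ideal I \<longleftrightarrow> 0 \<in> I \<and> (\<forall>x\<in>I. \<forall>y\<in>I. x + y \<in> I) \<and> (\<forall>a. \<forall>x\<in>I. a * x \<in> I)"

text \<open>The left regular module is semisimple: each of its submodules is a direct summand.\<close>

definition semisimple_ring :: "'h::ring_1 itself \<Rightarrow> bool" where
  "semisimple_ring _ \<longleftrightarrow>
     (\<forall>I :: 'h set. left_ideal I \<longrightarrow>
        (\<exists>J. left_ideal J \<and> I \<inter> J = {0} \<and> (\<forall>x. \<exists>i\<in>I. \<exists>j\<in>J. x = i + j)))"


section \<open>Complexes\<close>

record ('k, 'v) dgs =
  scl :: "'k \<Rightarrow> 'v \<Rightarrow> 'v"
  gr :: "int \<Rightarrow> 'v set"
  dif :: "'v \<Rightarrow> 'v"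

definition carr :: "('k::field, 'v::ab_group_add, 'z) dgs_scheme \<Rightarrow> 'v set" where
  "carr V = module.span (scl V) (\<Union>n. gr V n)"

locale dg_space = vector_space "scl V"
  for V :: "('k::field, 'v::ab_group_add, 'z) dgs_scheme" +
  assumes gr_subspace: "subspace (gr V n)"
    and gr_direct: "finite I \<Longrightarrow> (\<And>i. i \<in> I \<Longrightarrow> y i \<in> gr V i) \<Longrightarrow> (\<Sum>i\<in>I. y i) = 0 \<Longrightarrow>
          n \<in> I \<Longrightarrow> y n = 0"
    and dif_linear: "linear_on (scl V) (carr V) (scl V) (carr V) (dif V)"
    and dif_gr: "x \<in> gr V n \<Longrightarrow> dif V x \<in> gr V (n + 1)"
    and dif_dif: "x \<in> carr V \<Longrightarrow> dif V (dif V x) = 0"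

text \<open>The homogeneous components of an element of \<open>\<Oplus>\<^sub>n G n\<close>.\<close>

definition hcomp :: "(int \<Rightarrow> 'v::ab_group_add set) \<Rightarrow> 'v \<Rightarrow> int \<Rightarrow> 'v" where
  "hcomp G x = (THE c. finite {n. c n \<noteq> 0} \<and> (\<forall>n. c n \<in> G n) \<and> x = (\<Sum>n | c n \<noteq> 0. c n))"

text \<open>The sign \<open>(-1)\<^sup>n x\<close>.\<close>

definition ksgn :: "int \<Rightarrow> 'v::ab_group_add \<Rightarrow> 'v" where
  "ksgn n x = (if even n then x else - x)"

definition cocycles :: "('k, 'v::ab_group_add, 'z) dgs_scheme \<Rightarrow> int \<Rightarrow> 'v set" where
  "cocycles V n = {x \<in> gr V n. dif V x = 0}"

definition coboundaries :: "('k, 'v::ab_group_add, 'z) dgs_scheme \<Rightarrow> int \<Rightarrow> 'v set" where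
  "coboundaries V n = dif V ` gr V (n - 1)"

definition cohomologous :: "('k, 'v::ab_group_add, 'z) dgs_scheme \<Rightarrow> int \<Rightarrow> ('v \<times> 'v) set" where
  "cohomologous V n = {(x, y). x \<in> cocycles V n \<and> y \<in> cocycles V n \<and> x - y \<in> coboundaries V n}"

definition cohomology :: "('k, 'v::ab_group_add, 'z) dgs_scheme \<Rightarrow> int \<Rightarrow> 'v set set" where
  "cohomology V n = cocycles V n // cohomologous V n"

definition acyclic_dgs :: "('k, 'v::ab_group_add, 'z) dgs_scheme \<Rightarrow> bool" where
  "acyclic_dgs V \<longleftrightarrow> (\<forall>n. cocycles V n \<subseteq> coboundaries V n)"

definition dgs_hom ::
  "('k::field, 'v::ab_group_add, 'y) dgs_scheme \<Rightarrow> ('k, 'w::ab_group_add, 'z) dgs_scheme \<Rightarrow>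
    ('v \<Rightarrow> 'w) \<Rightarrow> bool" where
  "dgs_hom V W f \<longleftrightarrow> dg_space V \<and> dg_space W \<and>
     linear_on (scl V) (carr V) (scl W) (carr W) f \<and>
     (\<forall>n. \<forall>x\<in>gr V n. f x \<in> gr W n) \<and>
     (\<forall>x\<in>carr V. f (dif V x) = dif W (f x))"

text \<open>The map of complexes \<open>f\<close> induces a bijection on cohomology in each degree.\<close>

definition induces_iso ::
  "('k, 'v::ab_group_add, 'y) dgs_scheme \<Rightarrow> ('k, 'w::ab_group_add, 'z) dgs_scheme \<Rightarrow>
    ('v \<Rightarrow> 'w) \<Rightarrow> bool" where
  "induces_iso V W f \<longleftrightarrow>
     (\<forall>n. bij_betw (\<lambda>X. cohomologous W n `` (f ` X)) (cohomology V n) (cohomology W n))"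


section \<open>Dg algebras and dg modules\<close>

record ('k, 'a) dga = "('k, 'a) dgs" +
  mul :: "'a \<Rightarrow> 'a \<Rightarrow> 'a"
  unt :: 'a

locale dg_algebra = dg_space A
  for A :: "('k::field, 'a::ab_group_add, 'z) dga_scheme" +
  assumes mul_bilinear:
      "bilinear_on (scl A) (carr A) (scl A) (carr A) (scl A) (carr A) (mul A)"
    and mul_gr: "a \<in> gr A i \<Longrightarrow> b \<in> gr A j \<Longrightarrow> mul A a b \<in> gr A (i + j)"
    and mul_assoc: "a \<in> carr A \<Longrightarrow> b \<in> carr A \<Longrightarrow> c \<in> carr A \<Longrightarrow>
          mul A (mul A a b) c = mul A a (mul A b c)"
    and unt_gr: "unt A \<in> gr A 0"
    and unt_left: "a \<in> carr A \<Longrightarrow> mul A (unt A) a = a"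
    and unt_right: "a \<in> carr A \<Longrightarrow> mul A a (unt A) = a"
    and leibniz: "a \<in> gr A i \<Longrightarrow> b \<in> carr A \<Longrightarrow>
          dif A (mul A a b) = mul A (dif A a) b + ksgn i (mul A a (dif A b))"

definition dga_hom ::
  "('k::field, 'a::ab_group_add, 'y) dga_scheme \<Rightarrow> ('k, 'b::ab_group_add, 'z) dga_scheme \<Rightarrow>
    ('a \<Rightarrow> 'b) \<Rightarrow> bool" where
  "dga_hom A B f \<longleftrightarrow> dg_algebra A \<and> dg_algebra B \<and> dgs_hom A B f \<and>
     (\<forall>x\<in>carr A. \<forall>y\<in>carr A. f (mul A x y) = mul B (f x) (f y)) \<and> f (unt A) = unt B"

definition dga_quasi_iso ::
  "('k::field, 'a::ab_group_add, 'y) dga_scheme \<Rightarrow> ('k, 'b::ab_group_add, 'z) dga_scheme \<Rightarrow>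
    ('a \<Rightarrow> 'b) \<Rightarrow> bool" where
  "dga_quasi_iso A B f \<longleftrightarrow> dga_hom A B f \<and> induces_iso A B f"

locale dg_module = B: dg_algebra B + M: dg_space M
  for B :: "('k::field, 'b::ab_group_add, 'y) dga_scheme"
    and M :: "('k, 'm::ab_group_add, 'z) dgs_scheme"
    and act :: "'b \<Rightarrow> 'm \<Rightarrow> 'm" +
  assumes act_bilinear:
      "bilinear_on (scl B) (carr B) (scl M) (carr M) (scl M) (carr M) act"
    and act_gr: "b \<in> gr B i \<Longrightarrow> m \<in> gr M j \<Longrightarrow> act b m \<in> gr M (i + j)"
    and act_mul: "a \<in> carr B \<Longrightarrow> b \<in> carr B \<Longrightarrow> m \<in> carr M \<Longrightarrow>
          act (mul B a b) m = act a (act b m)"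
    and act_unt: "m \<in> carr M \<Longrightarrow> act (unt B) m = m"
    and act_leibniz: "b \<in> gr B i \<Longrightarrow> m \<in> carr M \<Longrightarrow>
          dif M (act b m) = act (dif B b) m + ksgn i (act b (dif M m))"

definition dg_module_hom ::
  "('k::field, 'b::ab_group_add, 'x) dga_scheme \<Rightarrow>
    ('k, 'm::ab_group_add, 'y) dgs_scheme \<Rightarrow> ('b \<Rightarrow> 'm \<Rightarrow> 'm) \<Rightarrow>
    ('k, 'n::ab_group_add, 'z) dgs_scheme \<Rightarrow> ('b \<Rightarrow> 'n \<Rightarrow> 'n) \<Rightarrow> ('m \<Rightarrow> 'n) \<Rightarrow> bool" where
  "dg_module_hom B M actM N actN f \<longleftrightarrow>
     dg_module B M actM \<and> dg_module B N actN \<and> dgs_hom M N f \<and>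
     (\<forall>b\<in>carr B. \<forall>m\<in>carr M. f (actM b m) = actN b (f m))"


section \<open>Hom complexes and K-projective resolutions\<close>

text \<open>
  Elements of Hom complexes are represented by functions that vanish outside the carrier of the
  source.
\<close>

definition hom_gr ::
  "('k::field, 'b::ab_group_add, 'x) dga_scheme \<Rightarrow>
    ('k, 'm::ab_group_add, 'y) dgs_scheme \<Rightarrow> ('b \<Rightarrow> 'm \<Rightarrow> 'm) \<Rightarrow>
    ('k, 'n::ab_group_add, 'z) dgs_scheme \<Rightarrow> ('b \<Rightarrow> 'n \<Rightarrow> 'n) \<Rightarrow> int \<Rightarrow> ('m \<Rightarrow> 'n) set" where
  "hom_gr B M actM N actN i = {f.
     linear_on (scl M) (carr M) (scl N) (carr N) f \<and>
     (\<forall>x. x \<notin> carr M \<longrightarrow> f x = 0) \<and>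
     (\<forall>j. \<forall>x\<in>gr M j. f x \<in> gr N (i + j)) \<and>
     (\<forall>j. \<forall>b\<in>gr B j. \<forall>m\<in>carr M. f (actM b m) = ksgn (i * j) (actN b (f m)))}"

definition hom_dgs ::
  "('k::field, 'b::ab_group_add, 'x) dga_scheme \<Rightarrow>
    ('k, 'm::ab_group_add, 'y) dgs_scheme \<Rightarrow> ('b \<Rightarrow> 'm \<Rightarrow> 'm) \<Rightarrow>
    ('k, 'n::ab_group_add, 'z) dgs_scheme \<Rightarrow> ('b \<Rightarrow> 'n \<Rightarrow> 'n) \<Rightarrow> ('k, 'm \<Rightarrow> 'n) dgs" where
  "hom_dgs B M actM N actN =
     \<lparr>scl = (\<lambda>c f x. scl N c (f x)),
      gr = hom_gr B M actM N actN,
      dif = (\<lambda>f. let f' = hcomp (hom_gr B M actM N actN) f in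
               \<Sum>i | f' i \<noteq> 0. (\<lambda>x. if x \<in> carr M then dif N (f' i x) - ksgn i (f' i (dif M x)) else 0))\<rparr>"

text \<open>The dg algebra \<open>Hom\<^sub>B(M, M)\<close>, with \<open>f * g = (-1)\<^bsup>|f||g|\<^esup> g \<circ> f\<close> for homogeneous \<open>f\<close> and \<open>g\<close>.\<close>

definition end_dga ::
  "('k::field, 'b::ab_group_add, 'x) dga_scheme \<Rightarrow>
    ('k, 'm::ab_group_add, 'y) dgs_scheme \<Rightarrow> ('b \<Rightarrow> 'm \<Rightarrow> 'm) \<Rightarrow> ('k, 'm \<Rightarrow> 'm) dga" where
  "end_dga B M act =
     \<lparr>scl = scl (hom_dgs B M act M act),
      gr = gr (hom_dgs B M act M act),
      dif = dif (hom_dgs B M act M act),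
      mul = (\<lambda>f g. let f' = hcomp (hom_gr B M act M act) f; g' = hcomp (hom_gr B M act M act) g in
               \<Sum>i | f' i \<noteq> 0. \<Sum>j | g' j \<noteq> 0. ksgn (i * j) (g' j \<circ> f' i)),
      unt = (\<lambda>x. if x \<in> carr M then x else 0)\<rparr>"

text \<open>
  HOL cannot quantify over all types here, so the test modules \<open>N\<close> are those whose underlying
  set is contained in the fixed vector space \<open>(nat \<times> 'b) list \<times> 'p \<Rightarrow> 'k\<close>.
  This is no restriction, by \<open>K_projective_test\<close> below: the condition then holds for dg modules
  \<open>N\<close> in an arbitrary type.  A cocycle of \<open>Hom\<^sub>B(P, N)\<close> with \<open>N\<close> acyclic takes values in an
  acyclic submodule spanned by a family indexed by \<open>(nat \<times> 'b) list \<times> 'p\<close>, obtained by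
  closing its image up under \<open>B\<close>, \<open>d\<close> and linear sections of \<open>d\<close>.
\<close>

definition K_projective ::
  "('k::field, 'b::ab_group_add, 'y) dga_scheme \<Rightarrow>
    ('k, 'p::ab_group_add, 'z) dgs_scheme \<Rightarrow> ('b \<Rightarrow> 'p \<Rightarrow> 'p) \<Rightarrow> bool" where
  "K_projective B P act \<longleftrightarrow> dg_module B P act \<and>
     (\<forall>(N :: ('k, (nat \<times> 'b) list \<times> 'p \<Rightarrow> 'k) dgs) actN.
        dg_module B N actN \<longrightarrow> acyclic_dgs N \<longrightarrow> acyclic_dgs (hom_dgs B P act N actN))"

context dg_space
begin

lemma carr_subspace: "subspace (carr V)"
  unfolding carr_def by simp

lemma gr_carr: "x \<in> gr V n \<Longrightarrow> x \<in> carr V"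
  unfolding carr_def by (rule span_base) blast

lemma carr_induct [consumes 1, case_names gr zero add]:
  assumes "x \<in> carr V" and gr: "\<And>n x. x \<in> gr V n \<Longrightarrow> Q x" and "Q 0"
    and add: "\<And>x y. x \<in> carr V \<Longrightarrow> y \<in> carr V \<Longrightarrow> Q x \<Longrightarrow> Q y \<Longrightarrow> Q (x + y)"
  shows "Q x"
proof -
  have "x \<in> carr V \<and> Q x"
    using assms(1) unfolding carr_def
  proof (induction rule: span_induct_alt)
    case base
    show ?case using \<open>Q 0\<close> span_zero by simp
  next
    case (step c x y)
    then obtain n where "x \<in> gr V n" by blast
    then have "scl V c x \<in> gr V n" using subspace_scale gr_subspace by blast
    then show ?case using step.IH gr add gr_carr subspace_add[OF carr_subspace]
      unfolding carr_def by blast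
  qed
  then show ?thesis ..
qed

end

lemma linear_ksgn:
  assumes "Vector_Spaces.linear s1 s2 \<phi>"
  shows "\<phi> (ksgn n x) = ksgn n (\<phi> x)"
  using module_hom.neg[OF Vector_Spaces.linear.axioms(3)[OF assms]] by (simp add: ksgn_def)

lemma ksgn_diff: "ksgn n (x - y) = ksgn n x - ksgn n y"
  by (simp add: ksgn_def)

lemma sum_apply: "(\<Sum>i\<in>I. f i) x = (\<Sum>i\<in>I. f i x)"
  by (induction I rule: infinite_finite_induct) auto

lemma hom_gr_sum_zero:
  assumes "dg_space P" "dg_space N" "finite I"
    and c: "\<And>n. n \<in> I \<Longrightarrow> c n \<in> hom_gr B P actP N actN n"
    and sum: "(\<Sum>n\<in>I. c n) = 0" and "n \<in> I"
  shows "c n = 0"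
proof -
  interpret P: dg_space P by fact
  interpret N: dg_space N by fact
  have lin: "linear_on (scl P) (carr P) (scl N) (carr N) (c m)" if "m \<in> I" for m
    using c[OF that] by (simp add: hom_gr_def)
  have sum': "(\<Sum>m\<in>I. c m x) = 0" for x
    using fun_cong[OF sum, of x] by (simp add: sum_apply)
  have "c n x = 0" if "x \<in> carr P" for x
    using that
  proof (induction rule: P.carr_induct)
    case (gr j x)
    have "(\<Sum>k\<in>(\<lambda>m. m + j) ` I. c (k - j) x) = (\<Sum>m\<in>I. c m x)"
      by (subst sum.reindex) (auto simp: inj_on_def)
    moreover have "c (k - j) x \<in> gr N k" if "k \<in> (\<lambda>m. m + j) ` I" for k
      using that c gr unfolding hom_gr_def by auto
    ultimately show ?case
      using N.gr_direct[of "(\<lambda>m. m + j) ` I" "\<lambda>k. c (k - j) x" "n + j"] sum' \<open>finite I\<close> \<open>n \<in> I\<close>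
      by auto
  next
    case zero
    have "c n (0 + 0) = c n 0 + c n 0"
      using lin[OF \<open>n \<in> I\<close>] P.subspace_0[OF P.carr_subspace] unfolding linear_on_def by blast
    then show ?case by simp
  next
    case (add x y)
    then show ?case using lin[OF \<open>n \<in> I\<close>] by (simp add: linear_on_def)
  qed
  moreover have "c n x = 0" if "x \<notin> carr P" for x
    using c[OF \<open>n \<in> I\<close>] that by (simp add: hom_gr_def)
  ultimately show ?thesis by (auto simp: fun_eq_iff)
qed

lemma zero_hom_gr:
  assumes "dg_space P" "dg_space N" "dg_module B N actN"
  shows "0 \<in> hom_gr B P actP N actN n"
proof -
  interpret P: dg_space P by fact
  interpret N: dg_space N by fact
  interpret M: dg_module B N actN by fact
  have "actN b 0 = 0" if "b \<in> carr B" for b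
  proof -
    have "actN b (0 + 0) = actN b 0 + actN b 0"
      using M.act_bilinear that N.subspace_0[OF N.carr_subspace]
      unfolding bilinear_on_def linear_on_def by blast
    then show ?thesis by simp
  qed
  then show ?thesis
    using M.B.gr_carr
    by (auto simp: hom_gr_def linear_on_def ksgn_def N.subspace_0 N.carr_subspace N.gr_subspace)
qed

lemma hcomp_hom_gr:
  assumes "dg_space P" "dg_space N" "dg_module B N actN" "f \<in> hom_gr B P actP N actN i"
  shows "hcomp (hom_gr B P actP N actN) f = (\<lambda>n. if n = i then f else 0)"
  unfolding hcomp_def
proof (rule the_equality)
  let ?c = "\<lambda>n. if n = i then f else 0"
  have "{n. ?c n \<noteq> 0} = (if f = 0 then {} else {i})" by auto
  then show "finite {n. ?c n \<noteq> 0} \<and> (\<forall>n. ?c n \<in> hom_gr B P actP N actN n) \<and>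
      f = (\<Sum>n | ?c n \<noteq> 0. ?c n)"
    using assms(4) zero_hom_gr[OF assms(1-3)] by auto
next
  interpret N: dg_space N by (rule assms)
  fix c assume c: "finite {n. c n \<noteq> 0} \<and> (\<forall>n. c n \<in> hom_gr B P actP N actN n) \<and>
      f = (\<Sum>n | c n \<noteq> 0. c n)"
  define I where "I = insert i {n. c n \<noteq> 0}"
  have fin: "finite I" and iI: "i \<in> I" using c by (auto simp: I_def)
  have "(\<Sum>n\<in>I. c n) = (\<Sum>n | c n \<noteq> 0. c n)"
    by (rule sum.mono_neutral_right) (auto simp: fin, auto simp: I_def)
  then have "(\<Sum>n\<in>I. c n) = f" using c by simp
  moreover have "(\<Sum>n\<in>I. if n = i then f else 0) = f" using fin iI by simp
  ultimately have s: "(\<Sum>n\<in>I. c n - (if n = i then f else 0)) = 0" by (simp add: sum_subtractf)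
  have d: "g - h \<in> hom_gr B P actP N actN n"
    if "g \<in> hom_gr B P actP N actN n" "h \<in> hom_gr B P actP N actN n" for g h n
  proof -
    interpret M: dg_module B N actN by (rule assms)
    have act_diff: "actN b (x - y) = actN b x - actN b y"
      if "b \<in> carr B" "x \<in> carr N" "y \<in> carr N" for b x y
    proof -
      have "actN b ((x - y) + y) = actN b (x - y) + actN b y"
        using M.act_bilinear that N.subspace_diff[OF N.carr_subspace]
        unfolding bilinear_on_def linear_on_def by blast
      then show ?thesis by (simp add: algebra_simps)
    qed
    show ?thesis
      using that M.B.gr_carr
      by (auto simp: hom_gr_def linear_on_def act_diff ksgn_diff N.subspace_diff N.carr_subspace
          N.gr_subspace N.scale_right_diff_distrib)
  qed
  have "c n - (if n = i then f else 0) = 0" if "n \<in> I" for n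
    using hom_gr_sum_zero[OF assms(1,2) fin, of "\<lambda>n. c n - (if n = i then f else 0)" B actP actN n]
      d c s that assms(4) zero_hom_gr[OF assms(1-3)] by auto
  then have "c n = (if n = i then f else 0)" if "n \<in> I" for n using that by simp
  moreover have "c n = (if n = i then f else 0)" if "n \<notin> I" for n using that by (simp add: I_def)
  ultimately show "c = (\<lambda>n. if n = i then f else 0)" by blast
qed

lemma hom_dgs_dif:
  assumes "dg_space P" "dg_space N" "dg_module B N actN" "f \<in> hom_gr B P actP N actN i"
  shows "dif (hom_dgs B P actP N actN) f =
    (\<lambda>x. if x \<in> carr P then dif N (f x) - ksgn i (f (dif P x)) else 0)"
proof -
  interpret N: dg_space N by (rule assms)
  have "dif N (0 + 0) = dif N 0 + dif N 0"
    using N.dif_linear N.subspace_0[OF N.carr_subspace] unfolding linear_on_def by blast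
  then have [simp]: "dif N 0 = 0" by simp
  let ?c = "\<lambda>n. if n = i then f else 0"
  have "{n. ?c n \<noteq> 0} = (if f = 0 then {} else {i})" by auto
  then show ?thesis
    by (cases "f = 0") (auto simp: hom_dgs_def Let_def hcomp_hom_gr[OF assms] fun_eq_iff ksgn_def)
qed

theorem K_projective_test:
  fixes B :: "('k::field, 'b::ab_group_add, 'x) dga_scheme"
    and P :: "('k, 'p::ab_group_add, 'y) dgs_scheme"
    and N :: "('k, 'n::ab_group_add, 'z) dgs_scheme"
  assumes proj: "K_projective B P actP" and "dg_module B N actN" and acyclic: "acyclic_dgs N"
  shows "acyclic_dgs (hom_dgs B P actP N actN)"
  unfolding acyclic_dgs_def
proof (intro allI subsetI)
  fix i f assume fcoc: "f \<in> cocycles (hom_dgs B P actP N actN) i"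
  interpret P: dg_module B P actP using proj by (simp add: K_projective_def)
  interpret N: dg_module B N actN by fact
  note Psp = P.M.dg_space_axioms and Nsp = N.M.dg_space_axioms
  let ?s = "scl N"
  have f: "f \<in> hom_gr B P actP N actN i" and "dif (hom_dgs B P actP N actN) f = 0"
    using fcoc by (auto simp: cocycles_def hom_dgs_def)
  then have D: "(\<lambda>x. if x \<in> carr P then dif N (f x) - ksgn i (f (dif P x)) else 0) = 0"
    by (simp add: hom_dgs_dif[OF Psp Nsp N.dg_module_axioms f])
  have fd: "dif N (f x) - ksgn i (f (dif P x)) = 0" if "x \<in> carr P" for x
    using fun_cong[OF D, of x] that by simp
  have f0: "f 0 = 0"
  proof -
    have "f (0 + 0) = f 0 + f 0"
      using f P.M.subspace_0[OF P.M.carr_subspace]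
      unfolding hom_gr_def linear_on_def by blast
    then show ?thesis by simp
  qed

  have "\<exists>\<sigma>. Vector_Spaces.linear ?s ?s \<sigma> \<and> range \<sigma> \<subseteq> gr N (j - 1) \<and>
      (\<forall>z\<in>cocycles N j. dif N (\<sigma> z) = z)" for j
  proof -
    obtain p where p: "Vector_Spaces.linear ?s ?s p" "range p \<subseteq> gr N (j - 1)"
      "\<And>x. x \<in> gr N (j - 1) \<Longrightarrow> p x = x"
      using exists_projection[OF N.M.vector_space_axioms N.M.gr_subspace] by blast
    have pc: "p x \<in> carr N" for x using p(2) N.M.gr_carr by blast
    have "Vector_Spaces.linear ?s ?s (\<lambda>x. dif N (p x))"
      using p(1) N.M.dif_linear pc by (simp add: Vector_Spaces.linear_iff linear_on_def)
    then obtain g where g: "range g \<subseteq> gr N (j - 1)" "Vector_Spaces.linear ?s ?s g"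
      "\<forall>v\<in>(\<lambda>x. dif N (p x)) ` gr N (j - 1). dif N (p (g v)) = v"
      using vector_space_pair.linear_exists_right_inverse_on[OF _ _ N.M.gr_subspace]
        N.M.vector_space_axioms unfolding vector_space_pair_def by blast
    have "dif N (g z) = z" if "z \<in> cocycles N j" for z
    proof -
      from that obtain y where y: "y \<in> gr N (j - 1)" "z = dif N y"
        using acyclic unfolding acyclic_dgs_def coboundaries_def by blast
      then have "z \<in> (\<lambda>x. dif N (p x)) ` gr N (j - 1)" using p(3) by force
      moreover have "p (g z) = g z" using g(1) p(3) by blast
      ultimately show ?thesis using g(3) by force
    qed
    then show ?thesis using g by blast
  qed
  then obtain \<sigma> where sl: "\<And>j. Vector_Spaces.linear ?s ?s (\<sigma> j)"
    and sr: "\<And>j x. \<sigma> j x \<in> gr N (j - 1)"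
    and sz: "\<And>j z. z \<in> cocycles N j \<Longrightarrow> dif N (\<sigma> j z) = z"
    by (metis rangeI subsetD)

  define letter where "letter = (\<lambda>(n :: nat, b) y.
     if n = 0 then actN b y else if n = 1 then dif N y else \<sigma> (int_decode (n - 2)) y)"
  define ev where "ev = (\<lambda>(l, x). foldr letter l (f x))"
  define W where "W j = {w \<in> gr N j. w \<in> range ev}" for j
  have Wf: "f x \<in> W (i + j)" if "x \<in> gr P j" for x j
  proof -
    have "f x = ev ([], x)" by (simp add: ev_def)
    then show ?thesis using f that unfolding W_def hom_gr_def by blast
  qed
  have Wl: "letter (n, b) w \<in> W k" if "w \<in> W j" "letter (n, b) w \<in> gr N k" for n b w j k
  proof -
    from that(1) obtain l x where "w = ev (l, x)" unfolding W_def by force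
    then have "letter (n, b) w = ev ((n, b) # l, x)" by (simp add: ev_def)
    then show ?thesis using that(2) unfolding W_def by blast
  qed
  have Wgr: "W j \<subseteq> gr N j" for j by (auto simp: W_def)
  have Wa: "actN b w \<in> W (k + j)" if "w \<in> W j" "b \<in> gr B k" for b w j k
    using Wl[OF that(1), of 0 b "k + j"] that(2) N.act_gr Wgr[of j] that(1)
    by (auto simp: letter_def)
  have Wd: "dif N w \<in> W (j + 1)" if "w \<in> W j" for w j
    using Wl[OF that(1), of 1 _ "j + 1"] N.M.dif_gr Wgr[of j] that(1)
    by (auto simp: letter_def)
  have Ws: "\<sigma> j w \<in> W (j - 1)" if "w \<in> W j" for w j
    using Wl[OF that(1), of "int_encode j + 2" _ "j - 1"] sr by (auto simp: letter_def)

  define N' where "N' j = N.M.span (W j)" for j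
  define C where "C = N.M.span (\<Union>j. N' j)"
  have N'sub: "N.M.subspace (N' j)" for j by (simp add: N'_def)
  have N'gr: "N' j \<subseteq> gr N j" for j
    unfolding N'_def by (rule N.M.span_minimal[OF Wgr N.M.gr_subspace])
  have Csub: "N.M.subspace C" by (simp add: C_def)
  have N'C: "x \<in> N' j \<Longrightarrow> x \<in> C" for x j unfolding C_def by (rule N.M.span_base) blast
  have Ccarr: "x \<in> carr N" if "x \<in> C" for x
    using N.M.span_minimal[OF _ N.M.carr_subspace, of "\<Union>j. N' j"] N'gr N.M.gr_carr that
    unfolding C_def by blast
  have CW: "C = N.M.span (\<Union>j. W j)"
  proof (rule subset_antisym)
    have "N' j \<subseteq> N.M.span (\<Union>j. W j)" for j unfolding N'_def by (rule N.M.span_mono) blast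
    then show "C \<subseteq> N.M.span (\<Union>j. W j)" unfolding C_def by (intro N.M.span_minimal) auto
    have "(\<Union>j. W j) \<subseteq> C" using N'C N.M.span_base unfolding N'_def by blast
    then show "N.M.span (\<Union>j. W j) \<subseteq> C" by (rule N.M.span_minimal[OF _ Csub])
  qed
  have span_closed: "\<phi> x \<in> N' k" if "x \<in> N' j" and "\<And>w. w \<in> W j \<Longrightarrow> \<phi> w \<in> W k"
    and "linear_on ?s (carr N) ?s (carr N) \<phi>" for \<phi> x j k
  proof -
    have 0: "\<phi> 0 = 0"
    proof -
      have "\<phi> (0 + 0) = \<phi> 0 + \<phi> 0"
        using that(3) N.M.subspace_0[OF N.M.carr_subspace] unfolding linear_on_def by blast
      then show ?thesis by simp
    qed
    have "\<phi> x \<in> N' k \<and> x \<in> carr N" using that(1) unfolding N'_def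
    proof (induction rule: N.M.span_induct_alt)
      case base
      show ?case using 0 N.M.span_zero N.M.subspace_0[OF N.M.carr_subspace] by simp
    next
      case (step c x y)
      then have x: "x \<in> carr N" "\<phi> x \<in> N.M.span (W k)"
        using Wgr N.M.gr_carr that(2) N.M.span_base by blast+
      then have "?s c x \<in> carr N" by (simp add: N.M.subspace_scale N.M.carr_subspace)
      then show ?case using x step.IH that(3)
        by (simp add: linear_on_def N.M.subspace_add N.M.carr_subspace N.M.span_add N.M.span_scale)
    qed
    then show ?thesis ..
  qed
  have act_lin: "linear_on ?s (carr N) ?s (carr N) (actN b)" if "b \<in> carr B" for b
    using N.act_bilinear that by (simp add: bilinear_on_def)
  have N'a: "actN b x \<in> N' (k + j)" if "x \<in> N' j" "b \<in> gr B k" for b x j k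
    using span_closed[OF that(1) _ act_lin] Wa that(2) P.B.gr_carr by blast
  have N'd: "dif N x \<in> N' (j + 1)" if "x \<in> N' j" for x j
    using span_closed[OF that(1) Wd N.M.dif_linear] .
  have N's: "\<sigma> j x \<in> N' (j - 1)" if "x \<in> N' j" for x j
  proof (rule span_closed[OF that, of "\<sigma> j"])
    show "\<sigma> j w \<in> W (j - 1)" if "w \<in> W j" for w by (rule Ws[OF that])
    show "linear_on ?s (carr N) ?s (carr N) (\<sigma> j)"
      by (rule linear_on_subset[OF sl]) (use sr N.M.gr_carr in blast)
  qed
  have C_induct: "Q x" if "x \<in> C" "\<And>j y. y \<in> N' j \<Longrightarrow> Q y"
    "\<And>x y. x \<in> C \<Longrightarrow> y \<in> C \<Longrightarrow> Q x \<Longrightarrow> Q y \<Longrightarrow> Q (x + y)" for Q x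
  proof -
    have "Q x \<and> x \<in> C" using that(1) unfolding C_def
    proof (induction rule: N.M.span_induct_alt)
      case base
      show ?case using that(2)[of 0 0] N.M.subspace_0[OF N'sub] N.M.span_zero by blast
    next
      case (step c x y)
      then obtain j where "x \<in> N' j" by blast
      then have "?s c x \<in> N' j" by (rule N.M.subspace_scale[OF N'sub])
      then show ?case using that(2,3) step.IH N'C N.M.subspace_add[OF Csub]
        unfolding C_def[symmetric] by blast
    qed
    then show ?thesis ..
  qed
  have Cd: "dif N x \<in> C" if "x \<in> C" for x
    using that
  proof (rule C_induct)
    show "dif N y \<in> C" if "y \<in> N' j" for y j using N'd[OF that] N'C by blast
    show "dif N (x + y) \<in> C" if "x \<in> C" "y \<in> C" "dif N x \<in> C" "dif N y \<in> C" for x y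
      using that N.M.dif_linear Ccarr N.M.subspace_add[OF Csub] by (simp add: linear_on_def)
  qed
  have Ca: "actN b x \<in> C" if "b \<in> carr B" "x \<in> C" for b x
    using that
  proof (induction b arbitrary: x rule: P.B.carr_induct)
    case (gr n b)
    from gr(2) show ?case
    proof (rule C_induct)
      show "actN b y \<in> C" if "y \<in> N' j" for y j using N'a[OF that gr(1)] N'C by blast
      show "actN b (x + y) \<in> C" if "x \<in> C" "y \<in> C" "actN b x \<in> C" "actN b y \<in> C" for x y
        using that act_lin[OF P.B.gr_carr[OF gr(1)]] Ccarr N.M.subspace_add[OF Csub]
        by (simp add: linear_on_def)
    qed
  next
    case zero
    have "0 \<in> carr B" using P.B.subspace_0[OF P.B.carr_subspace] .
    then have "actN (0 + 0) x = actN 0 x + actN 0 x"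
      using N.act_bilinear Ccarr[OF zero] unfolding bilinear_on_def linear_on_def by blast
    then show ?case using N.M.subspace_0[OF Csub] by simp
  next
    case (add a b)
    then show ?case
      using N.act_bilinear Ccarr[OF add.prems] N.M.subspace_add[OF Csub]
      by (simp add: bilinear_on_def linear_on_def)
  qed
  have fC: "f x \<in> C" if "x \<in> carr P" for x
    using that
  proof (induction rule: P.M.carr_induct)
    case (gr n x)
    then show ?case using Wf N'C N.M.span_base unfolding N'_def by blast
  next
    case zero
    show ?case using f0 N.M.subspace_0[OF Csub] by simp
  next
    case (add x y)
    then show ?case using f N.M.subspace_add[OF Csub] by (simp add: hom_gr_def linear_on_def)
  qed

  obtain Bs where Bs: "Bs \<subseteq> (\<Union>j. W j)" "N.M.independent Bs" "(\<Union>j. W j) \<subseteq> N.M.span Bs"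
    by (rule N.M.maximal_independent_subset[of "\<Union>j. W j"])
  have CBs: "C = N.M.span Bs"
    unfolding CW using N.M.span_minimal[OF Bs(3) N.M.subspace_span] N.M.span_mono[OF Bs(1)]
    by (rule subset_antisym)
  have Bs_ev: "Bs \<subseteq> range ev" using Bs(1) by (auto simp: W_def)
  obtain p where p: "Vector_Spaces.linear ?s ?s p" "range p \<subseteq> C" "\<And>x. x \<in> C \<Longrightarrow> p x = x"
    using exists_projection[OF N.M.vector_space_axioms Csub] by blast
  have pC: "p x \<in> N.M.span Bs" for x using p(2) CBs by blast
  define su where "su = (\<lambda>c (g :: (nat \<times> 'b) list \<times> 'p \<Rightarrow> 'k) \<iota>. c * g \<iota>)"
  have vsu: "vector_space su" unfolding su_def by (rule vector_space_fun[OF vector_space_mult])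
  interpret U: vector_space su by (rule vsu)
  interpret NU: vector_space_pair ?s su by unfold_locales
  define e where "e y = (\<lambda>\<iota>. N.M.representation Bs (p y) (ev \<iota>))" for y
  have e: "Vector_Spaces.linear ?s su e"
    using p(1) vsu N.M.vector_space_axioms
    by (auto simp: Vector_Spaces.linear_iff e_def su_def fun_eq_iff pC Bs(2)
        N.M.representation_add N.M.representation_scale)
  interpret e: Vector_Spaces.linear ?s su e by (rule e)
  have "inj_on e C"
  proof (rule inj_onI)
    fix x y assume xy: "x \<in> C" "y \<in> C" "e x = e y"
    have "N.M.representation Bs x b = N.M.representation Bs y b" for b
    proof (cases "b \<in> Bs")
      case True
      then obtain \<iota> where "b = ev \<iota>" using Bs_ev by blast
      then show ?thesis using fun_cong[OF xy(3), of \<iota>] xy(1,2) p(3) by (simp add: e_def)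
    next
      case False
      then show ?thesis using N.M.representation_ne_zero by metis
    qed
    then have "N.M.representation Bs x = N.M.representation Bs y" by blast
    then show "x = y"
      using N.M.sum_nonzero_representation_eq[OF Bs(2)] xy(1,2) CBs by metis
  qed
  then obtain r where r: "range r \<subseteq> C" "Vector_Spaces.linear su ?s r" "\<And>x. x \<in> C \<Longrightarrow> r (e x) = x"
    using NU.linear_exists_left_inverse_on[OF e Csub] by blast
  interpret r: Vector_Spaces.linear su ?s r by (rule r)
  have rC: "r y \<in> C" for y using r(1) by blast

  define U where "U = \<lparr>scl = su, gr = (\<lambda>n. e ` N' n), dif = (\<lambda>y. e (dif N (r y)))\<rparr>"
  define actU where "actU b y = e (actN b (r y))" for b y
  have simps [simp]: "scl U = su" "gr U n = e ` N' n" "dif U y = e (dif N (r y))" for n y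
    by (simp_all add: U_def)
  have carrU: "carr U = e ` C"
    unfolding carr_def C_def by (simp add: e.span_image[symmetric] image_UN)
  have eC: "e x \<in> carr U" if "x \<in> C" for x using that carrU by blast
  have er: "e (r y) = y" if "y \<in> carr U" for y using that r(3) unfolding carrU by auto
  have dN: "dif N (x + y) = dif N x + dif N y" if "x \<in> C" "y \<in> C" for x y
    using N.M.dif_linear that Ccarr by (auto simp: linear_on_def)
  have dN': "dif N (?s c x) = ?s c (dif N x)" if "x \<in> C" for x c
    using N.M.dif_linear that Ccarr by (auto simp: linear_on_def)
  have aN: "actN b (x + y) = actN b x + actN b y" if "b \<in> carr B" "x \<in> C" "y \<in> C" for b x y
    using act_lin[OF that(1)] that Ccarr by (auto simp: linear_on_def)
  have aN': "actN b (?s c x) = ?s c (actN b x)" if "b \<in> carr B" "x \<in> C" for b x c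
    using act_lin[OF that(1)] that Ccarr by (auto simp: linear_on_def)
  have aB: "actN (a + b) x = actN a x + actN b x" if "a \<in> carr B" "b \<in> carr B" "x \<in> C" for a b x
    using N.act_bilinear that Ccarr by (auto simp: bilinear_on_def linear_on_def)
  have aB': "actN (scl B c a) x = ?s c (actN a x)" if "a \<in> carr B" "x \<in> C" for a x c
    using N.act_bilinear that Ccarr by (auto simp: bilinear_on_def linear_on_def)
  have spU: "dg_space U"
  proof (intro dg_space.intro dg_space_axioms.intro)
    show "vector_space (scl U)" using vsu by simp
    show "module.subspace (scl U) (gr U n)" for n
      using e.subspace_image[OF N'sub] by simp
    show "y n = 0" if "finite I" "\<And>i. i \<in> I \<Longrightarrow> y i \<in> gr U i" "(\<Sum>i\<in>I. y i) = 0" "n \<in> I"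
      for I y n
    proof -
      have ry: "r (y j) \<in> N' j" "e (r (y j)) = y j" if "j \<in> I" for j
        using \<open>\<And>i. i \<in> I \<Longrightarrow> y i \<in> gr U i\<close>[OF that] r(3) N'C by auto
      have "(\<Sum>j\<in>I. r (y j)) = 0" using that(3) r.sum[of y I] by simp
      then have "r (y n) = 0"
        using N.M.gr_direct[OF that(1), of "\<lambda>j. r (y j)"] ry(1) N'gr that(4) by blast
      then show ?thesis using ry(2)[OF that(4)] by simp
    qed
    show "linear_on (scl U) (carr U) (scl U) (carr U) (dif U)"
      using dN dN' rC Cd eC by (auto simp: linear_on_def r.add r.scale e.add e.scale)
    show "dif U y \<in> gr U (n + 1)" if "y \<in> gr U n" for y n
      using that N'd r(3) N'C by auto
    show "dif U (dif U y) = 0" if "y \<in> carr U" for y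
      using that r(3) Cd rC N.M.dif_dif Ccarr by simp
  qed
  interpret US: dg_space U by (rule spU)
  have modU: "dg_module B U actU"
  proof (intro dg_module.intro dg_module_axioms.intro)
    show "dg_algebra B" "dg_space U" by (fact P.B.dg_algebra_axioms, fact spU)
    show "bilinear_on (scl B) (carr B) (scl U) (carr U) (scl U) (carr U) actU"
      using aN aN' aB aB' rC Ca eC
      by (auto simp: bilinear_on_def linear_on_def actU_def r.add r.scale e.add e.scale)
    show "actU b m \<in> gr U (i + j)" if "b \<in> gr B i" "m \<in> gr U j" for b m i j
      using that N'a r(3) N'C by (auto simp: actU_def)
    show "actU (mul B a b) m = actU a (actU b m)"
      if "a \<in> carr B" "b \<in> carr B" "m \<in> carr U" for a b m
      using that N.act_mul Ca rC r(3) Ccarr by (simp add: actU_def)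
    show "actU (unt B) m = m" if "m \<in> carr U" for m
      using er[OF that] N.act_unt Ccarr rC by (simp add: actU_def)
    show "dif U (actU b m) = actU (dif B b) m + ksgn i (actU b (dif U m))"
      if "b \<in> gr B i" "m \<in> carr U" for b m i
    proof -
      have "dif U (actU b m) = e (dif N (actN b (r m)))"
        using Ca[OF P.B.gr_carr[OF that(1)] rC] r(3) by (simp add: actU_def)
      also have "\<dots> = e (actN (dif B b) (r m)) + ksgn i (e (actN b (dif N (r m))))"
        using N.act_leibniz[OF that(1) Ccarr[OF rC]] by (simp add: e.add linear_ksgn[OF e])
      finally show ?thesis using Cd[OF rC] r(3) by (simp add: actU_def)
    qed
  qed
  have acU: "acyclic_dgs U"
    unfolding acyclic_dgs_def
  proof (intro allI subsetI)
    fix n y assume "y \<in> cocycles U n"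
    then obtain w where w: "w \<in> N' n" "y = e w" "e (dif N (r (e w))) = 0"
      by (auto simp: cocycles_def)
    then have "e (dif N w) = e 0" using r(3) N'C by simp
    then have "dif N w = 0"
      using r(3)[OF Cd[OF N'C[OF w(1)]]] r(3)[OF N.M.subspace_0[OF Csub]] by metis
    then have "dif N (\<sigma> n w) = w" using sz w(1) N'gr unfolding cocycles_def by blast
    then have "y = dif U (e (\<sigma> n w))" using r(3)[OF N'C[OF N's[OF w(1)]]] w(2) by simp
    then show "y \<in> coboundaries U n"
      using N's[OF w(1)] by (auto simp: coboundaries_def)
  qed
  define fU where "fU = (\<lambda>x. e (f x))"
  have fU: "fU \<in> hom_gr B P actP U actU i"
  proof -
    have 1: "f x \<in> N' (i + j)" if "x \<in> gr P j" for x j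
      using Wf[OF that] N.M.span_base unfolding N'_def by blast
    show ?thesis
      using f 1 fC eC r(3)
      by (auto simp: hom_gr_def linear_on_def fU_def actU_def e.add e.scale linear_ksgn[OF e, symmetric])
  qed
  have "dif (hom_dgs B P actP U actU) fU = 0"
  proof -
    have "e (dif N (f x)) - ksgn i (e (f (dif P x))) = 0" if "x \<in> carr P" for x
      using fd[OF that] by (simp add: linear_ksgn[OF e, symmetric] e.diff[symmetric])
    then have "(if x \<in> carr P then dif U (fU x) - ksgn i (fU (dif P x)) else 0) = 0" for x
      by (simp add: fU_def r(3) fC)
    then show ?thesis
      by (intro ext) (simp only: hom_dgs_dif[OF Psp spU modU fU] zero_fun_apply)
  qed
  then have "fU \<in> cocycles (hom_dgs B P actP U actU) i"
    using fU by (simp add: cocycles_def hom_dgs_def)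
  then have "fU \<in> coboundaries (hom_dgs B P actP U actU) i"
    using proj modU acU unfolding K_projective_def acyclic_dgs_def by blast
  then obtain g where g: "g \<in> hom_gr B P actP U actU (i - 1)"
    and gf: "fU = dif (hom_dgs B P actP U actU) g"
    by (auto simp: coboundaries_def hom_dgs_def)
  define h where "h = (\<lambda>x. r (g x))"
  have gU: "g x \<in> carr U" if "x \<in> carr P" for x
    using g that by (simp add: hom_gr_def linear_on_def)
  have h: "h \<in> hom_gr B P actP N actN (i - 1)"
  proof -
    have 1: "r (g x) \<in> gr N (i - 1 + j)" if x: "x \<in> gr P j" for x j
    proof -
      have "g x \<in> e ` N' (i - 1 + j)" using g x by (simp add: hom_gr_def)
      then show ?thesis using r(3) N'C N'gr[of "i - 1 + j"] by auto
    qed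
    have 2: "r (g (actP b m)) = ksgn ((i - 1) * j) (actN b (r (g m)))"
      if b: "b \<in> gr B j" and m: "m \<in> carr P" for b m j
    proof -
      have "g (actP b m) = ksgn ((i - 1) * j) (e (actN b (r (g m))))"
        using g b m by (simp add: hom_gr_def actU_def)
      then show ?thesis
        using r(3)[OF Ca[OF P.B.gr_carr[OF b] rC]] by (simp add: linear_ksgn[OF r(2)])
    qed
    show ?thesis
      using g 1 2 Ccarr[OF rC]
      by (simp add: hom_gr_def linear_on_def h_def r.add r.scale)
  qed
  have "dif (hom_dgs B P actP N actN) h = f"
  proof
    fix x
    show "dif (hom_dgs B P actP N actN) h x = f x"
    proof (cases "x \<in> carr P")
      case True
      have "e (f x) = e (dif N (r (g x))) - ksgn (i - 1) (g (dif P x))"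
        using fun_cong[OF gf, of x] True by (simp add: hom_dgs_dif[OF Psp spU modU g] fU_def)
      then have "r (e (f x)) = r (e (dif N (r (g x)))) - ksgn (i - 1) (r (g (dif P x)))"
        by (simp add: r.diff linear_ksgn[OF r(2)])
      then show ?thesis
        using True r(3)[OF fC[OF True]] r(3)[OF Cd[OF rC]]
        by (subst hom_dgs_dif[OF Psp Nsp N.dg_module_axioms h]) (simp add: h_def)
    next
      case False
      then show ?thesis
        using f by (simp add: hom_dgs_dif[OF Psp Nsp N.dg_module_axioms h] hom_gr_def)
    qed
  qed
  then show "f \<in> coboundaries (hom_dgs B P actP N actN) i"
    using h by (auto simp: coboundaries_def hom_dgs_def)
qed

definition K_projective_resolution ::
  "('k::field, 'b::ab_group_add, 'x) dga_scheme \<Rightarrow>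
    ('k, 'p::ab_group_add, 'y) dgs_scheme \<Rightarrow> ('b \<Rightarrow> 'p \<Rightarrow> 'p) \<Rightarrow>
    ('k, 'm::ab_group_add, 'z) dgs_scheme \<Rightarrow> ('b \<Rightarrow> 'm \<Rightarrow> 'm) \<Rightarrow> ('p \<Rightarrow> 'm) \<Rightarrow> bool" where
  "K_projective_resolution B P actP M actM q \<longleftrightarrow>
     K_projective B P actP \<and> dg_module_hom B P actP M actM q \<and> induces_iso P M q"


section \<open>Dg module algebras and smash products\<close>

locale dg_module_algebra = H: hopf_algebra H + A: dg_algebra A
  for H :: "('k::field, 'h::ring_1) hopf"
    and A :: "('k, 'a::ab_group_add, 'z) dga_scheme"
    and hact :: "'h \<Rightarrow> 'a \<Rightarrow> 'a" +
  assumes hact_bilinear: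
      "bilinear_on (hscl H) UNIV (scl A) (carr A) (scl A) (carr A) hact"
    and hact_one: "a \<in> carr A \<Longrightarrow> hact 1 a = a"
    and hact_mult: "a \<in> carr A \<Longrightarrow> hact (g * h) a = hact g (hact h a)"
    and hact_gr: "a \<in> gr A i \<Longrightarrow> hact h a \<in> gr A i"
    and hact_mul: "a \<in> carr A \<Longrightarrow> b \<in> carr A \<Longrightarrow>
          hact h (mul A a b) = sweedler H (\<lambda>h1 h2. mul A (hact h1 a) (hact h2 b)) h"
    and hact_unt: "hact h (unt A) = scl A (counit H h) (unt A)"
    and hact_dif: "a \<in> carr A \<Longrightarrow> dif A (hact h a) = hact h (dif A a)"

text \<open>The complex \<open>V \<otimes> H\<close> with \<open>H\<close> in degree 0, hence with differential \<open>d \<otimes> id\<close>.\<close>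

definition tensor_dgs ::
  "('k::field, 'h::ring_1) hopf \<Rightarrow> ('k, 'v::ab_group_add, 'z) dgs_scheme \<Rightarrow>
    ('k, ('v, 'h, 'k) tensor) dgs" where
  "tensor_dgs H V =
     \<lparr>scl = tscl,
      gr = (\<lambda>n. tspan (scl V) (gr V n) (hscl H) UNIV),
      dif = tlift (scl V) (carr V) (hscl H) UNIV (\<lambda>v h. tens (scl V) (hscl H) (dif V v) h)\<rparr>"

definition smash ::
  "('k::field, 'h::ring_1) hopf \<Rightarrow> ('k, 'a::ab_group_add, 'z) dga_scheme \<Rightarrow>
    ('h \<Rightarrow> 'a \<Rightarrow> 'a) \<Rightarrow> ('k, ('a, 'h, 'k) tensor) dga" where
  "smash H A hact =
     \<lparr>scl = scl (tensor_dgs H A),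
      gr = gr (tensor_dgs H A),
      dif = dif (tensor_dgs H A),
      mul = (\<lambda>x y.
        tlift (scl A) (carr A) (hscl H) UNIV (\<lambda>a h.
          tlift (scl A) (carr A) (hscl H) UNIV (\<lambda>b g.
            sweedler H (\<lambda>h1 h2. tens (scl A) (hscl H) (mul A a (hact h1 b)) (h2 * g)) h) y) x),
      unt = tens (scl A) (hscl H) (unt A) 1\<rparr>"

text \<open>The action of \<open>A # H\<close> on \<open>M \<otimes> H\<close>: \<open>(a # h)(m \<otimes> w) = (a # h\<^sub>1) m \<otimes> h\<^sub>2 w\<close>.\<close>

definition tensor_act ::
  "('k::field, 'h::ring_1) hopf \<Rightarrow> ('k, 'a::ab_group_add, 'y) dga_scheme \<Rightarrow>
    ('k, 'm::ab_group_add, 'z) dgs_scheme \<Rightarrow> (('a, 'h, 'k) tensor \<Rightarrow> 'm \<Rightarrow> 'm) \<Rightarrow>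
    ('a, 'h, 'k) tensor \<Rightarrow> ('m, 'h, 'k) tensor \<Rightarrow> ('m, 'h, 'k) tensor" where
  "tensor_act H A M act x t =
     tlift (scl A) (carr A) (hscl H) UNIV (\<lambda>a h.
       tlift (scl M) (carr M) (hscl H) UNIV (\<lambda>m w.
         sweedler H (\<lambda>h1 h2.
           tens (scl M) (hscl H) (act (tens (scl A) (hscl H) a h1) m) (h2 * w)) h) t) x"

text \<open>The restrictions of an action of \<open>A # H\<close> to \<open>A\<close> and to \<open>H\<close>.\<close>

definition res_alg ::
  "('k::field, 'h::ring_1) hopf \<Rightarrow> ('k, 'a::ab_group_add, 'y) dga_scheme \<Rightarrow>
    (('a, 'h, 'k) tensor \<Rightarrow> 'm \<Rightarrow> 'm) \<Rightarrow> 'a \<Rightarrow> 'm \<Rightarrow> 'm" where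
  "res_alg H A act a = act (tens (scl A) (hscl H) a 1)"

definition res_hopf ::
  "('k::field, 'h::ring_1) hopf \<Rightarrow> ('k, 'a::ab_group_add, 'y) dga_scheme \<Rightarrow>
    (('a, 'h, 'k) tensor \<Rightarrow> 'm \<Rightarrow> 'm) \<Rightarrow> 'h \<Rightarrow> 'm \<Rightarrow> 'm" where
  "res_hopf H A act h = act (tens (scl A) (hscl H) (unt A) h)"

text \<open>
  The action \<open>(h \<rightharpoonup> f) m = h\<^sub>2 f (S\<^sup>-\<^sup>1 h\<^sub>1 m)\<close> of \<open>H\<close> on \<open>Hom\<^sub>A(M, N)\<close>.  The antipode of a
  finite-dimensional Hopf algebra is bijective, so that \<open>inv (antip H)\<close> is its inverse.
\<close>

definition hom_hact ::
  "('k::field, 'h::ring_1) hopf \<Rightarrow> ('k, 'a::ab_group_add, 'x) dga_scheme \<Rightarrow>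
    ('k, 'm::ab_group_add, 'y) dgs_scheme \<Rightarrow> (('a, 'h, 'k) tensor \<Rightarrow> 'm \<Rightarrow> 'm) \<Rightarrow>
    (('a, 'h, 'k) tensor \<Rightarrow> 'n \<Rightarrow> 'n) \<Rightarrow> 'h \<Rightarrow> ('m \<Rightarrow> 'n::ab_group_add) \<Rightarrow> 'm \<Rightarrow> 'n" where
  "hom_hact H A M actM actN h f =
     (\<lambda>m. if m \<in> carr M
        then sweedler H (\<lambda>h1 h2. res_hopf H A actN h2 (f (res_hopf H A actM (inv (antip H) h1) m))) h
        else 0)"

text \<open>
  For a K-projective resolution \<open>P\<close> of \<open>M\<close> over \<open>A # H\<close>, the following are the models
  \<open>Hom\<^sub>A(P, P)\<close> of \<open>RHom\<^sub>A(M, M)\<close> and \<open>Hom\<^bsub>A#H\<^esub>(P \<otimes> H, P \<otimes> H)\<close> of \<open>RHom\<^bsub>A#H\<^esub>(M \<otimes> H, M \<otimes> H)\<close>.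
\<close>

definition RHom_A ::
  "('k::field, 'h::ring_1) hopf \<Rightarrow> ('k, 'a::ab_group_add, 'y) dga_scheme \<Rightarrow>
    ('k, 'p::ab_group_add, 'z) dgs_scheme \<Rightarrow> (('a, 'h, 'k) tensor \<Rightarrow> 'p \<Rightarrow> 'p) \<Rightarrow>
    ('k, 'p \<Rightarrow> 'p) dga" where
  "RHom_A H A P act = end_dga A P (res_alg H A act)"

definition RHom_smash ::
  "('k::field, 'h::ring_1) hopf \<Rightarrow> ('k, 'a::ab_group_add, 'y) dga_scheme \<Rightarrow> ('h \<Rightarrow> 'a \<Rightarrow> 'a) \<Rightarrow>
    ('k, 'p::ab_group_add, 'z) dgs_scheme \<Rightarrow> (('a, 'h, 'k) tensor \<Rightarrow> 'p \<Rightarrow> 'p) \<Rightarrow>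
    ('k, ('p, 'h, 'k) tensor \<Rightarrow> ('p, 'h, 'k) tensor) dga" where
  "RHom_smash H A hact P act =
     end_dga (smash H A hact) (tensor_dgs H P) (tensor_act H A P act)"

end

theory Submission
  imports Defs
begin

text \<open>
  For every \<open>A # H\<close>-module \<open>P\<close>, K-projective or not, the map
  \<open>f # h \<mapsto> (m \<otimes> w \<mapsto> (w\<^sub>1 \<rightharpoonup> f) m \<otimes> w\<^sub>2 h)\<close> is even an isomorphism of dg algebras from
  \<open>Hom\<^sub>A(P, P) # H\<close> to \<open>Hom\<^bsub>A#H\<^esub>(P \<otimes> H, P \<otimes> H)\<close>.  Indeed \<open>m \<otimes> w = \<Sum> w\<^sub>2 (S\<^sup>-\<^sup>1(w\<^sub>1) m \<otimes> 1)\<close>, so an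
  \<open>A # H\<close>-linear map is determined by its values \<open>m \<otimes> 1 \<mapsto> \<Sum> f\<^sub>i m \<otimes> e\<^sub>i\<close>, where \<open>(e\<^sub>i)\<close> is a basis of
  \<open>H\<close> and the \<open>f\<^sub>i\<close> are \<open>A\<close>-linear; on these values multiplicativity can be read off.

  This uses that \<open>S\<close> is bijective.  Semisimplicity provides a left integral \<open>\<Lambda>\<close> with \<open>\<epsilon>(\<Lambda>) = 1\<close>, and
  then \<open>\<lambda>(h) = tr(y \<mapsto> S\<^sup>2(y) h)\<close> satisfies \<open>\<lambda>(h\<^sub>1) h\<^sub>2 = \<lambda>(h) 1\<close> and \<open>\<lambda>(\<Lambda>) = 1\<close>.  From
  \<open>\<Lambda>\<^sub>1 \<otimes> h \<Lambda>\<^sub>2 = S(h) \<Lambda>\<^sub>1 \<otimes> \<Lambda>\<^sub>2\<close> one gets \<open>h = \<lambda>(S(h) \<Lambda>\<^sub>1) \<Lambda>\<^sub>2\<close>, so \<open>S\<close> is injective.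
\<close>

text \<open>The action on Hom_A(P, P) involves the inverse of S, so bijectivity of the antipode has
  to come first. It is usually drawn from the structure theorem for Hopf modules; the integral
  supplied by semisimplicity allows a direct argument instead. The functional \<lambda> is the
  character of the right regular representation twisted by S^2. The twist makes it an integral
  without knowing that S^2 = id, and \<lambda>(\<Lambda>) is computable because S^2(y) \<Lambda> =
  \<epsilon>(y) \<Lambda>, a map of trace \<epsilon>(\<Lambda>).

  That Hom_A(P, P) # H is a dg algebra is part of the claim. Its axioms are not derived from an
  H-module algebra structure on Hom_A(P, P), but pulled back along the bijection from the
  endomorphism dg algebra of P \<otimes> H. This is why smash products are first built from bilinear
  data alone.

  Maps are linear only on carriers and \<open>tlift\<close> is controlled only on
  \<open>tspan\<close>, so every Sweedler computation carries linearity and membership conditions;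
  much of the preparation exists to discharge them.\<close>

text \<open>
  Tensors are functions themselves: unfolding zero and sums of functions pointwise would destroy
  sums of tensors.
\<close>

declare zero_fun_apply [simp del] plus_fun_apply [simp del]

section \<open>Linear maps and signs on subspaces\<close>

abbreviation lin :: "('k \<Rightarrow> 'v \<Rightarrow> 'v) \<Rightarrow> ('k \<Rightarrow> 'w \<Rightarrow> 'w) \<Rightarrow>
    ('v::ab_group_add \<Rightarrow> 'w::ab_group_add) \<Rightarrow> bool" where
  "lin s t f \<equiv> linear_on s UNIV t UNIV f"

lemma linear_onD:
  assumes "linear_on s V t W f"
  shows "x \<in> V \<Longrightarrow> f x \<in> W" "x \<in> V \<Longrightarrow> y \<in> V \<Longrightarrow> f (x + y) = f x + f y"
    "x \<in> V \<Longrightarrow> f (s c x) = t c (f x)"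
  using assms by (simp_all add: linear_on_def)

lemma linear_on_zero: "linear_on s V t W f \<Longrightarrow> 0 \<in> V \<Longrightarrow> f 0 = 0"
  using linear_onD(2)[of s V t W f 0 0] by simp

lemma linear_on_sum:
  assumes "vector_space s" "module.subspace s V" "linear_on s V t W f" "\<And>i. i \<in> I \<Longrightarrow> g i \<in> V"
  shows "f (\<Sum>i\<in>I. g i) = (\<Sum>i\<in>I. f (g i))"
proof -
  interpret vector_space s by fact
  have "f (\<Sum>i\<in>I. g i) = (\<Sum>i\<in>I. f (g i)) \<and> (\<Sum>i\<in>I. g i) \<in> V"
    using assms(4)
    by (induction I rule: infinite_finite_induct)
      (use assms(2,3) in \<open>auto simp: subspace_0 linear_on_zero linear_onD subspace_add\<close>)
  then show ?thesis ..
qed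

lemma linear_on_neg:
  assumes "vector_space s" "module.subspace s V" "linear_on s V t W f" "x \<in> V"
  shows "f (- x) = - f x"
proof -
  interpret vector_space s by fact
  have "f (- x + x) = f (- x) + f x"
    using assms(3) subspace_neg[OF assms(2,4)] assms(4) by (rule linear_onD)
  then show ?thesis
    using linear_on_zero[OF assms(3) subspace_0[OF assms(2)]] by (simp add: eq_neg_iff_add_eq_0)
qed

lemma linear_on_diff:
  assumes "vector_space s" "module.subspace s V" "linear_on s V t W f" "x \<in> V" "y \<in> V"
  shows "f (x - y) = f x - f y"
proof -
  interpret vector_space s by fact
  have "f (x + (- y)) = f x + f (- y)"
    using assms(3,4) subspace_neg[OF assms(2,5)] by (rule linear_onD)
  then show ?thesis using linear_on_neg[OF assms(1,2,3,5)] by simp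
qed

lemma linear_on_ksgn:
  assumes "vector_space s" "module.subspace s V" "linear_on s V t W f" "x \<in> V"
  shows "f (ksgn n x) = ksgn n (f x)"
  using linear_on_neg[OF assms] by (simp add: ksgn_def)

lemma ksgn_simps [simp]:
  "ksgn n 0 = 0" "ksgn n (x + y) = ksgn n x + ksgn n y" "ksgn n (x - y) = ksgn n x - ksgn n y"
  "ksgn n (- x) = - ksgn n x" "ksgn n (ksgn m x) = ksgn (n + m) x" "ksgn 0 x = x"
  by (auto simp: ksgn_def)

lemma ksgn_apply: "ksgn n f x = ksgn n (f x)"
  by (simp add: ksgn_def)

lemma ksgn_scale: "vector_space s \<Longrightarrow> ksgn n (s c x) = s c (ksgn n x)"
  by (auto simp: ksgn_def module.scale_minus_right module_iff_vector_space)

lemma subspace_ksgn: "vector_space s \<Longrightarrow> module.subspace s V \<Longrightarrow> x \<in> V \<Longrightarrow> ksgn n x \<in> V"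
  using module.subspace_neg[of s V x] by (simp add: ksgn_def module_iff_vector_space)

lemma linear_on_ksgn_comp:
  "vector_space t \<Longrightarrow> module.subspace t W \<Longrightarrow> linear_on s X t W F \<Longrightarrow> linear_on s X t W (\<lambda>x. ksgn n (F x))"
  by (auto simp: linear_on_def ksgn_scale intro: subspace_ksgn)

lemma bilinear_onI:
  "(\<And>x. x \<in> V \<Longrightarrow> linear_on t W u U (f x)) \<Longrightarrow> (\<And>y. y \<in> W \<Longrightarrow> linear_on s V u U (\<lambda>x. f x y)) \<Longrightarrow>
    bilinear_on s V t W u U f"
  by (simp add: bilinear_on_def)

lemma bilinear_onD:
  assumes "bilinear_on s V t W u U f"
  shows "x \<in> V \<Longrightarrow> linear_on t W u U (f x)" "y \<in> W \<Longrightarrow> linear_on s V u U (\<lambda>x. f x y)"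
  using assms by (simp_all add: bilinear_on_def)

lemma linear_on_codom: "linear_on s V t W f \<Longrightarrow> linear_on s V t UNIV f"
  by (simp add: linear_on_def)

lemma linear_on_dom: "linear_on s V t W f \<Longrightarrow> V' \<subseteq> V \<Longrightarrow> linear_on s V' t W f"
  unfolding linear_on_def by blast

lemma linear_on_restr: "linear_on s V t W f \<Longrightarrow> (\<And>x. x \<in> V \<Longrightarrow> f x \<in> W') \<Longrightarrow> linear_on s V t W' f"
  by (auto simp: linear_on_def)

text \<open>Functions such as \<open>hh h f\<close> and \<open>phi1 f h\<close> are set to 0 off the
  carrier; their linearity is transferred from an unguarded formula that agrees with them on the
  carrier.\<close>

lemma linear_on_cong: "(\<And>x. x \<in> V \<Longrightarrow> f x = g x) \<Longrightarrow> vector_space s \<Longrightarrow> module.subspace s V \<Longrightarrow>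
  linear_on s V t W f \<longleftrightarrow> linear_on s V t W g"
  unfolding linear_on_def
  using module.subspace_add[of s V] module.subspace_scale[of s V]
  by (simp add: module_iff_vector_space cong: ball_cong)

lemma vector_space_subspace_UNIV: "vector_space s \<Longrightarrow> module.subspace s UNIV"
  by (simp add: module_iff_vector_space[symmetric] module.subspace_UNIV)

lemma lin_scale: "vector_space su \<Longrightarrow> lin su su (su c)"
  using module.scale_right_distrib[of su] module.scale_left_commute[of su]
  by (simp add: linear_on_def module_iff_vector_space)


section \<open>Tensor products\<close>

text \<open>The default value 0 of \<open>tens\<close> at functions that are not bilinear makes
  these identities hold at every argument, hence as equalities of functions.\<close>

lemma tens_add_left: "tens sv sw (v + v') w = tens sv sw v w + tens sv sw v' w"
  and tens_add_right: "tens sv sw v (w + w') = tens sv sw v w + tens sv sw v w'"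
  and tens_scl_left: "tens sv sw (sv c v) w = tscl c (tens sv sw v w)"
  and tens_scl_right: "tens sv sw v (sw c w) = tscl c (tens sv sw v w)"
  by (rule ext, simp add: tens_def tscl_def bilinear_form_def bilinear_on_def linear_on_def plus_fun_apply)+

lemma tens_zero_left [simp]: "tens sv sw 0 w = 0"
  using tens_add_left[of sv sw 0 0 w] by simp

lemma tens_zero_right [simp]: "tens sv sw v 0 = 0"
  using tens_add_right[of sv sw v 0 0] by simp

lemma tens_neg_left: "tens sv sw (- v) w = - tens sv sw v w"
  using tens_add_left[of sv sw "- v" v w] by (simp add: eq_neg_iff_add_eq_0)

lemma tens_ksgn_left: "tens sv sw (ksgn n v) w = ksgn n (tens sv sw v w)"
  by (simp add: ksgn_def tens_neg_left)

lemma tens_sum_right: "tens sv sw v (\<Sum>i\<in>I. f i) = (\<Sum>i\<in>I. tens sv sw v (f i))"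
  by (induction I rule: infinite_finite_induct) (auto simp: tens_add_right)

lemma subspace_tspan: "module.subspace tscl (tspan sv V sw W)"
  unfolding tspan_def
  by (rule module.subspace_span) (use vector_space_tscl module_iff_vector_space in blast)

lemma tens_in_tspan: "v \<in> V \<Longrightarrow> w \<in> W \<Longrightarrow> tens sv sw v w \<in> tspan sv V sw W"
  unfolding tspan_def
  by (rule module.span_base) (use vector_space_tscl module_iff_vector_space in blast)+

locale tensor_pair = V: vector_space sv + W: vector_space sw
  for sv :: "'k::field \<Rightarrow> 'v::ab_group_add \<Rightarrow> 'v" and sw :: "'k \<Rightarrow> 'w::ab_group_add \<Rightarrow> 'w" +
  fixes V W
  assumes subV: "V.subspace V" and subW: "W.subspace W"
begin

sublocale T: vector_space "tscl :: 'k \<Rightarrow> ('v, 'w, 'k) tensor \<Rightarrow> _"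
  by (rule vector_space_tscl)

lemma tspan_0: "0 \<in> tspan sv V sw W"
  and tspan_add: "x \<in> tspan sv V sw W \<Longrightarrow> y \<in> tspan sv V sw W \<Longrightarrow> x + y \<in> tspan sv V sw W"
  using subspace_tspan[of sv V sw W] by (simp_all add: T.subspace_0 T.subspace_add)

text \<open>The scalars of a linear combination are absorbed into the left factor, so no scaling
  case remains.\<close>

lemma tspan_induct [consumes 1, case_names tens zero add]:
  assumes "t \<in> tspan sv V sw W" "\<And>v w. v \<in> V \<Longrightarrow> w \<in> W \<Longrightarrow> Q (tens sv sw v w)" "Q 0"
    "\<And>x y. x \<in> tspan sv V sw W \<Longrightarrow> y \<in> tspan sv V sw W \<Longrightarrow> Q x \<Longrightarrow> Q y \<Longrightarrow> Q (x + y)"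
  shows "Q t"
proof -
  have "Q t \<and> t \<in> tspan sv V sw W"
    using assms(1) unfolding tspan_def
  proof (induction rule: T.span_induct_alt)
    case base
    show ?case using assms(3) T.span_zero by blast
  next
    case (step c x y)
    then obtain v w where x: "x = tens sv sw v w" "v \<in> V" "w \<in> W" by blast
    then have "tscl c x = tens sv sw (sv c v) w" "sv c v \<in> V"
      using V.subspace_scale[OF subV] by (auto simp: tens_scl_left)
    then have "Q (tscl c x)" "tscl c x \<in> tspan sv V sw W"
      using assms(2) x tens_in_tspan by metis+
    then show ?case using step.IH assms(4) tspan_add unfolding tspan_def by blast
  qed
  then show ?thesis ..
qed

text \<open>The uniqueness half of the universal property: it reduces identities of linear maps to
  pure tensors.\<close>

lemma linear_on_tspan_eqI:
  assumes "linear_on tscl (tspan sv V sw W) su U f" "linear_on tscl (tspan sv V sw W) su U' g"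
    and "\<And>v w. v \<in> V \<Longrightarrow> w \<in> W \<Longrightarrow> f (tens sv sw v w) = g (tens sv sw v w)"
    and "t \<in> tspan sv V sw W"
  shows "f t = g t"
  using assms(4)
  by (induction rule: tspan_induct)
    (use assms tspan_0 in \<open>auto simp: linear_on_zero[OF assms(1)] linear_on_zero[OF assms(2)]
        linear_onD[OF assms(1)] linear_onD[OF assms(2)]\<close>)

lemma tlift_tens:
  "vector_space su \<Longrightarrow> bilinear_on sv V sw W su UNIV f \<Longrightarrow> v \<in> V \<Longrightarrow> w \<in> W \<Longrightarrow>
    tlift sv V sw W f (tens sv sw v w) = f v w"
  using Defs.tlift_tens[OF V.vector_space_axioms W.vector_space_axioms _ subV subW vector_space_subspace_UNIV]
  by blast

lemma tlift_linear_on: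
  "vector_space su \<Longrightarrow> module.subspace su U \<Longrightarrow> bilinear_on sv V sw W su U f \<Longrightarrow>
    linear_on tscl (tspan sv V sw W) su U (tlift sv V sw W f)"
  using Defs.tlift_linear[OF V.vector_space_axioms W.vector_space_axioms _ subV subW] by blast

lemma tlift_linear:
  "vector_space su \<Longrightarrow> bilinear_on sv V sw W su UNIV f \<Longrightarrow>
    linear_on tscl (tspan sv V sw W) su UNIV (tlift sv V sw W f)"
  by (simp add: tlift_linear_on vector_space_subspace_UNIV)

text \<open>Here the bilinear map varies and the tensor is fixed. By induction over \<open>t\<close>
  only the values on pure tensors matter. This is what allows liftings to be nested.\<close>

lemma tlift_param_linear:
  assumes su: "vector_space su" and t: "t \<in> tspan sv V sw W"
    and x: "vector_space sx" "module.subspace sx X"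
    and bil: "\<And>x. x \<in> X \<Longrightarrow> bilinear_on sv V sw W su UNIV (F x)"
    and lin: "\<And>v w. v \<in> V \<Longrightarrow> w \<in> W \<Longrightarrow> linear_on sx X su UNIV (\<lambda>x. F x v w)"
  shows "linear_on sx X su UNIV (\<lambda>x. tlift sv V sw W (F x) t)"
  using t
proof (induction rule: tspan_induct)
  case (tens v w)
  have "linear_on sx X su UNIV (\<lambda>x. tlift sv V sw W (F x) (tens sv sw v w)) \<longleftrightarrow>
    linear_on sx X su UNIV (\<lambda>x. F x v w)"
    by (rule linear_on_cong) (use tens bil su x tlift_tens[OF su] in auto)
  then show ?case using lin[OF tens] by simp
next
  case zero
  have "linear_on sx X su UNIV (\<lambda>x. tlift sv V sw W (F x) 0) \<longleftrightarrow> linear_on sx X su UNIV (\<lambda>x. 0)"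
    by (rule linear_on_cong) (use x linear_on_zero[OF tlift_linear[OF su bil] tspan_0] in auto)
  then show ?case
    using module.scale_zero_right[of su] su by (simp add: linear_on_def module_iff_vector_space)
next
  case (add s t)
  interpret U: vector_space su by fact
  have "linear_on sx X su UNIV (\<lambda>x. tlift sv V sw W (F x) (s + t)) \<longleftrightarrow>
    linear_on sx X su UNIV (\<lambda>x. tlift sv V sw W (F x) s + tlift sv V sw W (F x) t)"
    by (rule linear_on_cong) (use x add linear_onD(2)[OF tlift_linear[OF su bil]] in auto)
  then show ?case using add.IH by (simp add: linear_on_def U.scale_right_distrib)
qed

end


text \<open>The product of a smash product and the action of \<open>A # H\<close> on P \<otimes> H
  both have this nested form, with \<open>K\<close> their value on pure tensors.\<close>

lemma tlift_tlift:
  fixes K :: "'a::ab_group_add \<Rightarrow> 'b::ab_group_add \<Rightarrow> 'v::ab_group_add \<Rightarrow> 'w::ab_group_add \<Rightarrow> 'u::ab_group_add"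
    and su :: "'k::field \<Rightarrow> 'u \<Rightarrow> 'u"
  assumes X: "tensor_pair sa sb A B" and Y: "tensor_pair sv sw V W"
    and su: "vector_space su" "module.subspace su U"
    and mem: "\<And>a b v w. a \<in> A \<Longrightarrow> b \<in> B \<Longrightarrow> v \<in> V \<Longrightarrow> w \<in> W \<Longrightarrow> K a b v w \<in> U"
    and lin: "\<And>b v w. b \<in> B \<Longrightarrow> v \<in> V \<Longrightarrow> w \<in> W \<Longrightarrow> linear_on sa A su UNIV (\<lambda>a. K a b v w)"
      "\<And>a v w. a \<in> A \<Longrightarrow> v \<in> V \<Longrightarrow> w \<in> W \<Longrightarrow> linear_on sb B su UNIV (\<lambda>b. K a b v w)"
      "\<And>a b w. a \<in> A \<Longrightarrow> b \<in> B \<Longrightarrow> w \<in> W \<Longrightarrow> linear_on sv V su UNIV (\<lambda>v. K a b v w)"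
      "\<And>a b v. a \<in> A \<Longrightarrow> b \<in> B \<Longrightarrow> v \<in> V \<Longrightarrow> linear_on sw W su UNIV (\<lambda>w. K a b v w)"
  shows tlift_tlift_bilinear: "bilinear_on tscl (tspan sa A sb B) tscl (tspan sv V sw W) su U
      (\<lambda>x y. tlift sa A sb B (\<lambda>a b. tlift sv V sw W (K a b) y) x)" (is "bilinear_on _ ?X _ ?Y _ _ ?F")
    and tlift_tlift_tens: "a \<in> A \<Longrightarrow> b \<in> B \<Longrightarrow> v \<in> V \<Longrightarrow> w \<in> W \<Longrightarrow>
      tlift sa A sb B (\<lambda>a b. tlift sv V sw W (K a b) (tens sv sw v w)) (tens sa sb a b) = K a b v w"
proof -
  interpret X: tensor_pair sa sb A B by fact
  interpret Y: tensor_pair sv sw V W by fact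
  let ?f = "\<lambda>y a b. tlift sv V sw W (K a b) y"
  have K: "bilinear_on sv V sw W su U (K a b)" if "a \<in> A" "b \<in> B" for a b
    using lin(3,4) mem that unfolding bilinear_on_def linear_on_def by blast
  have K': "bilinear_on sv V sw W su UNIV (K a b)" if "a \<in> A" "b \<in> B" for a b
    using K[OF that] by (auto simp: bilinear_on_def intro: linear_on_codom)
  have f: "bilinear_on sa A sb B su U (?f y)" if y: "y \<in> ?Y" for y
  proof (rule bilinear_onI; rule linear_on_restr)
    show "linear_on sb B su UNIV (?f y a)" if "a \<in> A" for a
      by (rule Y.tlift_param_linear[OF su(1) y X.W.vector_space_axioms X.subW])
        (use K' lin(2) that in auto)
    show "linear_on sa A su UNIV (\<lambda>a. ?f y a b)" if "b \<in> B" for b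
      by (rule Y.tlift_param_linear[OF su(1) y X.V.vector_space_axioms X.subV])
        (use K' lin(1) that in auto)
  qed (use linear_onD(1)[OF Y.tlift_linear_on[OF su K] y] in auto)
  have f': "bilinear_on sa A sb B su UNIV (?f y)" if "y \<in> ?Y" for y
    using f[OF that] by (auto simp: bilinear_on_def intro: linear_on_codom)
  have L: "linear_on tscl ?X su U (\<lambda>x. ?F x y)" if "y \<in> ?Y" for y
    by (rule X.tlift_linear_on[OF su f[OF that]])
  show "bilinear_on tscl ?X tscl ?Y su U ?F"
  proof (rule bilinear_onI[OF _ L])
    fix x assume x: "x \<in> ?X"
    have "linear_on tscl ?Y su UNIV (?F x)"
      by (rule X.tlift_param_linear[OF su(1) x vector_space_tscl subspace_tspan f'])
        (use Y.tlift_linear[OF su(1) K'] in auto)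
    then show "linear_on tscl ?Y su U (?F x)"
      using linear_onD(1)[OF L x] by (rule linear_on_restr)
  qed
  show "?F (tens sa sb a b) (tens sv sw v w) = K a b v w" if "a \<in> A" "b \<in> B" "v \<in> V" "w \<in> W"
    by (simp add: X.tlift_tens[OF su(1) f'] Y.tlift_tens[OF su(1) K'] tens_in_tspan that)
qed

section \<open>Sweedler notation\<close>

text \<open>\<open>lin_intros\<close> decomposes the (bi-, tri-)linearity side conditions of Sweedler computations.\<close>

named_theorems lin_intros

abbreviation hlin where "hlin H su f \<equiv> linear_on (hscl H) UNIV su UNIV f"
abbreviation hbil where "hbil H su f \<equiv> bilinear_on (hscl H) UNIV (hscl H) UNIV su UNIV f"

definition htri where
  "htri H su F \<longleftrightarrow> (\<forall>y z. hlin H su (\<lambda>x. F x y z)) \<and> (\<forall>x z. hlin H su (\<lambda>y. F x y z)) \<and>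
     (\<forall>x y. hlin H su (\<lambda>z. F x y z))"

lemma hbilI [lin_intros]: "(\<And>x. hlin H su (f x)) \<Longrightarrow> (\<And>y. hlin H su (\<lambda>x. f x y)) \<Longrightarrow> hbil H su f"
  by (simp add: bilinear_on_def)

lemma htriI [lin_intros]: "(\<And>y z. hlin H su (\<lambda>x. F x y z)) \<Longrightarrow> (\<And>x z. hlin H su (\<lambda>y. F x y z)) \<Longrightarrow>
   (\<And>x y. hlin H su (\<lambda>z. F x y z)) \<Longrightarrow> htri H su F"
  by (simp add: htri_def)

lemma hbil_compose:
  "hbil H su f \<Longrightarrow> (\<And>x y. f x y \<in> U) \<Longrightarrow> linear_on su U su' U' \<phi> \<Longrightarrow> hbil H su' (\<lambda>x y. \<phi> (f x y))"
  by (auto simp: bilinear_on_def linear_on_def)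

lemma hbil_hlin:
  assumes "hbil H su f" "hlin H (hscl H) g"
  shows "hlin H su (\<lambda>x. f (g x) z)" "hlin H su (\<lambda>x. f z (g x))"
  using assms by (auto simp: bilinear_on_def linear_on_def)

lemma linear_on_sum_list:
  assumes "vector_space s" "module.subspace s V" "linear_on s V t W f" "\<And>i. i \<in> set is \<Longrightarrow> g i \<in> V"
  shows "f (\<Sum>i\<leftarrow>is. g i) = (\<Sum>i\<leftarrow>is. f (g i))"
proof -
  interpret vector_space s by fact
  have "f (\<Sum>i\<leftarrow>is. g i) = (\<Sum>i\<leftarrow>is. f (g i)) \<and> (\<Sum>i\<leftarrow>is. g i) \<in> V"
    using assms(4) by (induction "is")
      (use assms(2,3) in \<open>auto simp: subspace_0 linear_on_zero linear_onD subspace_add\<close>)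
  then show ?thesis ..
qed

context hopf_algebra
begin

lemma vector_space_hscl [lin_intros]: "vector_space (hscl H)"
  by (rule vector_space_axioms)

declare vector_space_mult [lin_intros] vector_space_tscl [lin_intros]

sublocale HH: tensor_pair "hscl H" "hscl H" UNIV UNIV
  by unfold_locales (simp_all add: vector_space_subspace_UNIV)

text \<open>An arbitrary choice of representatives. With it a Sweedler sum becomes a finite list
  sum, and linear maps and other sums are moved through it by list induction.\<close>

definition coprod_list :: "'h \<Rightarrow> ('h \<times> 'h) list" where
  "coprod_list h = (SOME xs. comul H h = (\<Sum>(x, y)\<leftarrow>xs. htens H x y))"

lemma comul_coprod_list: "comul H h = (\<Sum>(x, y)\<leftarrow>coprod_list h. htens H x y)"
proof -
  have "comul H h \<in> tspan (hscl H) UNIV (hscl H) UNIV"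
    using comul_linear by (simp add: linear_on_def)
  then have "\<exists>xs. comul H h = (\<Sum>(x, y)\<leftarrow>xs. htens H x y)"
  proof (induction rule: HH.tspan_induct)
    case (tens v w)
    show ?case by (rule exI[of _ "[(v, w)]"]) simp
  next
    case zero
    show ?case by (rule exI[of _ "[]"]) simp
  next
    case (add x y)
    then obtain xs ys where "x = (\<Sum>(x, y)\<leftarrow>xs. htens H x y)" "y = (\<Sum>(x, y)\<leftarrow>ys. htens H x y)" by blast
    then show ?case by (intro exI[of _ "xs @ ys"]) simp
  qed
  then show ?thesis unfolding coprod_list_def by (rule someI_ex)
qed

lemma sweedler_sum_list:
  assumes "vector_space su" "hbil H su f"
  shows "sweedler H f h = (\<Sum>z\<leftarrow>coprod_list h. f (fst z) (snd z))"
proof -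
  have "sweedler H f h = (\<Sum>(x, y)\<leftarrow>coprod_list h. f x y)"
    unfolding sweedler_def comul_coprod_list
    by (rule tlift_sum_list[OF _ _ assms(1) _ _ vector_space_subspace_UNIV[OF assms(1)] assms(2)])
      (simp_all add: vector_space_subspace_UNIV vector_space_axioms)
  then show ?thesis by (simp add: case_prod_unfold)
qed

text \<open>The basic rule of Sweedler calculus. The subspace \<open>U\<close> is there because the
  maps to be pulled through, such as actions, are linear only on carriers.\<close>

lemma sweedler_linear_on:
  assumes "vector_space su" "vector_space su'" "module.subspace su U" "linear_on su U su' U' \<phi>"
    and f: "hbil H su f" "\<And>x y. f x y \<in> U"
  shows "\<phi> (sweedler H f h) = sweedler H (\<lambda>x y. \<phi> (f x y)) h"
proof -
  have "hbil H su' (\<lambda>x y. \<phi> (f x y))"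
    by (rule hbil_compose[OF f assms(4)])
  then show ?thesis
    using linear_on_sum_list[OF assms(1,3,4), of "coprod_list h" "\<lambda>z. f (fst z) (snd z)"] f(2)
    by (simp add: sweedler_sum_list[OF assms(1) f(1)] sweedler_sum_list[OF assms(2)])
qed

lemma sweedler_lin:
  "vector_space su \<Longrightarrow> vector_space su' \<Longrightarrow> lin su su' \<phi> \<Longrightarrow> hbil H su f \<Longrightarrow>
    \<phi> (sweedler H f h) = sweedler H (\<lambda>x y. \<phi> (f x y)) h"
  using sweedler_linear_on[OF _ _ vector_space_subspace_UNIV] by blast

lemma sweedler_mem:
  assumes "vector_space su" "module.subspace su U" "hbil H su f" "\<And>x y. f x y \<in> U"
  shows "sweedler H f h \<in> U"
proof -
  interpret U: vector_space su by fact
  have "(\<Sum>z\<leftarrow>xs. f (fst z) (snd z)) \<in> U" for xs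
    by (induction xs) (use assms in \<open>auto simp: U.subspace_0 U.subspace_add\<close>)
  then show ?thesis by (simp add: sweedler_sum_list[OF assms(1,3)])
qed

lemma sweedler_hlin [lin_intros]:
  assumes "vector_space su" "hbil H su f" "hlin H (hscl H) g"
  shows "hlin H su (\<lambda>x. sweedler H f (g x))"
proof -
  have "lin (hscl H) su (sweedler H f)"
    using linear_on_compose[OF comul_linear HH.tlift_linear[OF assms(1,2)]]
    by (simp add: sweedler_def[abs_def])
  then show ?thesis using assms(3) by (rule linear_on_compose[rotated])
qed

text \<open>Complement of \<open>sweedler_hlin\<close>: the variable now occurs in the summand and
  not in the element whose coproduct is taken.\<close>

lemma sweedler_hlin_param [lin_intros]:
  assumes "vector_space su" "\<And>x. hbil H su (F x)" "\<And>p q. hlin H su (\<lambda>x. F x p q)"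
  shows "hlin H su (\<lambda>x. sweedler H (F x) h)"
proof -
  interpret U: vector_space su by fact
  have "hlin H su (\<lambda>x. \<Sum>z\<leftarrow>xs. F x (fst z) (snd z))" for xs
    by (induction xs) (use assms(3) in \<open>auto simp: linear_on_def U.scale_right_distrib\<close>)
  then show ?thesis by (simp add: sweedler_sum_list[OF assms(1,2)])
qed

text \<open>For fixed representatives of the two coproducts, both sides are the same finite double
  sum.\<close>

lemma sweedler_swap:
  fixes su :: "'k \<Rightarrow> 'u::ab_group_add \<Rightarrow> 'u"
  assumes "vector_space su" "\<And>x y. hbil H su (F x y)" "\<And>p q. hbil H su (\<lambda>x y. F x y p q)"
  shows "sweedler H (\<lambda>x y. sweedler H (\<lambda>p q. F x y p q) g) h =
    sweedler H (\<lambda>p q. sweedler H (\<lambda>x y. F x y p q) h) g"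
proof -
  have 1: "hbil H su (\<lambda>x y. sweedler H (\<lambda>p q. F x y p q) g)"
    by (intro hbilI sweedler_hlin_param) (use assms in \<open>auto simp: bilinear_on_def\<close>)
  have 2: "hbil H su (\<lambda>p q. sweedler H (\<lambda>x y. F x y p q) h)"
    by (intro hbilI sweedler_hlin_param) (use assms in \<open>auto simp: bilinear_on_def\<close>)
  have "(\<Sum>u\<leftarrow>us. \<Sum>v\<leftarrow>vs. G u v) = (\<Sum>v\<leftarrow>vs. \<Sum>u\<leftarrow>us. G u v)" for us vs and G :: "_ \<Rightarrow> _ \<Rightarrow> 'u"
    by (induction us) (simp_all add: sum_list_addf)
  then show ?thesis
    unfolding sweedler_sum_list[OF assms(1) 1] sweedler_sum_list[OF assms(1) 2]
    by (simp add: sweedler_sum_list[OF assms(1,2)] sweedler_sum_list[OF assms(1,3)])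
qed

lemma sweedler_sum:
  fixes su :: "'k \<Rightarrow> 'u::ab_group_add \<Rightarrow> 'u"
  assumes "vector_space su" "\<And>i. i \<in> I \<Longrightarrow> hbil H su (F i)" "finite I"
  shows "sweedler H (\<lambda>x y. \<Sum>i\<in>I. F i x y) h = (\<Sum>i\<in>I. sweedler H (F i) h)"
proof -
  interpret U: vector_space su by fact
  have "hbil H su (\<lambda>x y. \<Sum>i\<in>I. F i x y)"
    using assms(2)
    by (auto simp: bilinear_on_def linear_on_def sum.distrib U.scale_sum_right intro!: sum.cong)
  moreover have "(\<Sum>u\<leftarrow>us. \<Sum>i\<in>I. G u i) = (\<Sum>i\<in>I. \<Sum>u\<leftarrow>us. G u i)" for us and G :: "_ \<Rightarrow> _ \<Rightarrow> 'u"
    by (induction us) (simp_all add: sum.distrib)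
  ultimately show ?thesis
    by (simp add: sweedler_sum_list[OF assms(1)] sweedler_sum_list[OF assms(1,2)])
qed

lemma hlin_id [lin_intros]: "hlin H (hscl H) (\<lambda>x. x)"
  by (simp add: linear_on_def)

lemma hlin_mult_left [lin_intros]: "hlin H (hscl H) f \<Longrightarrow> hlin H (hscl H) (\<lambda>x. f x * a)"
  by (simp add: linear_on_def scl_mult_left distrib_right)

lemma hlin_mult_right [lin_intros]: "hlin H (hscl H) f \<Longrightarrow> hlin H (hscl H) (\<lambda>x. a * f x)"
  by (simp add: linear_on_def scl_mult_right distrib_left)

lemma hlin_antip [lin_intros]: "hlin H (hscl H) f \<Longrightarrow> hlin H (hscl H) (\<lambda>x. antip H (f x))"
  using antip_linear by (rule linear_on_compose[rotated])

lemma hlin_counit [lin_intros]: "hlin H (hscl H) f \<Longrightarrow> hlin H (*) (\<lambda>x. counit H (f x))"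
  using counit_linear by (rule linear_on_compose[rotated])

lemma hlin_scale_left [lin_intros]:
  "vector_space su \<Longrightarrow> hlin H (*) f \<Longrightarrow> hlin H su (\<lambda>x. su (f x) u)"
  using module.scale_left_distrib[of su] module.scale_scale[of su]
  by (simp add: linear_on_def module_iff_vector_space)

lemma hlin_scale_right [lin_intros]:
  "vector_space su \<Longrightarrow> hlin H su f \<Longrightarrow> hlin H su (\<lambda>x. su c (f x))"
  using module.scale_right_distrib[of su] module.scale_left_commute[of su]
  by (simp add: linear_on_def module_iff_vector_space)

lemma hlin_tens_left [lin_intros]: "hlin H sv f \<Longrightarrow> hlin H tscl (\<lambda>x. tens sv sw (f x) w)"
  by (simp add: linear_on_def tens_add_left tens_scl_left)

lemma hlin_tens_right [lin_intros]: "hlin H sw f \<Longrightarrow> hlin H tscl (\<lambda>x. tens sv sw v (f x))"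
  by (simp add: linear_on_def tens_add_right tens_scl_right)

text \<open>The axiom \<open>coassoc\<close> is the case of the universal trilinear map into H
  \<otimes> (H \<otimes> H). Every trilinear \<open>F\<close> factors through that map by the linear
  map \<open>?\<Phi>\<close>, which is applied to both sides of the axiom.\<close>

lemma sweedler_coassoc:
  assumes su: "vector_space su" and F: "htri H su F"
  shows "sweedler H (\<lambda>x y. sweedler H (\<lambda>p q. F p q y) x) h =
    sweedler H (\<lambda>x y. sweedler H (\<lambda>p q. F x p q) y) h"
proof -
  interpret U: vector_space su by fact
  let ?HH = "tspan (hscl H) UNIV (hscl H) UNIV"
  interpret HHH: tensor_pair "hscl H" "tscl :: 'k \<Rightarrow> ('h, 'h, 'k) tensor \<Rightarrow> _" UNIV ?HH
    by unfold_locales (simp_all add: vector_space_subspace_UNIV subspace_tspan)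
  have F1 [lin_intros]: "hlin H su (\<lambda>x. F (g x) y z)" "hlin H su (\<lambda>x. F y (g x) z)"
    "hlin H su (\<lambda>x. F y z (g x))" if "hlin H (hscl H) g" for g y z
    using F that by (auto simp: htri_def linear_on_def)
  let ?f = "\<lambda>p. tlift (hscl H) UNIV (hscl H) UNIV (F p)"
  let ?\<Phi> = "tlift (hscl H) UNIV tscl ?HH ?f"
  have bil: "bilinear_on (hscl H) UNIV tscl ?HH su UNIV ?f"
    by (intro bilinear_onI HH.tlift_linear su HH.tlift_param_linear lin_intros)
      (simp_all add: vector_space_subspace_UNIV)
  note L = HHH.tlift_linear[OF su bil]
  have \<Phi>: "?\<Phi> (tens (hscl H) tscl p (htens H q y)) = F p q y" for p q y
    by (subst HHH.tlift_tens[OF su bil])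
      (auto intro!: tens_in_tspan HH.tlift_tens[OF su] lin_intros)
  have mem: "tens (hscl H) tscl p (htens H q y) \<in> tspan (hscl H) UNIV tscl ?HH" for p q y
    by (intro tens_in_tspan UNIV_I)
  have b: "hbil H tscl (\<lambda>p q. tens (hscl H) tscl p (htens H q y))"
    "hbil H tscl (\<lambda>p q. tens (hscl H) tscl y (htens H p q))"  for y
    by (intro lin_intros)+
  have push: "?\<Phi> (sweedler H f h) = sweedler H (\<lambda>x y. ?\<Phi> (f x y)) h"
    if "hbil H tscl f" "\<And>x y. f x y \<in> tspan (hscl H) UNIV tscl ?HH" for f h
    by (rule sweedler_linear_on[OF vector_space_tscl su subspace_tspan L that])
  have mem': "sweedler H (\<lambda>p q. tens (hscl H) tscl p (htens H q y)) x \<in> tspan (hscl H) UNIV tscl ?HH"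
     "sweedler H (\<lambda>p q. tens (hscl H) tscl x (htens H p q)) y \<in> tspan (hscl H) UNIV tscl ?HH" for x y
    by (rule sweedler_mem[OF vector_space_tscl subspace_tspan]; intro b mem)+
  have b': "hbil H tscl (\<lambda>x y. sweedler H (\<lambda>p q. tens (hscl H) tscl p (htens H q y)) x)"
    "hbil H tscl (\<lambda>x y. sweedler H (\<lambda>p q. tens (hscl H) tscl x (htens H p q)) y)"
    by (intro lin_intros)+
  show ?thesis
    using arg_cong[OF coassoc[of h], of ?\<Phi>]
    by (simp add: push[OF b'(1) mem'(1)] push[OF b'(2) mem'(2)] push[OF b(1) mem] push[OF b(2) mem] \<Phi>)
qed

lemma sweedler_counit_left:
  assumes "vector_space su" "hlin H su f"
  shows "sweedler H (\<lambda>x y. su (counit H x) (f y)) h = f h"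
proof -
  have "f (sweedler H (\<lambda>x y. hscl H (counit H x) y) h) = sweedler H (\<lambda>x y. f (hscl H (counit H x) y)) h"
    by (rule sweedler_lin[OF _ assms]) (intro lin_intros)+
  then show ?thesis using counit_left assms(2) by (simp add: linear_on_def)
qed

lemma sweedler_counit_right:
  assumes "vector_space su" "hlin H su f"
  shows "sweedler H (\<lambda>x y. su (counit H y) (f x)) h = f h"
proof -
  have "f (sweedler H (\<lambda>x y. hscl H (counit H y) x) h) = sweedler H (\<lambda>x y. f (hscl H (counit H y) x)) h"
    by (rule sweedler_lin[OF _ assms]) (intro lin_intros)+
  then show ?thesis using counit_right assms(2) by (simp add: linear_on_def)
qed

lemma sweedler_one: "vector_space su \<Longrightarrow> hbil H su f \<Longrightarrow> sweedler H f 1 = f 1 1"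
  unfolding sweedler_def comul_one by (rule HH.tlift_tens) auto

text \<open>The axiom \<open>comul_mult\<close> is the case of the universal bilinear map; the
  linear map induced by \<open>f\<close> is applied to it.\<close>

lemma sweedler_mult:
  assumes "vector_space su" "hbil H su f"
  shows "sweedler H f (g * h) =
    sweedler H (\<lambda>g1 g2. sweedler H (\<lambda>h1 h2. f (g1 * h1) (g2 * h2)) h) g"
proof -
  let ?t = "tlift (hscl H) UNIV (hscl H) UNIV f"
  note L = HH.tlift_linear[OF assms]
  note push = sweedler_linear_on[OF vector_space_tscl assms(1) subspace_tspan L]
  have t: "?t (htens H x y) = f x y" for x y
    using assms by (rule HH.tlift_tens) auto
  have mem: "htens H x y \<in> tspan (hscl H) UNIV (hscl H) UNIV" for x y
    by (intro tens_in_tspan UNIV_I)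
  have 1: "hbil H tscl (\<lambda>h1 h2. htens H (g1 * h1) (g2 * h2))" for g1 g2
    by (intro lin_intros)
  show ?thesis unfolding sweedler_def[of _ f "g * h"] comul_mult
    by (subst push; (subst push)?; (intro lin_intros sweedler_mem[OF vector_space_tscl subspace_tspan] mem)?)
      (simp add: t)
qed

end

section \<open>The antipode of a semisimple Hopf algebra\<close>

context hopf_algebra
begin

lemma sweedler_antip_left:
  assumes "vector_space su" "hlin H su f"
  shows "sweedler H (\<lambda>x y. f (antip H x * y)) h = su (counit H h) (f 1)"
proof -
  have "f (sweedler H (\<lambda>x y. antip H x * y) h) = sweedler H (\<lambda>x y. f (antip H x * y)) h"
    by (rule sweedler_lin[OF _ assms]) (intro lin_intros)+
  then show ?thesis using antip_left assms(2) by (simp add: linear_on_def)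
qed

lemma sweedler_antip_right:
  assumes "vector_space su" "hlin H su f"
  shows "sweedler H (\<lambda>x y. f (x * antip H y)) h = su (counit H h) (f 1)"
proof -
  have "f (sweedler H (\<lambda>x y. x * antip H y) h) = sweedler H (\<lambda>x y. f (x * antip H y)) h"
    by (rule sweedler_lin[OF _ assms]) (intro lin_intros)+
  then show ?thesis using antip_right assms(2) by (simp add: linear_on_def)
qed

text \<open>Coassociativity makes the two legs under \<open>\<mu>\<close> neighbours, and the counit
  removes the scalar they leave. The abstract \<open>\<mu>\<close> serves four times: for S(x) y and
  x S(y), and later for the two corresponding identities of the inverse antipode.\<close>

lemma sweedler_contract_left:
  assumes su: "vector_space su" and G: "hbil H su G"
    and \<mu>: "hbil H (hscl H) \<mu>" "\<And>h. sweedler H \<mu> h = hscl H (counit H h) 1"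
  shows "sweedler H (\<lambda>x r. sweedler H (\<lambda>y z. G (\<mu> x y) z) r) h = G 1 h" (is ?A)
    and "sweedler H (\<lambda>r z. sweedler H (\<lambda>x y. G (\<mu> x y) z) r) h = G 1 h" (is ?B)
proof -
  note G' = hbil_hlin[OF G]
  note \<mu>' = hbil_hlin[OF \<mu>(1)]
  have "G (sweedler H \<mu> r) z = sweedler H (\<lambda>x y. G (\<mu> x y) z) r" for r z
    by (rule sweedler_lin[OF _ su _ \<mu>(1)]) (intro lin_intros G')+
  moreover have "G (hscl H c 1) z = su c (G 1 z)" for c z
    using G by (simp add: bilinear_on_def linear_on_def)
  ultimately have "sweedler H (\<lambda>x y. G (\<mu> x y) z) r = su (counit H r) (G 1 z)" for r z
    using \<mu>(2) by simp
  then show ?B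
    by (simp add: sweedler_counit_left[OF su] bilinear_onD[OF G])
  then show ?A
    by (subst sweedler_coassoc[OF su, symmetric]) (intro lin_intros G' \<mu>' su)
qed

lemma sweedler_contract_right:
  assumes su: "vector_space su" and G: "hbil H su G"
    and \<mu>: "hbil H (hscl H) \<mu>" "\<And>h. sweedler H \<mu> h = hscl H (counit H h) 1"
  shows "sweedler H (\<lambda>x r. sweedler H (\<lambda>y z. G x (\<mu> y z)) r) h = G h 1" (is ?A)
    and "sweedler H (\<lambda>r z. sweedler H (\<lambda>x y. G x (\<mu> y z)) r) h = G h 1" (is ?B)
proof -
  note G' = hbil_hlin[OF G]
  note \<mu>' = hbil_hlin[OF \<mu>(1)]
  have "G x (sweedler H \<mu> r) = sweedler H (\<lambda>y z. G x (\<mu> y z)) r" for r x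
    by (rule sweedler_lin[OF _ su _ \<mu>(1)]) (intro lin_intros G')+
  moreover have "G x (hscl H c 1) = su c (G x 1)" for c x
    using G by (simp add: bilinear_on_def linear_on_def)
  ultimately have "sweedler H (\<lambda>y z. G x (\<mu> y z)) r = su (counit H r) (G x 1)" for r x
    using \<mu>(2) by simp
  then show ?A
    by (simp add: sweedler_counit_right[OF su] bilinear_onD[OF G])
  then show ?B
    by (subst sweedler_coassoc[OF su]) (intro lin_intros G' \<mu>' su)
qed

lemma hbil_antip: "hbil H (hscl H) (\<lambda>x y. antip H x * y)" "hbil H (hscl H) (\<lambda>x y. x * antip H y)"
  by (intro lin_intros)+

lemmas antip_left_contract_left = sweedler_contract_left[OF _ _ hbil_antip(1) antip_left]
lemmas antip_left_contract_right = sweedler_contract_right[OF _ _ hbil_antip(1) antip_left]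
lemmas antip_right_contract_left = sweedler_contract_left[OF _ _ hbil_antip(2) antip_right]
lemmas antip_right_contract_right = sweedler_contract_right[OF _ _ hbil_antip(2) antip_right]

lemma antip_one: "antip H 1 = 1"
proof -
  have "sweedler H (\<lambda>x y. antip H x * y) 1 = antip H 1 * 1"
    by (rule sweedler_one[of "hscl H"]) (intro lin_intros)+
  then show ?thesis using antip_left counit_one by simp
qed

lemma counit_antip: "counit H (antip H h) = counit H h"
proof -
  have 1: "counit H (sweedler H (\<lambda>x y. antip H x * y) h) = sweedler H (\<lambda>x y. counit H (antip H x * y)) h"
    by (rule sweedler_lin[of "hscl H" "(*)"]) (intro lin_intros counit_linear)+
  also have "\<dots> = sweedler H (\<lambda>x y. counit H y * counit H (antip H x)) h"
    by (simp add: counit_mult mult.commute)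
  also have "\<dots> = counit H (antip H h)"
    by (rule sweedler_counit_right[of "(*)"]) (intro lin_intros)+
  finally show ?thesis
    using counit_linear antip_left by (simp add: linear_on_def counit_one)
qed

text \<open>Uniqueness of convolution inverses: x \<otimes> y \<mapsto> S(x y) is a left inverse and
  x \<otimes> y \<mapsto> S(y) S(x) a right inverse of the multiplication. \<open>?X\<close> is the
  triple convolution product, evaluated under both bracketings.\<close>

lemma antip_mult: "antip H (x * y) = antip H y * antip H x"
proof -
  let ?F = "\<lambda>x1 x2 x3 y1 y2 y3. antip H (x1 * y1) * ((x2 * (y2 * antip H y3)) * antip H x3)"
  let ?X = "sweedler H (\<lambda>x1 x'. sweedler H (\<lambda>x2 x3. sweedler H (\<lambda>y1 y'. sweedler H (\<lambda>y2 y3.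
      ?F x1 x2 x3 y1 y2 y3) y') y) x') x"
  have 1: "sweedler H (\<lambda>y1 y'. sweedler H (\<lambda>y2 y3. ?F x1 x2 x3 y1 y2 y3) y') y =
      antip H (x1 * y) * (x2 * antip H x3)" for x1 x2 x3
    by (subst antip_right_contract_right[of "hscl H"]) (intro lin_intros | simp)+
  have "?X = antip H (x * y)"
    unfolding 1 by (subst antip_right_contract_right[of "hscl H"]) (intro lin_intros | simp)+
  moreover have "?X = antip H y * antip H x"
  proof -
    have "?X = sweedler H (\<lambda>x1 x'. sweedler H (\<lambda>x2 x3. sweedler H (\<lambda>y' y3. sweedler H (\<lambda>y1 y2.
      ?F x1 x2 x3 y1 y2 y3) y') y) x') x"
      by (subst sweedler_coassoc[of "hscl H" "?F _ _ _"]) (intro lin_intros | simp)+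
    also have "\<dots> = sweedler H (\<lambda>x' x3. sweedler H (\<lambda>x1 x2. sweedler H (\<lambda>y' y3. sweedler H (\<lambda>y1 y2.
      ?F x1 x2 x3 y1 y2 y3) y') y) x') x"
      by (subst sweedler_coassoc[of "hscl H"]) (intro lin_intros | simp)+
    also have "\<dots> = sweedler H (\<lambda>x' x3. sweedler H (\<lambda>y' y3. sweedler H (\<lambda>x1 x2. sweedler H (\<lambda>y1 y2.
      ?F x1 x2 x3 y1 y2 y3) y') x') y) x"
      by (subst sweedler_swap[of "hscl H"]) (intro lin_intros | simp)+
    \<comment> \<open>Once the first two legs of x and of y are adjacent, multiplicativity of the
      coproduct fuses them into the two legs of \<open>x' * y'\<close>, to which the antipode axiom
      applies.\<close>
    also have "\<dots> = sweedler H (\<lambda>x' x3. sweedler H (\<lambda>y' y3.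
        sweedler H (\<lambda>u v. antip H u * v * (antip H y3 * antip H x3)) (x' * y')) y) x"
      by (subst sweedler_mult[of "hscl H"]) (intro lin_intros | simp add: mult.assoc)+
    also have "\<dots> = sweedler H (\<lambda>x' x3. hscl H (counit H x') (sweedler H (\<lambda>y' y3.
        hscl H (counit H y') (antip H y3 * antip H x3)) y)) x"
      apply (subst sweedler_antip_left[where su="hscl H" and f="\<lambda>z. z * (antip H _ * antip H _)"])
      apply (intro lin_intros | simp add: counit_mult)+
      apply (subst sweedler_lin[of "hscl H" "hscl H" "hscl H _"])
      by (intro lin_intros | simp)+
    also have "\<dots> = antip H y * antip H x"
      by (subst sweedler_counit_left[of "hscl H"] | intro lin_intros | simp)+
    finally show ?thesis .
  qed
  ultimately show ?thesis by simp
qed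

text \<open>Again uniqueness of convolution inverses, now for the coproduct as a map from H to H
  \<otimes> H: its composite with S is a left inverse, and h \<mapsto> S(h_2) \<otimes> S(h_1) is a
  right inverse.\<close>

lemma sweedler_antip:
  assumes su: "vector_space su" and \<beta>: "hbil H su \<beta>"
  shows "sweedler H \<beta> (antip H h) = sweedler H (\<lambda>x y. \<beta> (antip H y) (antip H x)) h"
proof -
  note [lin_intros] = hbil_hlin[OF \<beta>]
  note [lin_intros] = su
  let ?F = "\<lambda>a b h2 h3 h4 h5. \<beta> ((a * h2) * antip H h5) (b * (h3 * antip H h4))"
  let ?X = "sweedler H (\<lambda>h1 r. sweedler H (\<lambda>a b. sweedler H (\<lambda>h2 s. sweedler H (\<lambda>h3 t.
    sweedler H (\<lambda>h4 h5. ?F a b h2 h3 h4 h5) t) s) r) (antip H h1)) h"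
  \<comment> \<open>The two legs of the coproduct cancel against the reversed antipodes from the
    inside out: h_3 against S(h_4) first, then h_2 against the last factor.\<close>
  have 1: "sweedler H (\<lambda>h3 t. sweedler H (\<lambda>h4 h5. ?F a b h2 h3 h4 h5) t) s = \<beta> ((a * h2) * antip H s) b"
    for a b h2 s
    by (subst antip_right_contract_left(1)[of su]) (intro lin_intros | simp)+
  have 2: "sweedler H (\<lambda>h2 s. \<beta> ((a * h2) * antip H s) b) r = su (counit H r) (\<beta> a b)" for a b r
    using sweedler_antip_right[OF su, of "\<lambda>z. \<beta> (a * z) b"] lin_intros by (simp add: mult.assoc)
  have "?X = sweedler H (\<lambda>h1 r. su (counit H r) (sweedler H \<beta> (antip H h1))) h"
    unfolding 1 2
    by (subst sweedler_lin[of su su "su _", symmetric]) (intro lin_scale lin_intros \<beta> | simp)+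
  also have "\<dots> = sweedler H \<beta> (antip H h)"
    by (rule sweedler_counit_right[of su]) (intro lin_intros \<beta>)+
  finally have A: "?X = sweedler H \<beta> (antip H h)" .
  have "?X = sweedler H (\<lambda>h1 r. sweedler H (\<lambda>a b. sweedler H (\<lambda>u t. sweedler H (\<lambda>h2 h3.
    sweedler H (\<lambda>h4 h5. ?F a b h2 h3 h4 h5) t) u) r) (antip H h1)) h"
    by (subst sweedler_coassoc[of su _ r for r]) (intro lin_intros | simp)+
  also have "\<dots> = sweedler H (\<lambda>h1 r. sweedler H (\<lambda>u t. sweedler H (\<lambda>a b. sweedler H (\<lambda>h2 h3.
    sweedler H (\<lambda>h4 h5. ?F a b h2 h3 h4 h5) t) u) (antip H h1)) r) h"
    by (subst sweedler_swap[of su]) (intro lin_intros | simp)+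
  also have "\<dots> = sweedler H (\<lambda>h1 r. sweedler H (\<lambda>u t. sweedler H (\<lambda>p q.
    sweedler H (\<lambda>h4 h5. \<beta> (p * antip H h5) (q * antip H h4)) t) (antip H h1 * u)) r) h"
    by (subst sweedler_mult[of su]) (intro lin_intros | simp add: mult.assoc)+
  also have "\<dots> = sweedler H (\<lambda>p q. sweedler H (\<lambda>h4 h5. \<beta> (p * antip H h5) (q * antip H h4)) h) 1"
    by (rule antip_left_contract_left(1)[of su]) (intro lin_intros)+
  also have "\<dots> = sweedler H (\<lambda>h4 h5. \<beta> (antip H h5) (antip H h4)) h"
    by (subst sweedler_one[of su]) (intro lin_intros | simp)+
  finally show ?thesis using A by simp
qed

text \<open>\<Lambda> is the component of 1 in a left ideal \<open>J\<close> complementary to the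
  kernel of \<epsilon>. The element (h - \<epsilon>(h) 1) \<Lambda> lies both in \<open>J\<close>
  and in that kernel, hence vanishes.\<close>

lemma normalized_left_integral:
  assumes "semisimple_ring TYPE('h)"
  obtains \<Lambda> where "\<And>h. h * \<Lambda> = hscl H (counit H h) \<Lambda>" "counit H \<Lambda> = 1"
proof -
  let ?I = "{x. counit H x = 0}"
  have \<epsilon>: "counit H (x + y) = counit H x + counit H y" "counit H (hscl H c x) = c * counit H x" for x y c
    using counit_linear by (simp_all add: linear_on_def)
  have \<epsilon>0: "counit H 0 = 0" using \<epsilon>(2)[of 0 0] by simp
  have I: "left_ideal ?I" by (simp add: left_ideal_def \<epsilon> \<epsilon>0 counit_mult)
  obtain J where J: "left_ideal J" "?I \<inter> J = {0}" "\<And>x. \<exists>i\<in>?I. \<exists>j\<in>J. x = i + j"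
    using assms[unfolded semisimple_ring_def, rule_format, OF I] by (elim exE conjE) simp
  from J(3)[of 1] obtain i \<Lambda> where \<Lambda>: "counit H i = 0" "\<Lambda> \<in> J" "1 = i + \<Lambda>" by blast
  have e: "counit H \<Lambda> = 1" using arg_cong[OF \<Lambda>(3), of "counit H"] \<Lambda>(1) by (simp add: \<epsilon> counit_one)
  have "h * \<Lambda> - hscl H (counit H h) \<Lambda> = 0" for h
  proof -
    have eq: "h * \<Lambda> - hscl H (counit H h) \<Lambda> = (h - hscl H (counit H h) 1) * \<Lambda>"
      by (simp add: left_diff_distrib scl_mult_left[symmetric])
    then have "h * \<Lambda> - hscl H (counit H h) \<Lambda> \<in> J"
      using J(1) \<Lambda>(2) unfolding left_ideal_def by metis
    moreover have "counit H (h - hscl H (counit H h) 1) = 0"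
      using \<epsilon>(1)[of "h - hscl H (counit H h) 1" "hscl H (counit H h) 1"] by (simp add: \<epsilon> counit_one)
    then have "h * \<Lambda> - hscl H (counit H h) \<Lambda> \<in> ?I" unfolding eq by (simp add: counit_mult)
    ultimately show ?thesis using J(2) by blast
  qed
  then show ?thesis using e by (intro that[of \<Lambda>]) (simp_all only: right_minus_eq)
qed

end

section \<open>Coordinates on a finite dimensional Hopf algebra and the trace form\<close>

lemma hlin_sum [lin_intros]:
  "vector_space su \<Longrightarrow> (\<And>i. i \<in> I \<Longrightarrow> hlin H su (F i)) \<Longrightarrow> hlin H su (\<lambda>x. \<Sum>i\<in>I. F i x)"
  using module.scale_sum_right[of su _ _ I]
  by (simp add: linear_on_def module_iff_vector_space sum.distrib)

locale fd_hopf_algebra = hopf_algebra H for H :: "('k::field, 'h::ring_1) hopf" +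
  fixes Bs :: "'h set"
  assumes finite_Bs: "finite Bs" and indep_Bs: "independent Bs" and span_Bs: "span Bs = UNIV"
begin

definition ch :: "'h \<Rightarrow> 'h \<Rightarrow> 'k" where
  "ch b h = representation Bs h b"

lemma sum_ch: "(\<Sum>b\<in>Bs. hscl H (ch b h) b) = h"
  unfolding ch_def using indep_Bs span_Bs finite_Bs by (intro sum_representation_eq) auto

lemma ch_basis: "b \<in> Bs \<Longrightarrow> c \<in> Bs \<Longrightarrow> ch b c = (if b = c then 1 else 0)"
  unfolding ch_def using indep_Bs by (simp add: representation_basis)

lemma ch_lin: "lin (hscl H) (*) (ch b)"
  using indep_Bs span_Bs
  by (simp add: linear_on_def ch_def representation_add representation_scale)

lemma hlin_ch [lin_intros]: "hlin H (hscl H) f \<Longrightarrow> hlin H (*) (\<lambda>x. ch b (f x))"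
  using ch_lin by (rule linear_on_compose[rotated])

lemma hlin_expand:
  assumes "vector_space su" "hlin H su f"
  shows "(\<Sum>b\<in>Bs. su (ch b h) (f b)) = f h"
proof -
  have "f (\<Sum>b\<in>Bs. hscl H (ch b h) b) = (\<Sum>b\<in>Bs. f (hscl H (ch b h) b))"
    by (rule linear_on_sum[OF vector_space_axioms _ assms(2)])
      (simp_all add: vector_space_subspace_UNIV vector_space_axioms)
  then show ?thesis using assms(2) by (simp add: sum_ch linear_on_def)
qed

text \<open>Expands the coproduct in the products c \<otimes> d of basis elements. Its matrix
  coefficients are what can be moved from one argument to another inside a trace.\<close>

lemma sweedler_expand:
  assumes su: "vector_space su" and G: "hbil H su G"
  shows "sweedler H G x =
    (\<Sum>c\<in>Bs. \<Sum>d\<in>Bs. su (sweedler H (\<lambda>u v. ch c u * ch d v) x) (G c d))"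
proof -
  interpret U: vector_space su by fact
  note [lin_intros] = hbil_hlin[OF G]
  have su' : "hbil H su (\<lambda>p q. su (ch c p * ch d q) (G c d))" "hbil H (*) (\<lambda>p q. ch c p * ch d q)" for c d
    by (intro lin_intros su)+
  have "G p q = (\<Sum>c\<in>Bs. \<Sum>d\<in>Bs. su (ch c p * ch d q) (G c d))" for p q
  proof -
    have "G p q = (\<Sum>c\<in>Bs. su (ch c p) (G c q))"
      by (rule hlin_expand[symmetric, OF su]) (intro lin_intros)
    moreover have "G c q = (\<Sum>d\<in>Bs. su (ch d q) (G c d))" for c
      by (rule hlin_expand[symmetric, OF su]) (intro lin_intros)
    ultimately show ?thesis by (simp add: U.scale_sum_right)
  qed
  then have "G = (\<lambda>p q. \<Sum>c\<in>Bs. \<Sum>d\<in>Bs. su (ch c p * ch d q) (G c d))"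
    by (intro ext)
  then have "sweedler H G x = sweedler H (\<lambda>p q. \<Sum>c\<in>Bs. \<Sum>d\<in>Bs. su (ch c p * ch d q) (G c d)) x"
    by (rule arg_cong)
  also have "\<dots> = (\<Sum>c\<in>Bs. sweedler H (\<lambda>p q. \<Sum>d\<in>Bs. su (ch c p * ch d q) (G c d)) x)"
    by (rule sweedler_sum[OF su _ finite_Bs])
      (intro lin_intros hlin_sum su)
  also have "\<dots> = (\<Sum>c\<in>Bs. \<Sum>d\<in>Bs. sweedler H (\<lambda>p q. su (ch c p * ch d q) (G c d)) x)"
    by (intro sum.cong refl sweedler_sum[OF su su'(1) finite_Bs])
  also have "\<dots> = (\<Sum>c\<in>Bs. \<Sum>d\<in>Bs. su (sweedler H (\<lambda>u v. ch c u * ch d v) x) (G c d))"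
    by (intro sum.cong refl sweedler_lin[OF vector_space_mult su _ su'(2), symmetric])
      (simp add: linear_on_def U.scale_left_distrib)
  finally show ?thesis .
qed

definition trace_form :: "'h \<Rightarrow> 'k" where
  "trace_form h = (\<Sum>b\<in>Bs. ch b (antip H (antip H b) * h))"

lemma trace_form_lin: "lin (hscl H) (*) trace_form"
proof -
  have "lin (hscl H) (*) (\<lambda>h. ch b (antip H (antip H b) * h))" for b
    by (intro lin_intros)
  then show ?thesis
    by (simp add: linear_on_def trace_form_def[abs_def] sum.distrib sum_distrib_left)
qed

text \<open>
  With \<open>z(b) = S\<^sup>2(b) h\<close> one has \<open>S\<^sup>2(b) h\<^sub>1 \<otimes> h\<^sub>2 = z(b\<^sub>1)\<^sub>1 \<otimes> S(b\<^sub>2) z(b\<^sub>1)\<^sub>2\<close>; in the trace over \<open>b\<close> the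
  comultiplication of \<open>b\<close> may be moved to \<open>z\<close>, which gives \<open>z\<^sub>1 \<otimes> S(z\<^sub>2) z\<^sub>3 = z \<otimes> 1\<close>.
\<close>

lemma trace_form_integral:
  "sweedler H (\<lambda>x y. hscl H (trace_form x) y) h = hscl H (trace_form h) 1"
proof -
  let ?S = "antip H"
  \<comment> \<open>As S reverses products and coproducts, S^2 respects both. Hence the coproduct of
    S^2(p) h is S^2(p_1) h_1 \<otimes> S^2(p_2) h_2, and S(q) S^2(p_2) = S(S(p_2) q), where S(p_2) q
    contracts to a counit.\<close>
  have step1: "sweedler H (\<lambda>x w. hscl H (ch b (?S (?S y) * x)) w) h =
      sweedler H (\<lambda>p q. sweedler H (\<lambda>x w. hscl H (ch b x) (?S q * w)) (?S (?S p) * h)) y" for b y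
  proof -
    have "sweedler H (\<lambda>p q. sweedler H (\<lambda>x w. hscl H (ch b x) (?S q * w)) (?S (?S p) * h)) y =
      sweedler H (\<lambda>p q. sweedler H (\<lambda>p1 p2. sweedler H (\<lambda>h1 h2.
         hscl H (ch b (?S (?S p1) * h1)) (?S (?S p2 * q) * h2)) h) p) y"
      apply (subst sweedler_mult[of "hscl H"])
        apply (intro lin_intros)+
      apply (subst sweedler_antip[of "hscl H"])
        apply (intro lin_intros)+
      apply (subst sweedler_antip[of "hscl H"])
        apply (intro lin_intros)+
      by (simp add: antip_mult mult.assoc)
    also have "\<dots> = sweedler H (\<lambda>p1 r. sweedler H (\<lambda>p2 q. sweedler H (\<lambda>h1 h2.
         hscl H (ch b (?S (?S p1) * h1)) (?S (?S p2 * q) * h2)) h) r) y"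
      by (subst sweedler_coassoc[of "hscl H"]) (intro lin_intros | simp)+
    also have "\<dots> = sweedler H (\<lambda>h1 h2. hscl H (ch b (?S (?S y) * h1)) (?S 1 * h2)) h"
      by (subst antip_left_contract_right(1)[of "hscl H"]) (intro lin_intros | simp)+
    finally show ?thesis by (simp add: antip_one)
  qed
  \<comment> \<open>With \<open>?g c d\<close> the coefficient of c \<otimes> d in the coproduct,
    both sides become triple sums over b, c, d. Summing over b first replaces the coefficients of
    the coproduct of b by those of the leg x, because b enters only through its coordinate
    functional.\<close>
  have step2: "(\<Sum>b\<in>Bs. sweedler H (\<lambda>p q. sweedler H (\<lambda>x w. hscl H (ch b x) (?S q * w)) (?S (?S p) * h)) b) =
    (\<Sum>c\<in>Bs. sweedler H (\<lambda>x w. sweedler H (\<lambda>u v. hscl H (ch c u) (?S v * w)) x) (?S (?S c) * h))"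
  proof -
    let ?J = "\<lambda>p q b. sweedler H (\<lambda>x w. hscl H (ch b x) (?S q * w)) (?S (?S p) * h)"
    let ?g = "\<lambda>c d. sweedler H (\<lambda>u v. ch c u * ch d v)"
    have J: "(\<Sum>b\<in>Bs. hscl H (?g c d b) (?J c d b)) =
      sweedler H (\<lambda>x w. hscl H (?g c d x) (?S d * w)) (?S (?S c) * h)" for c d
    proof -
      have e: "hscl H (?g c d b) (?J c d b) =
          sweedler H (\<lambda>x w. hscl H (?g c d b * ch b x) (?S d * w)) (?S (?S c) * h)" for b
        by (subst sweedler_lin[OF _ _ lin_scale, of "hscl H"]) (intro lin_intros | simp)+
      have "(\<Sum>b\<in>Bs. hscl H (?g c d b) (?J c d b)) =
          sweedler H (\<lambda>x w. \<Sum>b\<in>Bs. hscl H (?g c d b * ch b x) (?S d * w)) (?S (?S c) * h)"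
        unfolding e by (rule sweedler_sum[OF vector_space_axioms, symmetric]) (intro lin_intros finite_Bs)+
      also have "(\<lambda>x w. \<Sum>b\<in>Bs. hscl H (?g c d b * ch b x) (?S d * w)) = (\<lambda>x w. hscl H (?g c d x) (?S d * w))"
      proof (intro ext)
        fix x w
        \<comment> \<open>The exchange itself: the linear functional \<open>?g c d\<close> is
          expanded in the basis.\<close>
        have "(\<Sum>b\<in>Bs. ch b x * ?g c d b) = ?g c d x"
          by (rule hlin_expand[OF vector_space_mult]) (intro lin_intros)
        then show "(\<Sum>b\<in>Bs. hscl H (?g c d b * ch b x) (?S d * w)) = hscl H (?g c d x) (?S d * w)"
          by (simp add: scale_sum_left[symmetric] mult.commute)
      qed
      finally show ?thesis .
    qed
    have g: "(\<Sum>d\<in>Bs. hscl H (?g c d x) (?S d * w)) = sweedler H (\<lambda>u v. hscl H (ch c u) (?S v * w)) x" for c x w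
    proof -
      have e: "hscl H (?g c d x) (?S d * w) = sweedler H (\<lambda>u v. hscl H (ch c u * ch d v) (?S d * w)) x" for d
        by (rule sweedler_lin[of "(*)" "hscl H" "\<lambda>k. hscl H k _"])
          ((intro lin_intros)+ | simp add: linear_on_def scale_left_distrib)+
      have "(\<Sum>d\<in>Bs. hscl H (?g c d x) (?S d * w)) =
        sweedler H (\<lambda>u v. \<Sum>d\<in>Bs. hscl H (ch c u * ch d v) (?S d * w)) x"
        unfolding e by (rule sweedler_sum[OF vector_space_axioms, symmetric]) (intro lin_intros finite_Bs)+
      also have "(\<lambda>u v. \<Sum>d\<in>Bs. hscl H (ch c u * ch d v) (?S d * w)) = (\<lambda>u v. hscl H (ch c u) (?S v * w))"
      proof (intro ext)
        fix u v
        have "(\<Sum>d\<in>Bs. hscl H (ch d v) (?S d * w)) = ?S v * w"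
          by (rule hlin_expand) (intro lin_intros)+
        then show "(\<Sum>d\<in>Bs. hscl H (ch c u * ch d v) (?S d * w)) = hscl H (ch c u) (?S v * w)"
          by (simp add: scale_scale[symmetric] scale_sum_right[symmetric] del: scale_scale)
      qed
      finally show ?thesis .
    qed
    have "(\<Sum>b\<in>Bs. sweedler H (\<lambda>p q. ?J p q b) b) =
        (\<Sum>b\<in>Bs. \<Sum>c\<in>Bs. \<Sum>d\<in>Bs. hscl H (?g c d b) (?J c d b))"
      by (intro sum.cong refl sweedler_expand[OF vector_space_axioms]) (intro lin_intros)+
    also have "\<dots> = (\<Sum>c\<in>Bs. \<Sum>b\<in>Bs. \<Sum>d\<in>Bs. hscl H (?g c d b) (?J c d b))"
      by (rule sum.swap)
    also have "\<dots> = (\<Sum>c\<in>Bs. \<Sum>d\<in>Bs. \<Sum>b\<in>Bs. hscl H (?g c d b) (?J c d b))"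
      by (intro sum.cong refl sum.swap)
    also have "\<dots> = (\<Sum>c\<in>Bs. sweedler H (\<lambda>x w. \<Sum>d\<in>Bs. hscl H (?g c d x) (?S d * w)) (?S (?S c) * h))"
      unfolding J by (intro sum.cong refl sweedler_sum[OF vector_space_axioms, symmetric] finite_Bs; (intro lin_intros)?)
    finally show ?thesis unfolding g .
  qed
  have lam: "hscl H (trace_form x) y = (\<Sum>b\<in>Bs. hscl H (ch b (?S (?S b) * x)) y)" for x y
    by (simp add: trace_form_def scale_sum_left)
  have "sweedler H (\<lambda>x y. hscl H (trace_form x) y) h =
      (\<Sum>b\<in>Bs. sweedler H (\<lambda>x y. hscl H (ch b (?S (?S b) * x)) y) h)"
    unfolding lam by (rule sweedler_sum[OF vector_space_axioms]) ((intro lin_intros finite_Bs)+)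
  also have "\<dots> = (\<Sum>c\<in>Bs. hscl H (ch c (?S (?S c) * h)) 1)"
    unfolding step1 step2
    by (intro sum.cong refl antip_left_contract_right(2)[OF vector_space_axioms]) (intro lin_intros)+
  finally show ?thesis unfolding lam .
qed

text \<open>Insert S(h_1) h_2 \<otimes> h_3, which is 1 \<otimes> h. Then h_2 and h_3 act on the
  coproduct of \<Lambda> as the coproduct of a single element times \<Lambda>, which is absorbed by
  the integral property.\<close>

lemma left_integral_antip:
  assumes \<Lambda>: "\<And>h. h * \<Lambda> = hscl H (counit H h) \<Lambda>" and su: "vector_space su" and \<beta>: "hbil H su \<beta>"
  shows "sweedler H (\<lambda>x y. \<beta> x (h * y)) \<Lambda> = sweedler H (\<lambda>x y. \<beta> (antip H h * x) y) \<Lambda>"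
proof -
  note [lin_intros] = hbil_hlin[OF \<beta>]
  note [lin_intros] = su
  have "sweedler H (\<lambda>x y. \<beta> x (h * y)) \<Lambda> = sweedler H (\<lambda>x y. \<beta> (1 * x) (h * y)) \<Lambda>" by simp
  also have "\<dots> = sweedler H (\<lambda>h1 r. sweedler H (\<lambda>h2 h3. sweedler H (\<lambda>x y. \<beta> ((antip H h1 * h2) * x) (h3 * y)) \<Lambda>) r) h"
    by (rule antip_left_contract_left(1)[symmetric, OF su]) (intro lin_intros)+
  also have "\<dots> = sweedler H (\<lambda>h1 r. sweedler H (\<lambda>p q. \<beta> (antip H h1 * p) q) (r * \<Lambda>)) h"
    by (subst sweedler_mult[of su]) (intro lin_intros | simp add: mult.assoc)+
  also have "\<dots> = sweedler H (\<lambda>h1 r. su (counit H r) (sweedler H (\<lambda>p q. \<beta> (antip H h1 * p) q) \<Lambda>)) h"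
  proof -
    have "hlin H su (\<lambda>z. sweedler H (\<lambda>p q. \<beta> (antip H h1 * p) q) z)" for h1
      by (intro lin_intros)
    then show ?thesis unfolding \<Lambda> by (simp add: linear_on_def)
  qed
  also have "\<dots> = sweedler H (\<lambda>x y. \<beta> (antip H h * x) y) \<Lambda>"
    by (rule sweedler_counit_right[OF su]) (intro lin_intros)+
  finally show ?thesis .
qed

lemma bij_antip:
  assumes "semisimple_ring TYPE('h)"
  shows "bij (antip H)"
proof -
  obtain \<Lambda> where \<Lambda>: "\<And>h. h * \<Lambda> = hscl H (counit H h) \<Lambda>" "counit H \<Lambda> = 1"
    using normalized_left_integral[OF assms] by blast
  \<comment> \<open>S^2(b) \<Lambda> = \<epsilon>(b) \<Lambda>, since \<epsilon> is invariant under
    S; the trace is therefore the basis expansion of \<epsilon>(\<Lambda>).\<close>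
  have "trace_form \<Lambda> = (\<Sum>b\<in>Bs. ch b \<Lambda> * counit H b)"
    using ch_lin by (simp add: trace_form_def \<Lambda>(1) counit_antip linear_on_def mult.commute)
  also have "\<dots> = 1"
    using hlin_expand[OF vector_space_mult counit_linear, of \<Lambda>] \<Lambda>(2) by simp
  finally have t: "trace_form \<Lambda> = 1" .
  have [lin_intros]: "hlin H (*) (\<lambda>x. trace_form (g x))" if "hlin H (hscl H) g" for g
    using trace_form_lin that by (auto simp: linear_on_def)
  define R where "R s = sweedler H (\<lambda>x y. hscl H (trace_form (s * x)) y) \<Lambda>" for s
  have inv: "R (antip H h) = h" for h
  proof -
    have "sweedler H (\<lambda>x y. hscl H (trace_form (antip H h * x)) y) \<Lambda> =
        sweedler H (\<lambda>x y. hscl H (trace_form x) (h * y)) \<Lambda>"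
      by (rule left_integral_antip[OF \<Lambda>(1), symmetric, of "hscl H"]) (intro lin_intros)+
    also have "\<dots> = h * sweedler H (\<lambda>x y. hscl H (trace_form x) y) \<Lambda>"
      by (subst sweedler_lin[of "hscl H" "hscl H" "\<lambda>x. h * x"])
        (intro lin_intros | simp add: scl_mult_right)+
    finally show ?thesis by (simp add: R_def trace_form_integral t)
  qed
  then have inj: "inj (antip H)" by (metis injI)
  interpret F: finite_dimensional_vector_space "hscl H" Bs
    by unfold_locales (use finite_Bs indep_Bs span_Bs in auto)
  have "Vector_Spaces.linear (hscl H) (hscl H) (antip H)"
    using antip_linear by (simp add: linear_on_UNIV_iff vector_space_axioms)
  then have "surj (antip H)" using F.linear_inj_imp_surj inj by blast
  with inj show ?thesis by (simp add: bij_def)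
qed

end

section \<open>The inverse of the antipode\<close>

locale fd_hopf_algebra_bij = fd_hopf_algebra H Bs
  for H :: "('k::field, 'h::ring_1) hopf" and Bs :: "'h set" +
  assumes bij_S: "bij (antip H)"
begin

abbreviation T :: "'h \<Rightarrow> 'h" where "T \<equiv> inv (antip H)"

lemma T_antip [simp]: "T (antip H h) = h"
  using bij_S by (simp add: bij_is_inj)

lemma antip_T [simp]: "antip H (T h) = h"
  using bij_S by (simp add: bij_is_surj surj_f_inv_f)

lemma T_eqI: "antip H x = y \<Longrightarrow> T y = x"
  by auto

lemma T_lin: "lin (hscl H) (hscl H) T"
  using antip_linear by (auto simp: linear_on_def intro!: T_eqI)

lemma hlin_T [lin_intros]: "hlin H (hscl H) f \<Longrightarrow> hlin H (hscl H) (\<lambda>x. T (f x))"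
  using T_lin by (rule linear_on_compose[rotated])

lemma T_mult: "T (x * y) = T y * T x"
  by (rule T_eqI) (simp add: antip_mult)

lemma T_one: "T 1 = 1"
  by (rule T_eqI) (rule antip_one)

text \<open>Read \<open>sweedler_antip\<close> backwards at the element \<open>T h\<close>, for the
  form obtained from \<open>\<beta>\<close> by applying \<open>T\<close> to both legs and
  interchanging them.\<close>

lemma sweedler_T:
  assumes su: "vector_space su" and \<beta>: "hbil H su \<beta>"
  shows "sweedler H \<beta> (T h) = sweedler H (\<lambda>x y. \<beta> (T y) (T x)) h"
proof -
  note [lin_intros] = hbil_hlin[OF \<beta>]
  have "sweedler H (\<lambda>x y. \<beta> (T y) (T x)) (antip H (T h)) = sweedler H \<beta> (T h)"
    by (subst sweedler_antip[OF su]) (intro lin_intros su | simp)+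
  then show ?thesis by simp
qed

lemma hbil_T: "hbil H (hscl H) (\<lambda>x y. T y * x)" "hbil H (hscl H) (\<lambda>x y. y * T x)"
  by (intro lin_intros)+

lemma T_scale_one: "T (hscl H c 1) = hscl H c 1"
  using T_lin by (simp add: linear_on_def T_one)

text \<open>The antipode axiom S(h_1) h_2 = \<epsilon>(h) 1 after applying the anti-multiplicative
  map \<open>T\<close>.\<close>

lemma sweedler_T_left: "sweedler H (\<lambda>x y. T y * x) h = hscl H (counit H h) 1"
proof -
  have "T (sweedler H (\<lambda>x y. antip H x * y) h) = sweedler H (\<lambda>x y. T (antip H x * y)) h"
    by (rule sweedler_lin[of "hscl H" "hscl H"]) (intro lin_intros T_lin)+
  then show ?thesis by (simp add: T_mult antip_left T_scale_one)
qed

lemma sweedler_T_right: "sweedler H (\<lambda>x y. y * T x) h = hscl H (counit H h) 1"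
proof -
  have "T (sweedler H (\<lambda>x y. x * antip H y) h) = sweedler H (\<lambda>x y. T (x * antip H y)) h"
    by (rule sweedler_lin[of "hscl H" "hscl H"]) (intro lin_intros T_lin)+
  then show ?thesis by (simp add: T_mult antip_right T_scale_one)
qed

lemmas T_left_contract_left = sweedler_contract_left[OF _ _ hbil_T(1) sweedler_T_left]
lemmas T_right_contract_left = sweedler_contract_left[OF _ _ hbil_T(2) sweedler_T_right]

end

section \<open>Graded vector spaces and Hom complexes\<close>

text \<open>Separate from \<open>dg_space\<close> because the differential and product of Hom
  complexes are defined through homogeneous components: the grading must be usable before the
  complex is known to be one.\<close>

locale graded_space = vector_space s
  for s :: "'k::field \<Rightarrow> 'v::ab_group_add \<Rightarrow> 'v" +
  fixes G :: "int \<Rightarrow> 'v set"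
  assumes G_subspace: "subspace (G n)"
    and G_direct: "finite I \<Longrightarrow> (\<And>i. i \<in> I \<Longrightarrow> y i \<in> G i) \<Longrightarrow> (\<Sum>i\<in>I. y i) = 0 \<Longrightarrow> n \<in> I \<Longrightarrow> y n = 0"
begin

definition total :: "'v set" where
  "total = span (\<Union>n. G n)"

lemma total_subspace: "subspace total"
  by (simp add: total_def)

lemma G_total: "x \<in> G n \<Longrightarrow> x \<in> total"
  unfolding total_def by (rule span_base) blast

text \<open>The predicate under the definite description in \<open>hcomp\<close>, named so that
  existence and uniqueness can be stated.\<close>

definition decomp :: "'v \<Rightarrow> (int \<Rightarrow> 'v) \<Rightarrow> bool" where
  "decomp x c \<longleftrightarrow> finite {n. c n \<noteq> 0} \<and> (\<forall>n. c n \<in> G n) \<and> x = (\<Sum>n | c n \<noteq> 0. c n)"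

lemma sum_support:
  assumes "finite I" "{n. c n \<noteq> (0::'v)} \<subseteq> I" "\<And>n. \<phi> n 0 = 0"
  shows "(\<Sum>n | c n \<noteq> 0. \<phi> n (c n)) = (\<Sum>n\<in>I. \<phi> n (c n))"
  by (rule sum.mono_neutral_left) (use assms in auto)

lemma decomp_sum: "decomp x c \<Longrightarrow> finite I \<Longrightarrow> {n. c n \<noteq> 0} \<subseteq> I \<Longrightarrow> x = (\<Sum>n\<in>I. c n)"
  using sum_support[of I c "\<lambda>n x. x"] by (auto simp: decomp_def)

lemma decomp_unique:
  assumes "decomp x c" "decomp x d"
  shows "c = d"
proof
  fix n
  let ?I = "insert n ({n. c n \<noteq> 0} \<union> {n. d n \<noteq> 0})"
  have I: "finite ?I" using assms by (simp add: decomp_def)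
  have "(\<Sum>n\<in>?I. c n - d n) = 0"
    using decomp_sum[OF assms(1) I] decomp_sum[OF assms(2) I] by (auto simp: sum_subtractf)
  then have "c n - d n = 0"
    by (rule G_direct[OF I, rotated])
      (use assms subspace_diff[OF G_subspace] in \<open>auto simp: decomp_def\<close>)
  then show "c n = d n" by simp
qed

lemma hcomp_eqI: "decomp x c \<Longrightarrow> hcomp G x = c"
  unfolding hcomp_def using decomp_unique by (intro the_equality) (auto simp: decomp_def)

lemma decompI:
  assumes "finite I" "\<And>n. c n \<in> G n" "\<And>n. n \<notin> I \<Longrightarrow> c n = 0" "x = (\<Sum>n\<in>I. c n)"
  shows "decomp x c"
proof -
  have "{n. c n \<noteq> 0} \<subseteq> I" using assms(3) by blast
  then show ?thesis
    using assms(1,2,4) sum_support[of I c "\<lambda>n x. x"] finite_subset by (auto simp: decomp_def)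
qed

lemma decomp_homogeneous: "x \<in> G n \<Longrightarrow> decomp x (\<lambda>m. if m = n then x else 0)"
  by (rule decompI[of "{n}"]) (auto simp: subspace_0[OF G_subspace])

lemma decomp_add:
  assumes "decomp x c" "decomp y d"
  shows "decomp (x + y) (\<lambda>n. c n + d n)"
proof (rule decompI[of "{n. c n \<noteq> 0} \<union> {n. d n \<noteq> 0}"])
  show fin: "finite ({n. c n \<noteq> 0} \<union> {n. d n \<noteq> 0})"
    using assms by (simp add: decomp_def)
  show "x + y = (\<Sum>n\<in>{n. c n \<noteq> 0} \<union> {n. d n \<noteq> 0}. c n + d n)"
    using decomp_sum[OF assms(1) fin] decomp_sum[OF assms(2) fin] by (simp add: sum.distrib)
qed (use assms subspace_add[OF G_subspace] in \<open>auto simp: decomp_def\<close>)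

lemma decomp_scale:
  assumes "decomp x c"
  shows "decomp (s k x) (\<lambda>n. s k (c n))"
  by (rule decompI[of "{n. c n \<noteq> 0}"])
    (use assms subspace_scale[OF G_subspace] in \<open>auto simp: decomp_def scale_sum_right\<close>)

lemma decomp_hcomp: "x \<in> total \<Longrightarrow> decomp x (hcomp G x)"
proof -
  assume "x \<in> total"
  then have "\<exists>c. decomp x c" unfolding total_def
  proof (induction rule: span_induct_alt)
    case base
    show ?case using decompI[of "{}" "\<lambda>_. 0" 0] subspace_0[OF G_subspace] by auto
  next
    case (step k x y)
    then obtain n where "x \<in> G n" by blast
    then show ?case using step decomp_add decomp_scale decomp_homogeneous by blast
  qed
  then show ?thesis using hcomp_eqI by blast
qed

lemma hcomp_homogeneous: "x \<in> G n \<Longrightarrow> hcomp G x = (\<lambda>m. if m = n then x else 0)"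
  by (rule hcomp_eqI[OF decomp_homogeneous])

lemma hcomp_add: "x \<in> total \<Longrightarrow> y \<in> total \<Longrightarrow> hcomp G (x + y) = (\<lambda>n. hcomp G x n + hcomp G y n)"
  by (intro hcomp_eqI decomp_add decomp_hcomp)

lemma hcomp_scale: "x \<in> total \<Longrightarrow> hcomp G (s k x) = (\<lambda>n. s k (hcomp G x n))"
  by (intro hcomp_eqI decomp_scale decomp_hcomp)

lemma hcomp_mem: "x \<in> total \<Longrightarrow> hcomp G x n \<in> G n"
  using decomp_hcomp by (auto simp: decomp_def)

lemma finite_hcomp: "x \<in> total \<Longrightarrow> finite {n. hcomp G x n \<noteq> 0}"
  using decomp_hcomp by (auto simp: decomp_def)

text \<open>The common shape of \<open>dif\<close> in \<open>hom_dgs\<close> and, iterated, of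
  \<open>mul\<close> in \<open>end_dga\<close>: a family of maps, one for each degree, applied to
  the homogeneous components.\<close>

definition extend :: "(int \<Rightarrow> 'v \<Rightarrow> 'w::ab_group_add) \<Rightarrow> 'v \<Rightarrow> 'w" where
  "extend \<phi> x = (\<Sum>n | hcomp G x n \<noteq> 0. \<phi> n (hcomp G x n))"

text \<open>The condition on \<phi> covers x = 0, whose support is empty, so that the defining sum
  has no terms.\<close>

lemma extend_homogeneous:
  assumes "x \<in> G n" "\<phi> n 0 = 0"
  shows "extend \<phi> x = \<phi> n x"
proof -
  have "{m. (if m = n then x else 0) \<noteq> 0} = (if x = 0 then {} else {n})" by auto
  then show ?thesis by (simp add: extend_def hcomp_homogeneous[OF assms(1)] assms(2))
qed

text \<open>The support of a sum may be smaller than the union of the supports. All sums are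
  therefore taken over that union, where components add and vanishing ones contribute 0.\<close>

lemma extend_linear:
  assumes t: "vector_space t" "module.subspace t W"
    and \<phi>: "\<And>n. linear_on s (G n) t W (\<phi> n)"
  shows "linear_on s total t W (extend \<phi>)"
proof -
  interpret T: vector_space t by fact
  have \<phi>0: "\<phi> n 0 = 0" for n
    using linear_on_zero[OF \<phi> subspace_0[OF G_subspace]] .
  have add: "extend \<phi> (x + y) = extend \<phi> x + extend \<phi> y" if "x \<in> total" "y \<in> total" for x y
  proof -
    let ?I = "{n. hcomp G x n \<noteq> 0} \<union> {n. hcomp G y n \<noteq> 0}"
    have I: "finite ?I" using that finite_hcomp by blast
    have "extend \<phi> (x + y) = (\<Sum>n\<in>?I. \<phi> n (hcomp G x n + hcomp G y n))"
      unfolding extend_def hcomp_add[OF that]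
      by (rule sum_support) (use I \<phi>0 in auto)
    also have "\<dots> = (\<Sum>n\<in>?I. \<phi> n (hcomp G x n)) + (\<Sum>n\<in>?I. \<phi> n (hcomp G y n))"
      using that hcomp_mem linear_onD(2)[OF \<phi>] by (simp add: sum.distrib)
    also have "(\<Sum>n\<in>?I. \<phi> n (hcomp G x n)) = extend \<phi> x"
      unfolding extend_def by (rule sum_support[symmetric]) (use I \<phi>0 in auto)
    also have "(\<Sum>n\<in>?I. \<phi> n (hcomp G y n)) = extend \<phi> y"
      unfolding extend_def by (rule sum_support[symmetric]) (use I \<phi>0 in auto)
    finally show ?thesis .
  qed
  moreover have "extend \<phi> (s k x) = t k (extend \<phi> x)" if "x \<in> total" for k x
  proof -
    have "extend \<phi> (s k x) = (\<Sum>n | hcomp G x n \<noteq> 0. \<phi> n (s k (hcomp G x n)))"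
      unfolding extend_def hcomp_scale[OF that]
      by (rule sum_support) (use finite_hcomp[OF that] \<phi>0 in auto)
    then show ?thesis
      using that hcomp_mem linear_onD(3)[OF \<phi>] by (simp add: extend_def T.scale_sum_right)
  qed
  moreover have "extend \<phi> x \<in> W" if "x \<in> total" for x
    unfolding extend_def using that hcomp_mem linear_onD(1)[OF \<phi>]
    by (intro T.subspace_sum[OF t(2)]) blast
  ultimately show ?thesis by (simp add: linear_on_def)
qed

end

context dg_space
begin

lemma carr_0 [simp]: "0 \<in> carr V"
  and carr_add: "x \<in> carr V \<Longrightarrow> y \<in> carr V \<Longrightarrow> x + y \<in> carr V"
  and carr_diff: "x \<in> carr V \<Longrightarrow> y \<in> carr V \<Longrightarrow> x - y \<in> carr V"
  and carr_scale: "x \<in> carr V \<Longrightarrow> scl V c x \<in> carr V"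
  using subspace_0 subspace_add subspace_diff subspace_scale carr_subspace by auto

lemma dif_carr: "x \<in> carr V \<Longrightarrow> dif V x \<in> carr V"
  and dif_add: "x \<in> carr V \<Longrightarrow> y \<in> carr V \<Longrightarrow> dif V (x + y) = dif V x + dif V y"
  and dif_scale: "x \<in> carr V \<Longrightarrow> dif V (scl V c x) = scl V c (dif V x)"
  and dif_0 [simp]: "dif V 0 = 0"
  using dif_linear linear_on_zero[OF dif_linear carr_0] by (auto simp: linear_on_def)

lemma dif_diff: "x \<in> carr V \<Longrightarrow> y \<in> carr V \<Longrightarrow> dif V (x - y) = dif V x - dif V y"
  by (rule linear_on_diff[OF vector_space_axioms carr_subspace dif_linear])

lemma dif_ksgn: "x \<in> carr V \<Longrightarrow> dif V (ksgn n x) = ksgn n (dif V x)"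
  by (rule linear_on_ksgn[OF vector_space_axioms carr_subspace dif_linear])

lemma carr_ksgn: "x \<in> carr V \<Longrightarrow> ksgn n x \<in> carr V"
  by (rule subspace_ksgn[OF vector_space_axioms carr_subspace])

lemma gr_ksgn: "x \<in> gr V m \<Longrightarrow> ksgn n x \<in> gr V m"
  by (rule subspace_ksgn[OF vector_space_axioms gr_subspace])

lemma graded_space: "graded_space (scl V) (gr V)"
  by unfold_locales (use gr_subspace gr_direct in auto)

lemma linear_on_carr_eqI:
  assumes "linear_on (scl V) (carr V) t W f" "linear_on (scl V) (carr V) t' W' g"
    and "\<And>n x. x \<in> gr V n \<Longrightarrow> f x = g x" and "x \<in> carr V"
  shows "f x = g x"
  using assms(4)
  by (induction rule: carr_induct)
    (auto simp: assms(3) linear_on_zero[OF assms(1)] linear_on_zero[OF assms(2)]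
      linear_onD(2)[OF assms(1)] linear_onD(2)[OF assms(2)])

end

context dg_module
begin

lemma act_linear: "b \<in> carr B \<Longrightarrow> linear_on (scl M) (carr M) (scl M) (carr M) (act b)"
  using act_bilinear by (simp add: bilinear_on_def)

lemma act_linear_left: "m \<in> carr M \<Longrightarrow> linear_on (scl B) (carr B) (scl M) (carr M) (\<lambda>b. act b m)"
  using act_bilinear by (simp add: bilinear_on_def)

lemma act_carr: "b \<in> carr B \<Longrightarrow> m \<in> carr M \<Longrightarrow> act b m \<in> carr M"
  by (rule linear_onD(1)[OF act_linear])

lemma act_add: "b \<in> carr B \<Longrightarrow> m \<in> carr M \<Longrightarrow> n \<in> carr M \<Longrightarrow> act b (m + n) = act b m + act b n"
  by (rule linear_onD(2)[OF act_linear])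

lemma act_diff: "b \<in> carr B \<Longrightarrow> m \<in> carr M \<Longrightarrow> n \<in> carr M \<Longrightarrow> act b (m - n) = act b m - act b n"
  by (rule linear_on_diff[OF M.vector_space_axioms M.carr_subspace act_linear])

lemma act_scale: "b \<in> carr B \<Longrightarrow> m \<in> carr M \<Longrightarrow> act b (scl M c m) = scl M c (act b m)"
  by (rule linear_onD(3)[OF act_linear])

lemma act_ksgn: "b \<in> carr B \<Longrightarrow> m \<in> carr M \<Longrightarrow> act b (ksgn n m) = ksgn n (act b m)"
  by (rule linear_on_ksgn[OF M.vector_space_axioms M.carr_subspace act_linear])

lemma act_0 [simp]: "b \<in> carr B \<Longrightarrow> act b 0 = 0"
  using linear_on_zero[OF act_linear] by simp

end

locale dg_module_pair = M: dg_module B M actM + N: dg_module B N actN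
  for B :: "('k::field, 'b::ab_group_add, 'x) dga_scheme"
    and M :: "('k, 'm::ab_group_add, 'y) dgs_scheme" and actM
    and N :: "('k, 'n::ab_group_add, 'z) dgs_scheme" and actN
begin

abbreviation "homs \<equiv> hom_gr B M actM N actN"
abbreviation "Hom \<equiv> hom_dgs B M actM N actN"

lemma hom_grD:
  assumes "f \<in> homs i"
  shows "linear_on (scl M) (carr M) (scl N) (carr N) f" "x \<notin> carr M \<Longrightarrow> f x = 0"
    "x \<in> gr M j \<Longrightarrow> f x \<in> gr N (i + j)"
    "b \<in> gr B j \<Longrightarrow> m \<in> carr M \<Longrightarrow> f (actM b m) = ksgn (i * j) (actN b (f m))"
  using assms by (auto simp: hom_gr_def)

lemma hom_scl: "vector_space (\<lambda>c f x. scl N c (f x))"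
  by (rule vector_space_fun[OF N.M.vector_space_axioms])

lemma hom_gr_subspace: "module.subspace (\<lambda>c f x. scl N c (f x)) (homs i)"
proof -
  interpret V: vector_space "\<lambda>c (f :: 'm \<Rightarrow> 'n) x. scl N c (f x)" by (rule hom_scl)
  show ?thesis
  proof (rule V.subspaceI)
    show "0 \<in> homs i"
      by (rule zero_hom_gr[OF M.M.dg_space_axioms N.M.dg_space_axioms N.dg_module_axioms])
    show "f + g \<in> homs i" if "f \<in> homs i" "g \<in> homs i" for f g
      using that M.B.gr_carr
      by (auto simp: hom_gr_def linear_on_def plus_fun_apply N.act_add N.M.carr_add
          N.M.subspace_add[OF N.M.gr_subspace] N.M.scale_right_distrib)
    show "(\<lambda>x. scl N c (f x)) \<in> homs i" if "f \<in> homs i" for f c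
      using that M.B.gr_carr
      by (auto simp: hom_gr_def linear_on_def N.act_scale N.M.carr_scale
          N.M.subspace_scale[OF N.M.gr_subspace] N.M.scale_right_distrib
          ksgn_scale[OF N.M.vector_space_axioms] mult.commute)
  qed
qed

sublocale graded_space "\<lambda>c f x. scl N c (f x)" homs
  by (intro graded_space.intro graded_space_axioms.intro hom_scl hom_gr_subspace)
    (rule hom_gr_sum_zero[OF M.M.dg_space_axioms N.M.dg_space_axioms])

lemma hom_simps [simp]: "scl Hom = (\<lambda>c f x. scl N c (f x))" "gr Hom = homs" "carr Hom = total"
  by (simp_all add: hom_dgs_def carr_def total_def)

definition hdif :: "int \<Rightarrow> ('m \<Rightarrow> 'n) \<Rightarrow> 'm \<Rightarrow> 'n" where
  "hdif i f = (\<lambda>x. if x \<in> carr M then dif N (f x) - ksgn i (f (dif M x)) else 0)"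

lemma dif_Hom: "f \<in> homs i \<Longrightarrow> dif Hom f = hdif i f"
  unfolding hdif_def
  by (rule hom_dgs_dif[OF M.M.dg_space_axioms N.M.dg_space_axioms N.dg_module_axioms])

lemma dif_Hom_extend: "dif Hom = extend hdif"
  by (rule ext) (simp add: hom_dgs_def extend_def hdif_def Let_def)

lemma hom_carr: "f \<in> homs i \<Longrightarrow> x \<in> carr M \<Longrightarrow> f x \<in> carr N"
  by (rule linear_onD(1)[OF hom_grD(1)])

lemma hdif_mem:
  assumes f: "f \<in> homs i"
  shows "hdif i f \<in> homs (i + 1)"
  unfolding hom_gr_def
proof (intro CollectI conjI allI impI ballI)
  note fl = linear_onD[OF hom_grD(1)[OF f]]
  show "linear_on (scl M) (carr M) (scl N) (carr N) (hdif i f)"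
    by (auto simp: linear_on_def hdif_def fl M.M.dif_carr N.M.dif_carr M.M.dif_add N.M.dif_add
        M.M.dif_scale N.M.dif_scale M.M.carr_add M.M.carr_scale N.M.carr_diff N.M.carr_ksgn
        ksgn_scale[OF N.M.vector_space_axioms] N.M.scale_right_diff_distrib)
  show "hdif i f x = 0" if "x \<notin> carr M" for x using that by (simp add: hdif_def)
  show "hdif i f x \<in> gr N (i + 1 + j)" if x: "x \<in> gr M j" for x j
  proof -
    have "dif N (f x) \<in> gr N (i + 1 + j)"
      using N.M.dif_gr[OF hom_grD(3)[OF f x]] by (simp add: algebra_simps)
    moreover have "ksgn i (f (dif M x)) \<in> gr N (i + 1 + j)"
      using N.M.gr_ksgn[OF hom_grD(3)[OF f M.M.dif_gr[OF x]]] by (simp add: algebra_simps)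
    ultimately show ?thesis
      using x N.M.subspace_diff[OF N.M.gr_subspace] M.M.gr_carr by (auto simp: hdif_def)
  qed
  show "hdif i f (actM b m) = ksgn ((i + 1) * j) (actN b (hdif i f m))"
    if b: "b \<in> gr B j" and m: "m \<in> carr M" for b j m
  proof -
    have bc: "b \<in> carr B" "dif B b \<in> gr B (j + 1)" "dif B b \<in> carr B"
      using b M.B.gr_carr M.B.dif_gr by blast+
    \<comment> \<open>The two terms containing \<open>dif B b\<close> cancel: both carry the sign
      (-1)^(i j), one from \<open>act_leibniz\<close> in N and one, after i + i (j + 1) sign
      changes, with a minus from the commutator.\<close>
    have "hdif i f (actM b m) = ksgn (i * j) (dif N (actN b (f m))) -
        ksgn i (f (actM (dif B b) m) + f (ksgn j (actM b (dif M m))))"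
      using bc m by (simp add: hdif_def hom_grD(4)[OF f b m] M.act_carr M.act_leibniz[OF b m] fl
          N.M.dif_ksgn N.act_carr hom_carr[OF f] M.M.carr_ksgn M.M.dif_carr)
    also have "f (ksgn j (actM b (dif M m))) = ksgn (j + i * j) (actN b (f (dif M m)))"
      using linear_on_ksgn[OF M.M.vector_space_axioms M.M.carr_subspace hom_grD(1)[OF f]] bc m
      by (simp add: M.act_carr M.M.dif_carr hom_grD(4)[OF f b])
    also have "f (actM (dif B b) m) = ksgn (i * (j + 1)) (actN (dif B b) (f m))"
      by (rule hom_grD(4)[OF f bc(2) m])
    also have "dif N (actN b (f m)) = actN (dif B b) (f m) + ksgn j (actN b (dif N (f m)))"
      by (rule N.act_leibniz[OF b hom_carr[OF f m]])
    finally show ?thesis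
      using bc m by (simp add: hdif_def N.act_diff N.M.dif_carr hom_carr[OF f] M.M.dif_carr
          N.M.carr_ksgn N.act_ksgn) (auto simp: ksgn_def)
  qed
qed

lemma hdif_linear:
  "linear_on (\<lambda>c f x. scl N c (f x)) (homs i) (\<lambda>c f x. scl N c (f x)) total (hdif i)"
  using G_total[OF hdif_mem]
  by (auto simp: linear_on_def hdif_def fun_eq_iff plus_fun_apply N.M.dif_add N.M.dif_scale
      N.M.scale_right_diff_distrib hom_carr ksgn_scale[OF N.M.vector_space_axioms])

lemma hdif_hdif: "f \<in> homs i \<Longrightarrow> hdif (i + 1) (hdif i f) = 0"
  by (rule ext, simp add: hdif_def zero_fun_apply N.M.dif_diff N.M.dif_carr N.M.carr_ksgn hom_carr
      M.M.dif_carr N.M.dif_dif M.M.dif_dif N.M.dif_ksgn linear_on_zero[OF hom_grD(1)])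
    (simp add: ksgn_def)

lemma dg_space_Hom: "dg_space Hom"
proof (intro dg_space.intro dg_space_axioms.intro)
  show "vector_space (scl Hom)" by (simp add: hom_scl)
  show "module.subspace (scl Hom) (gr Hom n)" for n by (simp add: hom_gr_subspace)
  show "y n = 0" if "finite I" "\<And>i. i \<in> I \<Longrightarrow> y i \<in> gr Hom i" "(\<Sum>i\<in>I. y i) = 0" "n \<in> I" for I y n
    using that by (intro G_direct) auto
  show L: "linear_on (scl Hom) (carr Hom) (scl Hom) (carr Hom) (dif Hom)"
    unfolding dif_Hom_extend hom_simps
    by (intro extend_linear hom_scl total_subspace hdif_linear)
  show "dif Hom f \<in> gr Hom (n + 1)" if "f \<in> gr Hom n" for f n
    using that by (simp add: dif_Hom hdif_mem)
  have L2: "linear_on (scl Hom) (carr Hom) (scl Hom) (carr Hom) (\<lambda>f. dif Hom (dif Hom f))"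
    using linear_on_compose[OF L L] .
  show "dif Hom (dif Hom f) = 0" if "f \<in> carr Hom" for f
  proof -
    have "dif Hom (dif Hom f) = 0 \<and> f \<in> total"
      using that unfolding hom_simps total_def
    proof (induction rule: span_induct_alt)
      case base
      show ?case using linear_on_zero[OF L2] subspace_0[OF total_subspace] by (simp add: total_def)
    next
      case (step c f g)
      then obtain n where f: "f \<in> homs n" by blast
      then have "dif Hom (dif Hom f) = 0" by (simp add: dif_Hom dif_Hom[OF hdif_mem] hdif_hdif)
      moreover have t: "f \<in> total" "(\<lambda>x. scl N c (f x)) \<in> total"
        using G_total[OF f] subspace_scale[OF total_subspace] by blast+
      ultimately show ?case
        using step.IH linear_onD(2,3)[OF L2] subspace_add[OF total_subspace t(2)] scale_zero_right
        by (simp add: total_def[symmetric])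
    qed
    then show ?thesis ..
  qed
qed

end

section \<open>The endomorphism dg algebra of a dg module\<close>

context dg_module
begin

sublocale E: dg_module_pair B M act M act
  by unfold_locales

abbreviation "End \<equiv> end_dga B M act"

lemma End_simps [simp]: "scl End = (\<lambda>c f x. scl M c (f x))" "gr End = E.homs"
  "dif End = dif E.Hom" "carr End = E.total" "unt End = (\<lambda>x. if x \<in> carr M then x else 0)"
  by (simp_all add: end_dga_def hom_dgs_def carr_def E.total_def)

lemma dg_space_End: "dg_space End"
  using E.dg_space_Hom unfolding dg_space_def dg_space_axioms_def End_simps E.hom_simps .

definition emul :: "int \<Rightarrow> int \<Rightarrow> ('m \<Rightarrow> 'm) \<Rightarrow> ('m \<Rightarrow> 'm) \<Rightarrow> 'm \<Rightarrow> 'm" where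
  "emul i j f g = ksgn (i * j) (g \<circ> f)"

lemma emul_apply: "emul i j f g x = ksgn (i * j) (g (f x))"
  by (simp add: emul_def ksgn_def)

lemma hom_linD:
  assumes "f \<in> E.homs i"
  shows "x \<in> carr M \<Longrightarrow> y \<in> carr M \<Longrightarrow> f (x + y) = f x + f y"
    "x \<in> carr M \<Longrightarrow> f (scl M c x) = scl M c (f x)" "f 0 = 0"
    "x \<in> carr M \<Longrightarrow> f (ksgn n x) = ksgn n (f x)"
    "x \<in> carr M \<Longrightarrow> y \<in> carr M \<Longrightarrow> f (x - y) = f x - f y"
  using linear_onD[OF E.hom_grD(1)[OF assms]] linear_on_zero[OF E.hom_grD(1)[OF assms]]
    linear_on_ksgn[OF M.vector_space_axioms M.carr_subspace E.hom_grD(1)[OF assms]]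
    linear_on_diff[OF M.vector_space_axioms M.carr_subspace E.hom_grD(1)[OF assms]]
  by simp_all

lemma emul_mem:
  assumes f: "f \<in> E.homs i" and g: "g \<in> E.homs j"
  shows "emul i j f g \<in> E.homs (i + j)"
proof -
  have "g \<circ> f \<in> E.homs (i + j)"
    unfolding hom_gr_def
  proof (intro CollectI conjI allI impI ballI)
    show "linear_on (scl M) (carr M) (scl M) (carr M) (g \<circ> f)"
      using linear_on_compose[OF E.hom_grD(1)[OF f] E.hom_grD(1)[OF g]] by (simp add: o_def)
    show "(g \<circ> f) x = 0" if "x \<notin> carr M" for x
      using E.hom_grD(2)[OF f that] hom_linD(3)[OF g] by simp
    show "(g \<circ> f) x \<in> gr M (i + j + k)" if "x \<in> gr M k" for x k
      using E.hom_grD(3)[OF g E.hom_grD(3)[OF f that]] by (simp add: algebra_simps)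
    show "(g \<circ> f) (act b m) = ksgn ((i + j) * k) (act b ((g \<circ> f) m))"
      if b: "b \<in> gr B k" and m: "m \<in> carr M" for b k m
    proof -
      have "act b (f m) \<in> carr M" "f m \<in> carr M"
        using E.hom_carr[OF f m] act_carr B.gr_carr[OF b] by blast+
      then show ?thesis
        using E.hom_grD(4)[OF g b] E.hom_grD(4)[OF f b m] hom_linD(4)[OF g]
        by (simp add: distrib_right)
    qed
  qed
  then show ?thesis
    unfolding emul_def by (rule subspace_ksgn[OF E.hom_scl E.hom_gr_subspace])
qed

lemma emul_linear_right:
  assumes "f \<in> E.homs i"
  shows "linear_on (scl End) (E.homs j) (scl End) (carr End) (emul i j f)"
  using E.G_total[OF emul_mem[OF assms]]
  by (auto simp: linear_on_def fun_eq_iff emul_apply plus_fun_apply ksgn_scale[OF M.vector_space_axioms])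

lemma emul_linear_left:
  assumes "g \<in> E.homs j"
  shows "linear_on (scl End) (E.homs i) (scl End) (carr End) (\<lambda>f. emul i j f g)"
proof -
  have "emul i j (f + f') g = emul i j f g + emul i j f' g"
    if "f \<in> E.homs i" "f' \<in> E.homs i" for f f'
  proof
    fix x
    show "emul i j (f + f') g x = (emul i j f g + emul i j f' g) x"
      using E.hom_carr[OF that(1), of x] E.hom_carr[OF that(2), of x] E.hom_grD(2)[OF that(1), of x]
        E.hom_grD(2)[OF that(2), of x] hom_linD[OF assms]
      by (cases "x \<in> carr M") (simp_all add: emul_apply plus_fun_apply)
  qed
  moreover have "emul i j (\<lambda>x. scl M c (f x)) g = (\<lambda>x. scl M c (emul i j f g x))"
    if "f \<in> E.homs i" for f c
  proof
    fix x
    show "emul i j (\<lambda>x. scl M c (f x)) g x = scl M c (emul i j f g x)"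
      using E.hom_carr[OF that(1), of x] E.hom_grD(2)[OF that(1), of x] hom_linD[OF assms]
      by (cases "x \<in> carr M") (simp_all add: emul_apply ksgn_scale[OF M.vector_space_axioms])
  qed
  ultimately show ?thesis
    using E.G_total[OF emul_mem[OF _ assms]] by (simp add: linear_on_def)
qed

lemma End_mul_extend: "mul End f g = E.extend (\<lambda>i f. E.extend (\<lambda>j g. emul i j f g) g) f"
  by (simp add: end_dga_def E.extend_def emul_def Let_def)

lemma End_mul_right_linear:
  assumes "f \<in> E.homs i"
  shows "linear_on (scl End) (carr End) (scl End) (carr End) (E.extend (\<lambda>j g. emul i j f g))"
  using E.extend_linear[OF E.hom_scl E.total_subspace, of "\<lambda>j g. emul i j f g"] emul_linear_right[OF assms]
  by simp

lemma End_mul_left_linear: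
  assumes g: "g \<in> carr End"
  shows "linear_on (scl End) (E.homs i) (scl End) (carr End) (\<lambda>f. E.extend (\<lambda>j g. emul i j f g) g)"
proof -
  note L = linear_onD[OF emul_linear_left[OF E.hcomp_mem]]
  have "E.extend (\<lambda>j g. emul i j (f + f') g) g =
      E.extend (\<lambda>j g. emul i j f g) g + E.extend (\<lambda>j g. emul i j f' g) g"
    if "f \<in> E.homs i" "f' \<in> E.homs i" for f f'
    using L(2) that g by (simp add: E.extend_def sum.distrib)
  moreover have "E.extend (\<lambda>j g. emul i j (\<lambda>x. scl M c (f x)) g) g =
      (\<lambda>x. scl M c (E.extend (\<lambda>j g. emul i j f g) g x))" if "f \<in> E.homs i" for f c
    using L(3)[of g f i] that g by (simp add: E.extend_def E.scale_sum_right)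
  ultimately show ?thesis
    using linear_onD(1)[OF End_mul_right_linear g] by (simp add: linear_on_def)
qed

lemma End_mul_bilinear:
  "bilinear_on (scl End) (carr End) (scl End) (carr End) (scl End) (carr End) (mul End)"
proof (rule bilinear_onI)
  fix g assume g: "g \<in> carr End"
  show "linear_on (scl End) (carr End) (scl End) (carr End) (\<lambda>f. mul End f g)"
    unfolding End_mul_extend
    using E.extend_linear[OF E.hom_scl E.total_subspace] End_mul_left_linear[OF g] by simp
next
  fix f assume f: "f \<in> carr End"
  note L = linear_onD[OF End_mul_right_linear[OF E.hcomp_mem]]
  have "mul End f g \<in> carr End" if "g \<in> carr End" for g
    using f that L(1) unfolding End_mul_extend E.extend_def[of _ f]
    by (auto intro!: E.subspace_sum[OF E.total_subspace])
  moreover have "mul End f (g + g') = mul End f g + mul End f g'"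
    if "g \<in> carr End" "g' \<in> carr End" for g g'
    using f that L(2) by (simp add: End_mul_extend E.extend_def[of _ f] sum.distrib)
  moreover have "mul End f (scl End c g) = scl End c (mul End f g)" if "g \<in> carr End" for g c
    using f that L(3) by (simp add: End_mul_extend E.extend_def[of _ f] E.scale_sum_right)
  ultimately show "linear_on (scl End) (carr End) (scl End) (carr End) (mul End f)"
    by (simp add: linear_on_def)
qed

lemma End_mul:
  assumes f: "f \<in> E.homs i" and g: "g \<in> E.homs j"
  shows "mul End f g = emul i j f g"
proof -
  have z: "emul i j f 0 = 0" for i j f
    by (simp add: fun_eq_iff emul_apply zero_fun_apply)
  have 0: "0 \<in> E.homs i"
    by (rule E.subspace_0[OF E.G_subspace])
  have "E.extend (\<lambda>j g. emul i j 0 g) g = 0"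
    by (subst E.extend_homogeneous[OF g, of "\<lambda>j. emul i j 0"])
      (simp_all add: fun_eq_iff emul_apply zero_fun_apply hom_linD(3)[OF g])
  then show ?thesis
    unfolding End_mul_extend
    by (subst E.extend_homogeneous[OF f]) (auto intro: E.extend_homogeneous[OF g, of "\<lambda>j. emul i j f"] simp: z)
qed

text \<open>All identities are linear in each argument and are checked on homogeneous maps.
  Associativity is that of composition together with i j + (i + j) k = j k + i (j + k).\<close>

lemma dg_algebra_End: "dg_algebra End"
proof (intro dg_algebra.intro dg_algebra_axioms.intro dg_space_End End_mul_bilinear)
  interpret S: dg_space End by (rule dg_space_End)
  note L = bilinear_onD[OF End_mul_bilinear]
  have mul_carr: "mul End f g \<in> carr End" if "f \<in> carr End" "g \<in> carr End" for f g
    using linear_onD(1)[OF L(1)] that by blast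
  have one: "unt End \<in> E.homs 0"
    using B.gr_carr M.gr_carr
    by (auto simp: hom_gr_def linear_on_def M.carr_add M.carr_scale act_carr)
  then show "unt End \<in> gr End 0" by simp
  show gr: "mul End f g \<in> gr End (i + j)" if "f \<in> gr End i" "g \<in> gr End j" for f g i j
    using that by (simp add: End_mul emul_mem)
  show "mul End (mul End f g) h = mul End f (mul End g h)"
    if "f \<in> carr End" "g \<in> carr End" "h \<in> carr End" for f g h
  proof (rule S.linear_on_carr_eqI[OF _ _ _ that(1)])
    show "linear_on (scl End) (carr End) (scl End) (carr End) (\<lambda>f. mul End (mul End f g) h)"
      by (rule linear_on_compose[OF L(2)[OF that(2)] L(2)[OF that(3)]])
    show "linear_on (scl End) (carr End) (scl End) (carr End) (\<lambda>f. mul End f (mul End g h))"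
      by (rule L(2)[OF mul_carr[OF that(2,3)]])
    fix i f assume f: "f \<in> gr End i"
    note fc = S.gr_carr[OF f]
    show "mul End (mul End f g) h = mul End f (mul End g h)"
    proof (rule S.linear_on_carr_eqI[OF _ _ _ that(2)])
      show "linear_on (scl End) (carr End) (scl End) (carr End) (\<lambda>g. mul End (mul End f g) h)"
        by (rule linear_on_compose[OF L(1)[OF fc] L(2)[OF that(3)]])
      show "linear_on (scl End) (carr End) (scl End) (carr End) (\<lambda>g. mul End f (mul End g h))"
        by (rule linear_on_compose[OF L(2)[OF that(3)] L(1)[OF fc]])
      fix j g assume g: "g \<in> gr End j"
      note gc = S.gr_carr[OF g]
      show "mul End (mul End f g) h = mul End f (mul End g h)"
      proof (rule S.linear_on_carr_eqI[OF _ _ _ that(3)])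
        show "linear_on (scl End) (carr End) (scl End) (carr End) (\<lambda>h. mul End (mul End f g) h)"
          by (rule L(1)[OF mul_carr[OF fc gc]])
        show "linear_on (scl End) (carr End) (scl End) (carr End) (\<lambda>h. mul End f (mul End g h))"
          by (rule linear_on_compose[OF L(1)[OF gc] L(1)[OF fc]])
        fix k h assume h: "h \<in> gr End k"
        have "mul End (mul End f g) h = emul (i + j) k (emul i j f g) h"
          using f g h by (simp add: End_mul End_mul[OF emul_mem])
        moreover have "mul End f (mul End g h) = emul i (j + k) f (emul j k g h)"
          using f g h by (simp add: End_mul End_mul[OF _ emul_mem])
        moreover have "emul (i + j) k (emul i j f g) h x = emul i (j + k) f (emul j k g h) x" for x
        proof (cases "x \<in> carr M")
          case True
          then have "g (f x) \<in> carr M" using f g E.hom_carr by simp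
          then show ?thesis
            using h by (simp add: emul_apply hom_linD(4)[of h k]) (simp add: algebra_simps)
        next
          case False
          then show ?thesis using f g h by (simp add: emul_apply E.hom_grD(2)[of f i] hom_linD(3)[of g j] hom_linD(3)[of h k])
        qed
        ultimately show "mul End (mul End f g) h = mul End f (mul End g h)" by auto
      qed
    qed
  qed
  show "mul End (unt End) f = f" if "f \<in> carr End" for f
  proof (rule S.linear_on_carr_eqI[OF _ _ _ that])
    show "linear_on (scl End) (carr End) (scl End) (carr End) (mul End (unt End))"
      using L(1) E.G_total[OF one] by simp
    show "linear_on (scl End) (carr End) (scl End) (carr End) (\<lambda>f. f)"
      by (simp add: linear_on_def)
    show "mul End (unt End) f = f" if "f \<in> gr End i" for f i
    proof -
      have f: "f \<in> E.homs i" using that by simp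
      show ?thesis
        unfolding End_mul[OF one f] using E.hom_grD(2)[OF f] hom_linD(3)[OF f]
        by (auto simp: fun_eq_iff emul_apply)
    qed
  qed
  show "mul End f (unt End) = f" if "f \<in> carr End" for f
  proof (rule S.linear_on_carr_eqI[OF _ _ _ that])
    show "linear_on (scl End) (carr End) (scl End) (carr End) (\<lambda>f. mul End f (unt End))"
      using L(2) E.G_total[OF one] by simp
    show "linear_on (scl End) (carr End) (scl End) (carr End) (\<lambda>f. f)"
      by (simp add: linear_on_def)
    show "mul End f (unt End) = f" if "f \<in> gr End i" for f i
    proof -
      have f: "f \<in> E.homs i" using that by simp
      show ?thesis
        unfolding End_mul[OF f one] using E.hom_grD(2)[OF f] E.hom_carr[OF f]
        by (auto simp: fun_eq_iff emul_apply)
    qed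
  qed
  show "dif End (mul End f g) = mul End (dif End f) g + ksgn i (mul End f (dif End g))"
    if "f \<in> gr End i" "g \<in> carr End" for f g i
  proof (rule S.linear_on_carr_eqI[OF _ _ _ that(2)])
    note fc = S.gr_carr[OF that(1)]
    have f: "f \<in> E.homs i" using that by simp
    note f' = E.hdif_mem[OF f]
    show "linear_on (scl End) (carr End) (scl End) (carr End) (\<lambda>g. dif End (mul End f g))"
      by (rule linear_on_compose[OF L(1)[OF fc] S.dif_linear])
    have 1: "linear_on (scl End) (carr End) (scl End) (carr End) (mul End (dif End f))"
      by (rule L(1)[OF S.dif_carr[OF fc]])
    have 2: "linear_on (scl End) (carr End) (scl End) (carr End) (\<lambda>g. mul End f (dif End g))"
      by (rule linear_on_compose[OF S.dif_linear L(1)[OF fc]])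
    show "linear_on (scl End) (carr End) (scl End) (carr End)
        (\<lambda>g. mul End (dif End f) g + ksgn i (mul End f (dif End g)))"
      unfolding linear_on_def
      by (intro conjI ballI allI)
       (simp_all only: linear_onD[OF 1] linear_onD[OF 2] S.carr_add S.carr_ksgn ksgn_simps
        ksgn_scale[OF S.vector_space_axioms] S.scale_right_distrib add_ac)
    fix j g assume "g \<in> gr End j"
    then have g: "g \<in> E.homs j" by simp
    note g' = E.hdif_mem[OF g]
    \<comment> \<open>From d(g f) = (dg) f + (-1)^j g (df): the factor (-1)^(i j) in the reversed
      product turns the first term into (-1)^i f * dg and the second into df * g.\<close>
    have "E.hdif (i + j) (emul i j f g) x =
       emul (i + 1) j (E.hdif i f) g x + ksgn i (emul i (j + 1) f (E.hdif j g) x)" for x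
    proof (cases "x \<in> carr M")
      case True
      note c = True E.hom_carr[OF f] E.hom_carr[OF g] M.dif_carr M.carr_ksgn
      show ?thesis
        by (simp add: E.hdif_def emul_apply c M.dif_ksgn hom_linD[OF g]) (auto simp: ksgn_def)
    next
      case False
      then show ?thesis by (simp add: E.hdif_def emul_apply hom_linD(3)[OF g] E.hom_grD(2)[OF f])
    qed
    then show "dif End (mul End f g) = mul End (dif End f) g + ksgn i (mul End f (dif End g))"
      by (simp add: End_mul[OF f g] E.dif_Hom[OF f] E.dif_Hom[OF g] E.dif_Hom[OF emul_mem[OF f g]]
          End_mul[OF f' g] End_mul[OF f g'])
        (simp add: fun_eq_iff plus_fun_apply ksgn_apply)
  qed
qed

end

section \<open>The complex \<open>V \<otimes> H\<close>\<close>

locale dg_tensor = fd_hopf_algebra H Bs + V: dg_space V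
  for H :: "('k::field, 'h::ring_1) hopf" and Bs :: "'h set"
    and V :: "('k, 'v::ab_group_add, 'z) dgs_scheme"
begin

abbreviation ts :: "'v \<Rightarrow> 'h \<Rightarrow> ('v, 'h, 'k) tensor" where
  "ts \<equiv> tens (scl V) (hscl H)"

abbreviation "VH \<equiv> tspan (scl V) (carr V) (hscl H) UNIV"

sublocale VH: tensor_pair "scl V" "hscl H" "carr V" UNIV
  by unfold_locales (simp_all add: V.carr_subspace vector_space_subspace_UNIV vector_space_axioms)

sublocale gr: tensor_pair "scl V" "hscl H" "gr V n" UNIV for n
  by unfold_locales (simp_all add: V.gr_subspace vector_space_subspace_UNIV vector_space_axioms)

lemma vector_space_V [lin_intros]: "vector_space (scl V)"
  by (rule V.vector_space_axioms)

lemma gr_VH: "t \<in> tspan (scl V) (gr V n) (hscl H) UNIV \<Longrightarrow> t \<in> VH"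
  by (induction rule: gr.tspan_induct) (auto intro: tens_in_tspan V.gr_carr VH.tspan_0 VH.tspan_add)

lemma VH_induct [consumes 1, case_names tens zero add]:
  assumes "t \<in> VH" "\<And>v h n. v \<in> gr V n \<Longrightarrow> Q (ts v h)" "Q 0"
    "\<And>x y. x \<in> VH \<Longrightarrow> y \<in> VH \<Longrightarrow> Q x \<Longrightarrow> Q y \<Longrightarrow> Q (x + y)"
  shows "Q t"
  using assms(1)
proof (induction rule: VH.tspan_induct)
  case (tens v h)
  from tens(1) show ?case
    by (induction rule: V.carr_induct) (auto intro: assms tens_in_tspan simp: tens_add_left)
qed (use assms in auto)

lemma tensor_simps [simp]: "scl (tensor_dgs H V) = tscl"
  "gr (tensor_dgs H V) n = tspan (scl V) (gr V n) (hscl H) UNIV"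
  by (simp_all add: tensor_dgs_def)

lemma span_gr_tensor: "module.span tscl (\<Union>n. tspan (scl V) (gr V n) (hscl H) UNIV) = VH"
proof
  show "module.span tscl (\<Union>n. tspan (scl V) (gr V n) (hscl H) UNIV) \<subseteq> VH"
    using gr_VH by (intro VH.T.span_minimal subspace_tspan) blast
  show "VH \<subseteq> module.span tscl (\<Union>n. tspan (scl V) (gr V n) (hscl H) UNIV)"
  proof
    fix t assume "t \<in> VH"
    then show "t \<in> module.span tscl (\<Union>n. tspan (scl V) (gr V n) (hscl H) UNIV)"
    proof (induction rule: VH_induct)
      case (tens v h n)
      show ?case by (rule VH.T.span_base) (use tens in \<open>auto intro: tens_in_tspan\<close>)
    qed (auto intro: VH.T.span_zero VH.T.span_add)
  qed
qed

lemma carr_tensor [simp]: "carr (tensor_dgs H V) = VH"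
  by (simp add: carr_def[of "tensor_dgs H V"] span_gr_tensor)

text \<open>The contraction of V \<otimes> H with the coordinate functional of b. These maps
  identify V \<otimes> H with a finite direct sum of copies of V.\<close>

definition co :: "'h \<Rightarrow> ('v, 'h, 'k) tensor \<Rightarrow> 'v" where
  "co b = tlift (scl V) (carr V) (hscl H) UNIV (\<lambda>v h. scl V (ch b h) v)"

lemma linear_on_tens: "linear_on (scl V) (carr V) tscl UNIV (\<lambda>v. ts v h)"
  by (simp add: linear_on_def tens_add_left tens_scl_left)

lemma co_bilinear: "module.subspace (scl V) U \<Longrightarrow>
    bilinear_on (scl V) U (hscl H) UNIV (scl V) U (\<lambda>v h. scl V (ch b h) v)"
  using ch_lin
  by (auto simp: bilinear_on_def linear_on_def V.subspace_scale V.scale_right_distrib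
      V.scale_left_distrib mult.commute)

lemma co_linear: "linear_on tscl VH (scl V) (carr V) (co b)"
  unfolding co_def
  by (intro VH.tlift_linear_on V.vector_space_axioms V.carr_subspace co_bilinear)

lemma co_tens: "v \<in> carr V \<Longrightarrow> co b (ts v h) = scl V (ch b h) v"
  unfolding co_def
  by (rule VH.tlift_tens[OF V.vector_space_axioms])
    (use co_bilinear[OF V.carr_subspace] in \<open>auto simp: bilinear_on_def intro: linear_on_codom\<close>)

lemma co_gr: "t \<in> tspan (scl V) (gr V n) (hscl H) UNIV \<Longrightarrow> co b t \<in> gr V n"
proof (induction rule: gr.tspan_induct)
  case (tens v h)
  then show ?case by (simp add: co_tens V.gr_carr V.subspace_scale[OF V.gr_subspace])
next
  case zero
  then show ?case
    using linear_on_zero[OF co_linear VH.tspan_0] V.subspace_0[OF V.gr_subspace] by simp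
next
  case (add x y)
  then show ?case
    using linear_onD(2)[OF co_linear gr_VH gr_VH] V.subspace_add[OF V.gr_subspace] by simp
qed

lemma tensor_expand: "t \<in> VH \<Longrightarrow> t = (\<Sum>b\<in>Bs. ts (co b t) b)"
proof (induction rule: VH.tspan_induct)
  case (tens v h)
  have "(\<Sum>b\<in>Bs. ts (co b (ts v h)) b) = (\<Sum>b\<in>Bs. ts v (hscl H (ch b h) b))"
    using tens by (simp add: co_tens tens_scl_left tens_scl_right)
  then show ?case by (simp add: tens_sum_right[symmetric] sum_ch)
next
  case zero
  then show ?case using linear_on_zero[OF co_linear VH.tspan_0] by simp
next
  case (add x y)
  then show ?case using linear_onD(2)[OF co_linear add(1,2)] by (simp add: tens_add_left sum.distrib)
qed

lemma tensor_eq_0I: "t \<in> VH \<Longrightarrow> (\<And>b. b \<in> Bs \<Longrightarrow> co b t = 0) \<Longrightarrow> t = 0"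
  by (subst tensor_expand) simp_all

lemma co_sum:
  assumes "\<And>c. v c \<in> carr V" "b \<in> Bs"
  shows "co b (\<Sum>c\<in>Bs. ts (v c) c) = v b"
proof -
  have "co b (\<Sum>c\<in>Bs. ts (v c) c) = (\<Sum>c\<in>Bs. co b (ts (v c) c))"
    by (rule linear_on_sum[OF vector_space_tscl subspace_tspan co_linear])
      (intro tens_in_tspan assms UNIV_I)
  also have "\<dots> = (\<Sum>c\<in>Bs. if b = c then v c else 0)"
    by (intro sum.cong refl) (simp add: co_tens assms ch_basis)
  finally show ?thesis using finite_Bs assms(2) by simp
qed

lemma dif_bilinear: "bilinear_on (scl V) (carr V) (hscl H) UNIV tscl VH (\<lambda>v h. ts (dif V v) h)"
  by (auto simp: bilinear_on_def linear_on_def V.dif_carr V.dif_add V.dif_scale tens_add_left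
      tens_add_right tens_scl_left tens_scl_right intro: tens_in_tspan)

lemma dif_tensor_linear: "linear_on tscl VH tscl VH (dif (tensor_dgs H V))"
  unfolding tensor_dgs_def by (simp add: VH.tlift_linear_on dif_bilinear subspace_tspan vector_space_tscl)

lemma dif_tens: "v \<in> carr V \<Longrightarrow> dif (tensor_dgs H V) (ts v h) = ts (dif V v) h"
  unfolding tensor_dgs_def using dif_bilinear
  by (simp, intro VH.tlift_tens[OF vector_space_tscl])
    (auto simp: bilinear_on_def intro: linear_on_codom)

lemma dg_space_tensor: "dg_space (tensor_dgs H V)"
proof (intro dg_space.intro dg_space_axioms.intro)
  show "vector_space (scl (tensor_dgs H V))" by (simp add: vector_space_tscl)
  show "module.subspace (scl (tensor_dgs H V)) (gr (tensor_dgs H V) n)" for n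
    by (simp add: subspace_tspan)
  \<comment> \<open>Directness of the grading is inherited from V: the coordinates preserve the
    degree and jointly detect 0.\<close>
  show "y n = 0" if "finite I" and y: "\<And>i. i \<in> I \<Longrightarrow> y i \<in> gr (tensor_dgs H V) i"
    and sum: "(\<Sum>i\<in>I. y i) = 0" and "n \<in> I" for I y n
  proof (rule tensor_eq_0I)
    have yVH: "y i \<in> VH" if "i \<in> I" for i using y[OF that] gr_VH by simp
    show "y n \<in> VH" by (rule yVH) fact
    fix b assume "b \<in> Bs"
    have "(\<Sum>i\<in>I. co b (y i)) = co b (\<Sum>i\<in>I. y i)"
      by (rule linear_on_sum[OF vector_space_tscl subspace_tspan co_linear yVH, symmetric])
    also have "\<dots> = 0" using linear_on_zero[OF co_linear VH.tspan_0] sum by simp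
    finally show "co b (y n) = 0"
      using V.gr_direct[OF \<open>finite I\<close>, of "\<lambda>i. co b (y i)"] co_gr y \<open>n \<in> I\<close> by simp
  qed
  show "linear_on (scl (tensor_dgs H V)) (carr (tensor_dgs H V)) (scl (tensor_dgs H V))
      (carr (tensor_dgs H V)) (dif (tensor_dgs H V))"
    by (simp add: dif_tensor_linear)
  show "dif (tensor_dgs H V) x \<in> gr (tensor_dgs H V) (n + 1)" if "x \<in> gr (tensor_dgs H V) n" for x n
    using that unfolding tensor_simps
  proof (induction rule: gr.tspan_induct)
    case (tens v h)
    then show ?case by (simp add: dif_tens V.gr_carr tens_in_tspan V.dif_gr)
  next
    case zero
    then show ?case using linear_on_zero[OF dif_tensor_linear VH.tspan_0] gr.tspan_0 by simp
  next
    case (add x y)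
    then show ?case using linear_onD(2)[OF dif_tensor_linear gr_VH gr_VH] gr.tspan_add by simp
  qed
  show "dif (tensor_dgs H V) (dif (tensor_dgs H V) x) = 0" if "x \<in> carr (tensor_dgs H V)" for x
    using that unfolding carr_tensor
  proof (induction rule: VH.tspan_induct)
    case (tens v h)
    then show ?case by (simp add: dif_tens V.dif_carr V.dif_dif)
  next
    case zero
    then show ?case using linear_on_zero[OF dif_tensor_linear VH.tspan_0] by simp
  next
    case (add x y)
    then show ?case using linear_onD[OF dif_tensor_linear] by simp
  qed
qed

end


section \<open>Smash products and their modules\<close>

text \<open>Only bilinearity of the product and the action is assumed. The locale is instantiated
  both for A and for Hom_A(P, P), and for the latter before its smash product is known to be a dg
  algebra.\<close>

locale smash_product = dg_tensor H Bs A
  for H :: "('k::field, 'h::ring_1) hopf" and Bs :: "'h set"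
    and A :: "('k, 'a::ab_group_add, 'z) dga_scheme" +
  fixes hact :: "'h \<Rightarrow> 'a \<Rightarrow> 'a"
  assumes mul_bil: "bilinear_on (scl A) (carr A) (scl A) (carr A) (scl A) (carr A) (mul A)"
    and hact_bil: "bilinear_on (hscl H) UNIV (scl A) (carr A) (scl A) (carr A) hact"
begin

lemma smash_simps [simp]: "scl (smash H A hact) = tscl"
  "gr (smash H A hact) n = tspan (scl A) (gr A n) (hscl H) UNIV"
  "carr (smash H A hact) = VH" "dif (smash H A hact) = dif (tensor_dgs H A)"
  "unt (smash H A hact) = ts (unt A) 1"
  by (simp_all add: smash_def carr_def span_gr_tensor)

lemma dg_space_smash: "dg_space (smash H A hact)"
  using dg_space_tensor
  unfolding dg_space_def dg_space_axioms_def smash_simps tensor_simps carr_tensor .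

lemma mul_carr: "a \<in> carr A \<Longrightarrow> b \<in> carr A \<Longrightarrow> mul A a b \<in> carr A"
  using mul_bil by (simp add: bilinear_on_def linear_on_def)

lemma hact_carr: "a \<in> carr A \<Longrightarrow> hact h a \<in> carr A"
  using hact_bil by (simp add: bilinear_on_def linear_on_def)

lemma hlin_mul_left [lin_intros]:
  "hlin H (scl A) f \<Longrightarrow> (\<And>x. f x \<in> carr A) \<Longrightarrow> b \<in> carr A \<Longrightarrow> hlin H (scl A) (\<lambda>x. mul A (f x) b)"
  using mul_bil by (auto simp: bilinear_on_def linear_on_def)

lemma hlin_mul_right [lin_intros]:
  "hlin H (scl A) f \<Longrightarrow> (\<And>x. f x \<in> carr A) \<Longrightarrow> b \<in> carr A \<Longrightarrow> hlin H (scl A) (\<lambda>x. mul A b (f x))"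
  using mul_bil by (auto simp: bilinear_on_def linear_on_def)

lemma hlin_hact_left [lin_intros]:
  "hlin H (hscl H) f \<Longrightarrow> b \<in> carr A \<Longrightarrow> hlin H (scl A) (\<lambda>x. hact (f x) b)"
  using hact_bil by (auto simp: bilinear_on_def linear_on_def)

lemma hlin_hact_right [lin_intros]:
  "hlin H (scl A) f \<Longrightarrow> (\<And>x. f x \<in> carr A) \<Longrightarrow> hlin H (scl A) (\<lambda>x. hact h (f x))"
  using hact_bil by (auto simp: bilinear_on_def linear_on_def)

definition smul :: "'a \<Rightarrow> 'h \<Rightarrow> 'a \<Rightarrow> 'h \<Rightarrow> ('a, 'h, 'k) tensor" where
  "smul a h b g = sweedler H (\<lambda>h1 h2. ts (mul A a (hact h1 b)) (h2 * g)) h"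

lemma smul_bil: "a \<in> carr A \<Longrightarrow> b \<in> carr A \<Longrightarrow> hbil H tscl (\<lambda>h1 h2. ts (mul A a (hact h1 b)) (h2 * g))"
  by (intro lin_intros hact_carr)

lemma smul_mem: "a \<in> carr A \<Longrightarrow> b \<in> carr A \<Longrightarrow> smul a h b g \<in> VH"
  unfolding smul_def
  by (intro sweedler_mem[OF vector_space_tscl subspace_tspan] smul_bil tens_in_tspan mul_carr hact_carr UNIV_I)

lemma sweedler_param_linear_on:
  assumes su: "vector_space su" and s: "vector_space s" "module.subspace s X"
    and F: "\<And>x. x \<in> X \<Longrightarrow> hbil H su (F x)" "\<And>p q. linear_on s X su UNIV (\<lambda>x. F x p q)"
  shows "linear_on s X su UNIV (\<lambda>x. sweedler H (F x) h)"
  unfolding sweedler_def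
  by (rule HH.tlift_param_linear[OF su _ s F])
    (use comul_linear in \<open>simp_all add: linear_on_def\<close>)

lemma linear_on_tens_left: "linear_on s X (scl A) W f \<Longrightarrow> linear_on s X tscl UNIV (\<lambda>x. ts (f x) h)"
  by (simp add: linear_on_def tens_add_left tens_scl_left)

lemma smul_linear:
  shows "b \<in> carr A \<Longrightarrow> linear_on (scl A) (carr A) tscl UNIV (\<lambda>a. smul a h b g)"
    "a \<in> carr A \<Longrightarrow> b \<in> carr A \<Longrightarrow> hlin H tscl (\<lambda>h. smul a h b g)"
    "a \<in> carr A \<Longrightarrow> linear_on (scl A) (carr A) tscl UNIV (\<lambda>b. smul a h b g)"
    "a \<in> carr A \<Longrightarrow> b \<in> carr A \<Longrightarrow> hlin H tscl (\<lambda>g. smul a h b g)"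
proof -
  show "linear_on (scl A) (carr A) tscl UNIV (\<lambda>a. smul a h b g)" if "b \<in> carr A"
    unfolding smul_def
    by (intro sweedler_param_linear_on vector_space_tscl V.vector_space_axioms V.carr_subspace smul_bil
        linear_on_tens_left[where W="carr A"] bilinear_onD(2)[OF mul_bil] hact_carr that)
  show "linear_on (scl A) (carr A) tscl UNIV (\<lambda>b. smul a h b g)" if "a \<in> carr A"
    unfolding smul_def
    by (intro sweedler_param_linear_on vector_space_tscl V.vector_space_axioms V.carr_subspace smul_bil
        linear_on_tens_left[where W="carr A"] linear_on_compose[OF bilinear_onD(1)[OF hact_bil]
          bilinear_onD(1)[OF mul_bil]] hact_carr that UNIV_I)
  show "hlin H tscl (\<lambda>h. smul a h b g)" "hlin H tscl (\<lambda>g. smul a h b g)"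
    if "a \<in> carr A" "b \<in> carr A"
    unfolding smul_def by (intro lin_intros hact_carr that)+
qed

lemma smash_mul_eq: "mul (smash H A hact) x y = tlift (scl A) (carr A) (hscl H) UNIV (\<lambda>a h.
    tlift (scl A) (carr A) (hscl H) UNIV (smul a h) y) x"
  by (simp add: smash_def smul_def[abs_def])

lemma smash_mul_tens:
  "a \<in> carr A \<Longrightarrow> b \<in> carr A \<Longrightarrow> mul (smash H A hact) (ts a h) (ts b g) = smul a h b g"
  unfolding smash_mul_eq
  by (rule tlift_tlift_tens[OF VH.tensor_pair_axioms VH.tensor_pair_axioms vector_space_tscl
        subspace_tspan smul_mem smul_linear]) auto

lemma smash_mul_bilinear: "bilinear_on tscl VH tscl VH tscl VH (mul (smash H A hact))"
  unfolding smash_mul_eq[abs_def]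
  by (rule tlift_tlift_bilinear[OF VH.tensor_pair_axioms VH.tensor_pair_axioms vector_space_tscl
        subspace_tspan smul_mem smul_linear])

end

locale smash_module = fd_hopf_algebra_bij H Bs + A: dg_module_algebra H A hact +
    P: dg_module "smash H A hact" P act
  for H :: "('k::field, 'h::ring_1) hopf" and Bs :: "'h set"
    and A :: "('k, 'a::ab_group_add, 'y) dga_scheme" and hact :: "'h \<Rightarrow> 'a \<Rightarrow> 'a"
    and P :: "('k, 'p::ab_group_add, 'z) dgs_scheme"
    and act :: "('a, 'h, 'k) tensor \<Rightarrow> 'p \<Rightarrow> 'p"
begin

sublocale sm: smash_product H Bs A hact
  by unfold_locales (rule A.A.mul_bilinear A.hact_bilinear)+

sublocale PH: dg_tensor H Bs P
  by unfold_locales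

section \<open>Restriction of the A # H-module P to A and to H\<close>

abbreviation "AH \<equiv> smash H A hact"
abbreviation "aP \<equiv> res_alg H A act"
abbreviation "hP \<equiv> res_hopf H A act"

lemma unt_carr [simp]: "unt A \<in> carr A"
  by (rule A.A.gr_carr[OF A.A.unt_gr])

lemma ts_AH: "a \<in> carr A \<Longrightarrow> sm.ts a h \<in> carr AH"
  by (simp add: tens_in_tspan)

lemma ts_AH_gr: "a \<in> gr A i \<Longrightarrow> sm.ts a h \<in> gr AH i"
  by (simp add: tens_in_tspan)

lemma aP_carr [simp]: "a \<in> carr A \<Longrightarrow> m \<in> carr P \<Longrightarrow> aP a m \<in> carr P"
  unfolding res_alg_def by (rule P.act_carr[OF ts_AH])

lemma hP_carr [simp]: "m \<in> carr P \<Longrightarrow> hP h m \<in> carr P"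
  unfolding res_hopf_def by (rule P.act_carr[OF ts_AH]) auto

lemma aP_linear: "a \<in> carr A \<Longrightarrow> linear_on (scl P) (carr P) (scl P) (carr P) (aP a)"
  using P.act_linear[OF ts_AH] by (simp add: res_alg_def[abs_def])

lemma hP_linear: "linear_on (scl P) (carr P) (scl P) (carr P) (hP h)"
  using P.act_linear[OF ts_AH] by (simp add: res_hopf_def[abs_def])

lemma aP_linear_left: "m \<in> carr P \<Longrightarrow> linear_on (scl A) (carr A) (scl P) (carr P) (\<lambda>a. aP a m)"
  using P.act_linear_left[of m] ts_AH
  by (auto simp: linear_on_def res_alg_def tens_add_left tens_scl_left)

lemma hP_linear_left: "m \<in> carr P \<Longrightarrow> linear_on (hscl H) UNIV (scl P) (carr P) (\<lambda>h. hP h m)"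
  using P.act_linear_left[of m] ts_AH[OF unt_carr]
  by (auto simp: linear_on_def res_hopf_def tens_add_right tens_scl_right)

lemma hlin_aP_left [lin_intros]:
  "hlin H (scl A) f \<Longrightarrow> (\<And>x. f x \<in> carr A) \<Longrightarrow> m \<in> carr P \<Longrightarrow> hlin H (scl P) (\<lambda>x. aP (f x) m)"
  using aP_linear_left by (auto simp: linear_on_def)

lemma hlin_aP_right [lin_intros]:
  "hlin H (scl P) f \<Longrightarrow> (\<And>x. f x \<in> carr P) \<Longrightarrow> a \<in> carr A \<Longrightarrow> hlin H (scl P) (\<lambda>x. aP a (f x))"
  using aP_linear by (auto simp: linear_on_def)

lemma hlin_hP_left [lin_intros]:
  "hlin H (hscl H) f \<Longrightarrow> m \<in> carr P \<Longrightarrow> hlin H (scl P) (\<lambda>x. hP (f x) m)"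
  using hP_linear_left by (auto simp: linear_on_def)

lemma hlin_hP_right [lin_intros]:
  "hlin H (scl P) f \<Longrightarrow> (\<And>x. f x \<in> carr P) \<Longrightarrow> hlin H (scl P) (\<lambda>x. hP h (f x))"
  using hP_linear by (auto simp: linear_on_def)

lemma hlin_act [lin_intros]:
  "hlin H (hscl H) f \<Longrightarrow> a \<in> carr A \<Longrightarrow> m \<in> carr P \<Longrightarrow> hlin H (scl P) (\<lambda>x. act (sm.ts a (f x)) m)"
  using P.act_linear_left[of m] ts_AH[of a]
  by (auto simp: linear_on_def tens_add_right tens_scl_right)

text \<open>The factorisation a # h = (a # 1)(1 # h), which holds since the coproduct of 1 is 1
  \<otimes> 1.\<close>

lemma act_ts: "a \<in> carr A \<Longrightarrow> m \<in> carr P \<Longrightarrow> act (sm.ts a h) m = aP a (hP h m)"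
proof -
  assume a: "a \<in> carr A" and m: "m \<in> carr P"
  have "sm.smul a 1 (unt A) h = sm.ts (mul A a (hact 1 (unt A))) (1 * h)"
    unfolding sm.smul_def by (rule sweedler_one[OF vector_space_tscl sm.smul_bil[OF a unt_carr]])
  then have "mul AH (sm.ts a 1) (sm.ts (unt A) h) = sm.ts a h"
    using a by (simp add: sm.smash_mul_tens A.hact_one A.A.unt_right)
  then show ?thesis
    using P.act_mul[OF ts_AH[OF a] ts_AH[OF unt_carr] m, of 1 h] by (simp add: res_alg_def res_hopf_def)
qed

text \<open>In (1 # g)(1 # h) the element g_1 acts on the unit of A by its counit, which leaves 1 #
  g h.\<close>

lemma hP_mult: "m \<in> carr P \<Longrightarrow> hP (g * h) m = hP g (hP h m)"
proof -
  assume m: "m \<in> carr P"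
  have "sm.smul (unt A) g (unt A) h =
      sweedler H (\<lambda>g1 g2. tscl (counit H g1) (sm.ts (unt A) (g2 * h))) g"
    by (simp add: sm.smul_def A.A.unt_left A.A.carr_scale A.hact_unt tens_scl_left)
  also have "\<dots> = sm.ts (unt A) (g * h)"
    by (rule sweedler_counit_left[OF vector_space_tscl]) (intro lin_intros)
  finally have "mul AH (sm.ts (unt A) g) (sm.ts (unt A) h) = sm.ts (unt A) (g * h)"
    by (simp add: sm.smash_mul_tens)
  then show ?thesis
    using P.act_mul[OF ts_AH ts_AH m, of "unt A" "unt A" g h] by (simp add: res_hopf_def)
qed

lemma hP_one: "m \<in> carr P \<Longrightarrow> hP 1 m = m"
  using P.act_unt by (simp add: res_hopf_def)

lemma aP_unt: "m \<in> carr P \<Longrightarrow> aP (unt A) m = m"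
  using P.act_unt by (simp add: res_alg_def)

text \<open>The commutation relation (1 # h)(a # 1) = (h_1 a) # h_2 of the smash product, read on
  P.\<close>

lemma hP_aP:
  assumes a: "a \<in> carr A" and m: "m \<in> carr P"
  shows "hP h (aP a m) = sweedler H (\<lambda>h1 h2. aP (hact h1 a) (hP h2 m)) h"
proof -
  have "mul AH (sm.ts (unt A) h) (sm.ts a 1) = sweedler H (\<lambda>h1 h2. sm.ts (hact h1 a) h2) h"
    using a by (simp add: sm.smash_mul_tens sm.smul_def A.A.unt_left sm.hact_carr)
  then have "hP h (aP a m) = act (sweedler H (\<lambda>h1 h2. sm.ts (hact h1 a) h2) h) m"
    using P.act_mul[OF ts_AH[OF unt_carr] ts_AH[OF a] m, of h 1] by (simp add: res_alg_def res_hopf_def)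
  also have "\<dots> = sweedler H (\<lambda>h1 h2. act (sm.ts (hact h1 a) h2) m) h"
    using P.act_linear_left[OF m] a
    by (intro sweedler_linear_on[OF vector_space_tscl P.M.vector_space_axioms subspace_tspan])
      (auto intro!: lin_intros tens_in_tspan sm.hact_carr)
  finally show ?thesis using a m by (simp add: act_ts sm.hact_carr)
qed

lemma aP_mul:
  assumes a: "a \<in> carr A" "b \<in> carr A" and m: "m \<in> carr P"
  shows "aP (mul A a b) m = aP a (aP b m)"
proof -
  have "sm.smul a 1 b 1 = sm.ts (mul A a (hact 1 b)) (1 * 1)"
    unfolding sm.smul_def by (rule sweedler_one[OF vector_space_tscl sm.smul_bil[OF a]])
  then have "mul AH (sm.ts a 1) (sm.ts b 1) = sm.ts (mul A a b) 1"
    using a by (simp add: sm.smash_mul_tens A.hact_one)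
  then show ?thesis
    using P.act_mul[OF ts_AH[OF a(1)] ts_AH[OF a(2)] m, of 1 1] by (simp add: res_alg_def)
qed

lemma hP_gr: "m \<in> gr P n \<Longrightarrow> hP h m \<in> gr P n"
  using P.act_gr[OF ts_AH_gr[OF A.A.unt_gr]] by (simp add: res_hopf_def)

lemma dg_module_aP: "dg_module A P aP"
proof (intro dg_module.intro dg_module_axioms.intro A.A.dg_algebra_axioms P.M.dg_space_axioms aP_mul aP_unt)
  show "bilinear_on (scl A) (carr A) (scl P) (carr P) (scl P) (carr P) aP"
    by (intro bilinear_onI aP_linear aP_linear_left)
  show "aP b m \<in> gr P (i + j)" if "b \<in> gr A i" "m \<in> gr P j" for b m i j
    using P.act_gr[OF ts_AH_gr[OF that(1)] that(2)] by (simp add: res_alg_def)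
  show "dif P (aP b m) = aP (dif A b) m + ksgn i (aP b (dif P m))"
    if "b \<in> gr A i" "m \<in> carr P" for b m i
    using P.act_leibniz[OF ts_AH_gr[OF that(1)] that(2), of 1] A.A.gr_carr[OF that(1)]
    by (simp add: res_alg_def sm.dif_tens)
qed

section \<open>The A # H-module P \<otimes> H\<close>

abbreviation "tact \<equiv> tensor_act H A P act"
abbreviation "PtH \<equiv> tensor_dgs H P"

definition tact0 where
  "tact0 a h m w = sweedler H (\<lambda>h1 h2. PH.ts (act (sm.ts a h1) m) (h2 * w)) h"

lemma tact0_bil: "a \<in> carr A \<Longrightarrow> m \<in> carr P \<Longrightarrow> hbil H tscl (\<lambda>h1 h2. PH.ts (act (sm.ts a h1) m) (h2 * w))"
  by (intro lin_intros)

lemma tact0_mem: "a \<in> carr A \<Longrightarrow> m \<in> carr P \<Longrightarrow> tact0 a h m w \<in> PH.VH"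
  unfolding tact0_def
  by (intro sweedler_mem[OF vector_space_tscl subspace_tspan] tact0_bil tens_in_tspan P.act_carr ts_AH UNIV_I)

lemma tact0_linear:
  shows "m \<in> carr P \<Longrightarrow> linear_on (scl A) (carr A) tscl UNIV (\<lambda>a. tact0 a h m w)"
    "a \<in> carr A \<Longrightarrow> m \<in> carr P \<Longrightarrow> hlin H tscl (\<lambda>h. tact0 a h m w)"
    "a \<in> carr A \<Longrightarrow> linear_on (scl P) (carr P) tscl UNIV (\<lambda>m. tact0 a h m w)"
    "a \<in> carr A \<Longrightarrow> m \<in> carr P \<Longrightarrow> hlin H tscl (\<lambda>w. tact0 a h m w)"
proof -
  show "linear_on (scl A) (carr A) tscl UNIV (\<lambda>a. tact0 a h m w)" if m: "m \<in> carr P"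
  proof -
    have 1: "linear_on (scl A) (carr A) (scl P) (carr P) (\<lambda>a. act (sm.ts a p) m)" for p
      using P.act_linear_left[OF m] ts_AH by (auto simp: linear_on_def tens_add_left tens_scl_left)
    show ?thesis
      unfolding tact0_def
      by (intro sm.sweedler_param_linear_on vector_space_tscl A.A.vector_space_axioms
          A.A.carr_subspace tact0_bil linear_on_compose[OF 1 PH.linear_on_tens] m)
  qed
  show "linear_on (scl P) (carr P) tscl UNIV (\<lambda>m. tact0 a h m w)" if "a \<in> carr A"
    unfolding tact0_def
    by (intro sm.sweedler_param_linear_on vector_space_tscl P.M.vector_space_axioms P.M.carr_subspace tact0_bil
        linear_on_compose[OF P.act_linear PH.linear_on_tens] ts_AH that)
  show "hlin H tscl (\<lambda>h. tact0 a h m w)" "hlin H tscl (\<lambda>w. tact0 a h m w)"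
    if "a \<in> carr A" "m \<in> carr P"
    unfolding tact0_def by (intro lin_intros that)+
qed

lemma tact_eq: "tact x t = tlift (scl A) (carr A) (hscl H) UNIV (\<lambda>a h.
    tlift (scl P) (carr P) (hscl H) UNIV (tact0 a h) t) x"
  by (simp add: tensor_act_def tact0_def[abs_def])

lemma tact_tens:
  "a \<in> carr A \<Longrightarrow> m \<in> carr P \<Longrightarrow> tact (sm.ts a h) (PH.ts m w) = tact0 a h m w"
  unfolding tact_eq
  by (rule tlift_tlift_tens[OF sm.VH.tensor_pair_axioms PH.VH.tensor_pair_axioms vector_space_tscl
        subspace_tspan tact0_mem tact0_linear]) auto

lemma tact_bilinear: "bilinear_on tscl sm.VH tscl PH.VH tscl PH.VH tact"
  unfolding tact_eq[abs_def]
  by (rule tlift_tlift_bilinear[OF sm.VH.tensor_pair_axioms PH.VH.tensor_pair_axioms vector_space_tscl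
        subspace_tspan tact0_mem tact0_linear])

lemmas tact_linear = bilinear_onD[OF tact_bilinear]

lemma tact_carr: "x \<in> sm.VH \<Longrightarrow> t \<in> PH.VH \<Longrightarrow> tact x t \<in> PH.VH"
  using linear_onD(1)[OF tact_linear(1)] by blast


lemmas carr_intros = aP_carr hP_carr sm.hact_carr sm.mul_carr P.act_carr

lemma tens_linear_on: "linear_on s X (scl P) (carr P) f \<Longrightarrow> linear_on s X tscl UNIV (\<lambda>m. PH.ts (f m) w)"
  by (simp add: linear_on_def tens_add_left tens_scl_left)

text \<open>Both sides equal a (h_1 b) h_2 g_1 m \<otimes> h_3 g_2 w, the term \<open>?J\<close>. On
  the right, moving h_1 past b splits the first leg of h, so coassociativity and two interchanges of
  sums are needed to reach the order of the left side.\<close>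

lemma tact_smul_tens:
  assumes a: "a \<in> carr A" and b: "b \<in> carr A" and m: "m \<in> carr P"
  shows "tact (sm.smul a h b g) (PH.ts m w) = tact (sm.ts a h) (tact (sm.ts b g) (PH.ts m w))"
proof -
  note intros = lin_intros carr_intros a b m
  let ?J = "\<lambda>h1 h2 h3 g1 g2. PH.ts (aP a (aP (hact h1 b) (hP h2 (hP g1 m)))) (h3 * (g2 * w))"
  have "tact (sm.smul a h b g) (PH.ts m w) =
      sweedler H (\<lambda>h1 r. tact0 (mul A a (hact h1 b)) (r * g) m w) h"
    unfolding sm.smul_def
    by (subst sweedler_linear_on[OF vector_space_tscl vector_space_tscl subspace_tspan tact_linear(2)])
      (auto intro!: tens_in_tspan sm.smul_bil intros simp: tact_tens a m sm.mul_carr b sm.hact_carr)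
  also have "\<dots> = sweedler H (\<lambda>h1 r. sweedler H (\<lambda>h2 h3. sweedler H (\<lambda>g1 g2. ?J h1 h2 h3 g1 g2) g) r) h"
    unfolding tact0_def
    by (subst sweedler_mult[OF vector_space_tscl])
      (intro intros | simp add: act_ts sm.mul_carr sm.hact_carr a b m aP_mul hP_mult mult.assoc)+
  finally have L: "tact (sm.smul a h b g) (PH.ts m w) =
    sweedler H (\<lambda>h1 r. sweedler H (\<lambda>h2 h3. sweedler H (\<lambda>g1 g2. ?J h1 h2 h3 g1 g2) g) r) h" .
  have "tact (sm.ts a h) (tact (sm.ts b g) (PH.ts m w)) =
      sweedler H (\<lambda>g1 g2. tact0 a h (act (sm.ts b g1) m) (g2 * w)) g"
    unfolding tact_tens[OF b m] tact0_def[of b]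
    by (subst sweedler_linear_on[OF vector_space_tscl vector_space_tscl subspace_tspan tact_linear(1)])
      (auto intro!: tens_in_tspan tact0_bil intros simp: tact_tens a b m P.act_carr ts_AH[simplified])
  also have "\<dots> = sweedler H (\<lambda>g1 g2. sweedler H (\<lambda>u v. sweedler H (\<lambda>h1 h2. ?J h1 h2 v g1 g2) u) h) g"
  proof -
    have "PH.ts (act (sm.ts a u) (act (sm.ts b g1) m)) z =
        sweedler H (\<lambda>h1 h2. PH.ts (aP a (aP (hact h1 b) (hP h2 (hP g1 m)))) z) u" for u g1 z
      unfolding act_ts[OF b m]
      by (subst act_ts, (intro intros)+, subst hP_aP, (intro intros)+)
        (rule sweedler_linear_on[OF P.M.vector_space_axioms vector_space_tscl P.M.carr_subspace
            tens_linear_on[OF aP_linear[OF a]]]; intro intros)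
    then show ?thesis by (simp add: tact0_def)
  qed
  also have "\<dots> = sweedler H (\<lambda>g1 g2. sweedler H (\<lambda>h1 r. sweedler H (\<lambda>h2 h3. ?J h1 h2 h3 g1 g2) r) h) g"
    by (subst sweedler_coassoc[OF vector_space_tscl]) (intro intros refl)+
  also have "\<dots> = sweedler H (\<lambda>h1 r. sweedler H (\<lambda>g1 g2. sweedler H (\<lambda>h2 h3. ?J h1 h2 h3 g1 g2) r) g) h"
    by (subst sweedler_swap[OF vector_space_tscl]) (intro intros refl)+
  also have "\<dots> = sweedler H (\<lambda>h1 r. sweedler H (\<lambda>h2 h3. sweedler H (\<lambda>g1 g2. ?J h1 h2 h3 g1 g2) g) r) h"
    by (subst sweedler_swap[OF vector_space_tscl, where h=g]) (intro intros refl)+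
  finally show ?thesis using L by simp
qed

lemma dg_module_tact: "dg_module AH PtH tact"
proof (intro dg_module.intro dg_module_axioms.intro P.B.dg_algebra_axioms PH.dg_space_tensor)
  show "bilinear_on (scl AH) (carr AH) (scl PtH) (carr PtH) (scl PtH) (carr PtH) tact"
    using tact_bilinear by simp
  have tact0_gr: "tact0 a h m w \<in> gr PtH (i + j)" if "a \<in> gr A i" "m \<in> gr P j" for a h m w i j
    unfolding tact0_def PH.tensor_simps
    by (intro sweedler_mem[OF vector_space_tscl subspace_tspan] tact0_bil tens_in_tspan UNIV_I
        P.act_gr ts_AH_gr A.A.gr_carr[OF that(1)] P.M.gr_carr[OF that(2)] that)
  show "tact x t \<in> gr PtH (i + j)" if "x \<in> gr AH i" "t \<in> gr PtH j" for x t i j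
  proof -
    have x: "x \<in> sm.VH" using that(1) sm.gr_VH by simp
    have "tact x (PH.ts m w) \<in> gr PtH (i + j)" if m: "m \<in> gr P j" for m w
      using \<open>x \<in> gr AH i\<close> unfolding sm.smash_simps
    proof (induction rule: sm.gr.tspan_induct)
      case (tens a h)
      then show ?case
        using tact0_gr[OF tens(1) m] by (simp add: tact_tens A.A.gr_carr P.M.gr_carr[OF m])
    next
      case zero
      then show ?case
        using linear_on_zero[OF tact_linear(2) sm.VH.tspan_0] P.M.gr_carr[OF m] PH.gr.tspan_0
        by (simp add: tens_in_tspan)
    next
      case (add x y)
      then show ?case
        using linear_onD(2)[OF tact_linear(2) sm.gr_VH sm.gr_VH, of "PH.ts m w" x _ y]
          P.M.gr_carr[OF m] PH.gr.tspan_add by (simp add: tens_in_tspan)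
    qed
    note 1 = this
    from that(2) show ?thesis unfolding PH.tensor_simps(2)[of j]
    proof (induction rule: PH.gr.tspan_induct)
      case (tens v w)
      show ?case using tens(1) by (rule 1)
    next
      case zero
      then show ?case
        using linear_on_zero[OF tact_linear(1)[OF x] PH.VH.tspan_0] PH.gr.tspan_0 by simp
    next
      case (add s t)
      then show ?case
        using linear_onD(2)[OF tact_linear(1)[OF x] PH.gr_VH PH.gr_VH] PH.gr.tspan_add by simp
    qed
  qed
  show "tact (mul AH x y) t = tact x (tact y t)"
    if "x \<in> carr AH" "y \<in> carr AH" "t \<in> carr PtH" for x y t
  proof -
    from that have x: "x \<in> sm.VH" and y: "y \<in> sm.VH" and t: "t \<in> PH.VH" by simp_all
    note mb = bilinear_onD[OF sm.smash_mul_bilinear]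
    show ?thesis
    proof (rule PH.VH.linear_on_tspan_eqI[OF _ _ _ t])
      show "linear_on tscl PH.VH tscl PH.VH (tact (mul AH x y))"
        using tact_linear(1) linear_onD(1)[OF mb(1)[OF x] y] .
      show "linear_on tscl PH.VH tscl PH.VH (\<lambda>t. tact x (tact y t))"
        by (rule linear_on_compose[OF tact_linear(1)[OF y] tact_linear(1)[OF x]])
      fix m w assume m: "m \<in> carr P"
      then have mw: "PH.ts m w \<in> PH.VH" by (simp add: tens_in_tspan)
      show "tact (mul AH x y) (PH.ts m w) = tact x (tact y (PH.ts m w))"
      proof (rule sm.VH.linear_on_tspan_eqI[OF _ _ _ y])
        show "linear_on tscl sm.VH tscl PH.VH (\<lambda>y. tact (mul AH x y) (PH.ts m w))"
          by (rule linear_on_compose[OF mb(1)[OF x] tact_linear(2)[OF mw]])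
        show "linear_on tscl sm.VH tscl PH.VH (\<lambda>y. tact x (tact y (PH.ts m w)))"
          by (rule linear_on_compose[OF tact_linear(2)[OF mw] tact_linear(1)[OF x]])
        fix b g assume b: "b \<in> carr A"
        then have bg: "sm.ts b g \<in> sm.VH" by (simp add: tens_in_tspan)
        show "tact (mul AH x (sm.ts b g)) (PH.ts m w) = tact x (tact (sm.ts b g) (PH.ts m w))"
        proof (rule sm.VH.linear_on_tspan_eqI[OF _ _ _ x])
          show "linear_on tscl sm.VH tscl PH.VH (\<lambda>x. tact (mul AH x (sm.ts b g)) (PH.ts m w))"
            by (rule linear_on_compose[OF mb(2)[OF bg] tact_linear(2)[OF mw]])
          show "linear_on tscl sm.VH tscl PH.VH (\<lambda>x. tact x (tact (sm.ts b g) (PH.ts m w)))"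
            by (rule tact_linear(2)[OF tact_carr[OF bg mw]])
          show "tact (mul AH (sm.ts a h) (sm.ts b g)) (PH.ts m w) =
              tact (sm.ts a h) (tact (sm.ts b g) (PH.ts m w))" if "a \<in> carr A" for a h
            using that b m by (simp add: sm.smash_mul_tens tact_smul_tens)
        qed
      qed
    qed
  qed
  show "tact (unt AH) t = t" if "t \<in> carr PtH" for t
  proof (rule PH.VH.linear_on_tspan_eqI[OF _ _ _ that[unfolded PH.carr_tensor]])
    show "linear_on tscl PH.VH tscl PH.VH (tact (unt AH))"
      by (rule tact_linear(1)) (simp add: tens_in_tspan)
    show "linear_on tscl PH.VH tscl PH.VH (\<lambda>t. t)" by (simp add: linear_on_def)
    fix m w assume m: "m \<in> carr P"
    then have "tact0 (unt A) 1 m w = PH.ts (act (sm.ts (unt A) 1) m) (1 * w)"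
      unfolding tact0_def by (intro sweedler_one[OF vector_space_tscl tact0_bil] unt_carr)
    then show "tact (unt AH) (PH.ts m w) = PH.ts m w"
      using m P.act_unt[OF m] by (simp add: tact_tens)
  qed
  show "dif PtH (tact x t) = tact (dif AH x) t + ksgn i (tact x (dif PtH t))"
    if "x \<in> gr AH i" "t \<in> carr PtH" for x t i
  proof -
    from that(2) have t: "t \<in> PH.VH" by simp
    note dl = PH.dif_tensor_linear sm.dif_tensor_linear
    have addl: "linear_on tscl PH.VH tscl PH.VH (\<lambda>t. f t + ksgn i (g t))"
      if "linear_on tscl PH.VH tscl PH.VH f" "linear_on tscl PH.VH tscl PH.VH g" for f g
      using that
      by (auto simp: linear_on_def PH.VH.T.scale_right_distrib ksgn_scale[OF vector_space_tscl]
          intro!: PH.VH.tspan_add subspace_ksgn[OF vector_space_tscl subspace_tspan])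
    have leib: "dif PtH (tact (sm.ts a h) (PH.ts m w)) =
        tact (dif AH (sm.ts a h)) (PH.ts m w) + ksgn i (tact (sm.ts a h) (dif PtH (PH.ts m w)))"
      if a: "a \<in> gr A i" and m: "m \<in> carr P" for a h m w
    proof -
      note ac = A.A.gr_carr[OF a]
      have "dif P (act (sm.ts a h1) m) =
          act (sm.ts (dif A a) h1) m + ksgn i (act (sm.ts a h1) (dif P m))" for h1
        using P.act_leibniz[OF ts_AH_gr[OF a] m] by (simp add: sm.dif_tens ac)
      then have "dif PtH (tact0 a h m w) =
        sweedler H (\<lambda>h1 h2. PH.ts (act (sm.ts (dif A a) h1) m) (h2 * w)
           + ksgn i (PH.ts (act (sm.ts a h1) (dif P m)) (h2 * w))) h"
        unfolding tact0_def
        by (subst sweedler_linear_on[OF vector_space_tscl vector_space_tscl subspace_tspan dl(1)])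
          (auto simp: PH.dif_tens P.act_carr ts_AH[simplified] ac m tens_add_left tens_ksgn_left
            intro!: tact0_bil ac m tens_in_tspan P.act_carr)
      also have "\<dots> = tact0 (dif A a) h m w + ksgn i (tact0 a h (dif P m) w)"
      proof -
        note b1 = tact0_bil[OF A.A.dif_carr[OF ac] m, of w] and b2 = tact0_bil[OF ac P.M.dif_carr[OF m], of w]
        have b3: "hbil H tscl (\<lambda>h1 h2. PH.ts (act (sm.ts (dif A a) h1) m) (h2 * w)
           + ksgn i (PH.ts (act (sm.ts a h1) (dif P m)) (h2 * w)))"
          using b1 b2 by (auto simp: bilinear_on_def linear_on_def PH.VH.T.scale_right_distrib
            ksgn_scale[OF vector_space_tscl])
        have "(\<Sum>z\<leftarrow>zs. f z + ksgn i (g z)) = (\<Sum>z\<leftarrow>zs. f z) + ksgn i (\<Sum>z\<leftarrow>zs. g z)"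
          for zs :: "('h \<times> 'h) list" and f g :: "_ \<Rightarrow> ('p, 'h, 'k) tensor"
          by (induction zs) auto
        then show ?thesis
          unfolding tact0_def sweedler_sum_list[OF vector_space_tscl b1]
            sweedler_sum_list[OF vector_space_tscl b2] sweedler_sum_list[OF vector_space_tscl b3] .
      qed
      finally show ?thesis
        using ac m by (simp add: tact_tens sm.dif_tens PH.dif_tens A.A.dif_carr P.M.dif_carr)
    qed
    from that(1) have "x \<in> tspan (scl A) (gr A i) (hscl H) UNIV" by simp
    then show ?thesis
    proof (induction rule: sm.gr.tspan_induct)
      case (tens a h)
      then have ah: "sm.ts a h \<in> sm.VH" "dif AH (sm.ts a h) \<in> sm.VH"
        using linear_onD(1)[OF dl(2)] by (auto intro: tens_in_tspan A.A.gr_carr)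
      show ?case
        by (rule PH.VH.linear_on_tspan_eqI[OF linear_on_compose[OF tact_linear(1) dl(1)]
            addl[OF tact_linear(1) linear_on_compose[OF dl(1) tact_linear(1)]] _ t])
          (use ah leib[OF tens(1)] in auto)
    next
      case zero
      then show ?case
        using linear_on_zero[OF tact_linear(2) sm.VH.tspan_0] linear_onD(1)[OF dl(1) t] t
          linear_on_zero[OF dl(1) PH.VH.tspan_0] linear_on_zero[OF dl(2) sm.VH.tspan_0]
        by simp
    next
      case (add x y)
      then have "x \<in> sm.VH" "y \<in> sm.VH" by (auto intro: sm.gr_VH)
      then show ?case
        using add.IH linear_onD[OF dl(1)] linear_onD[OF dl(2)] t tact_carr
          linear_onD(2)[OF tact_linear(2)] by simp
    qed
  qed
qed

end

section \<open>The action of \<open>H\<close> on \<open>Hom\<^sub>A(P, P)\<close>\<close>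

context smash_module
begin

sublocale AP: dg_module A P aP
  by (rule dg_module_aP)

sublocale TP: dg_module AH PtH tact
  by (rule dg_module_tact)

abbreviation "hh \<equiv> hom_hact H A P act act"
abbreviation "hf \<equiv> \<lambda>f m h1 h2. hP h2 (f (hP (T h1) m))"
abbreviation "lin_P f \<equiv> linear_on (scl P) (carr P) (scl P) (carr P) f"

lemma hh_apply: "m \<in> carr P \<Longrightarrow> hh h f m = sweedler H (hf f m) h"
  by (simp add: hom_hact_def)

lemma hh_outside: "m \<notin> carr P \<Longrightarrow> hh h f m = 0"
  by (simp add: hom_hact_def)

lemma hlin_lin_P:
  "hlin H (scl P) g \<Longrightarrow> (\<And>x. g x \<in> carr P) \<Longrightarrow> lin_P f \<Longrightarrow> hlin H (scl P) (\<lambda>x. f (g x))"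
  by (simp add: linear_on_def)

lemma lin_P_carr: "lin_P f \<Longrightarrow> m \<in> carr P \<Longrightarrow> f m \<in> carr P"
  by (rule linear_onD(1))

lemma hf_bil: "lin_P f \<Longrightarrow> m \<in> carr P \<Longrightarrow> hbil H (scl P) (hf f m)"
  by (intro lin_intros hlin_lin_P[where f=f] carr_intros lin_P_carr[where f=f])

lemma hh_carr: "lin_P f \<Longrightarrow> m \<in> carr P \<Longrightarrow> hh h f m \<in> carr P"
  unfolding hh_apply
  by (intro sweedler_mem[OF P.M.vector_space_axioms P.M.carr_subspace] hf_bil carr_intros lin_P_carr[where f=f])

lemma hh_lin_P: "lin_P f \<Longrightarrow> lin_P (hh h f)"
proof -
  assume f: "lin_P f"
  have "linear_on (scl P) (carr P) (scl P) UNIV (\<lambda>m. sweedler H (hf f m) h)"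
    by (intro sm.sweedler_param_linear_on P.M.vector_space_axioms P.M.carr_subspace hf_bil f
        linear_on_codom[where W="carr P"] linear_on_compose[OF hP_linear linear_on_compose[OF f hP_linear]])
  moreover have "linear_on (scl P) (carr P) (scl P) UNIV (hh h f) \<longleftrightarrow>
      linear_on (scl P) (carr P) (scl P) UNIV (\<lambda>m. sweedler H (hf f m) h)"
    by (intro linear_on_cong P.M.vector_space_axioms P.M.carr_subspace) (rule hh_apply)
  ultimately have "linear_on (scl P) (carr P) (scl P) UNIV (hh h f)" by blast
  then show ?thesis using hh_carr[OF f] by (rule linear_on_restr)
qed

lemma hlin_hh [lin_intros]:
  "hlin H (hscl H) g \<Longrightarrow> lin_P f \<Longrightarrow> m \<in> carr P \<Longrightarrow> hlin H (scl P) (\<lambda>x. hh (g x) f m)"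
  by (simp only: hh_apply) (intro lin_intros hf_bil)

lemma hlin_hh_right [lin_intros]:
  "hlin H (scl P) g \<Longrightarrow> (\<And>x. g x \<in> carr P) \<Longrightarrow> lin_P f \<Longrightarrow> hlin H (scl P) (\<lambda>x. hh h f (g x))"
  by (rule hlin_lin_P[OF _ _ hh_lin_P])

lemma hh_one: "lin_P f \<Longrightarrow> m \<in> carr P \<Longrightarrow> hh 1 f m = f m"
  by (simp add: hh_apply sweedler_one[OF P.M.vector_space_axioms] hf_bil T_one hP_one linear_onD(1)[of _ _ _ _ f])

lemma hom_lin_P: "f \<in> AP.E.homs i \<Longrightarrow> lin_P f"
  by (rule AP.E.hom_grD(1))

lemma hh_gr:
  assumes f: "f \<in> AP.E.homs i" and m: "m \<in> gr P j"
  shows "hh h f m \<in> gr P (i + j)"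
proof -
  note mc = P.M.gr_carr[OF m]
  show ?thesis
    unfolding hh_apply[OF mc]
    by (intro sweedler_mem[OF P.M.vector_space_axioms P.M.gr_subspace] hf_bil hom_lin_P[OF f] mc
        hP_gr AP.E.hom_grD(3)[OF f] m)
qed

text \<open>The inverse antipode reverses coproducts, so pulling a out of f leaves
  \<open>T h2\<close> acting on a; the following leg h_3 then acts on it too, and h_3 T(h_2)
  contracts to the counit. The use of the inverse of S, and not S, in the action is what makes these
  legs cancel.\<close>

lemma hh_aP:
  assumes f: "f \<in> AP.E.homs i" and a: "a \<in> gr A j" and m: "m \<in> carr P"
  shows "hh h f (aP a m) = ksgn (i * j) (aP a (hh h f m))"
proof -
  note ac = A.A.gr_carr[OF a] and fl = hom_lin_P[OF f]
  note intros = lin_intros hlin_lin_P[where f=f] carr_intros lin_P_carr[where f=f] ac fl m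
  note V = P.M.vector_space_axioms
  let ?G = "\<lambda>h1 h2 h3 h4. aP (hact (h3 * T h2) a) (hP h4 (f (hP (T h1) m)))"
  have kl: "lin (scl P) (scl P) (ksgn n)" for n
    by (simp add: linear_on_def ksgn_scale[OF V])
  have "hh h f (aP a m) = sweedler H (\<lambda>x y. hP y (f (sweedler H (\<lambda>h1 h2. aP (hact (T h2) a) (hP (T h1) m)) x))) h"
    unfolding hh_apply[OF aP_carr[OF ac m]] hP_aP[OF ac m]
    by (subst sweedler_T[OF V]) (intro intros refl)+
  also have "\<dots> = sweedler H (\<lambda>x y. sweedler H (\<lambda>h1 h2. hP y (f (aP (hact (T h2) a) (hP (T h1) m)))) x) h"
    by (subst sweedler_linear_on[OF V V P.M.carr_subspace linear_on_compose[OF fl hP_linear]])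
      (intro intros refl)+
  also have "\<dots> = sweedler H (\<lambda>x y. sweedler H (\<lambda>h1 h2.
      ksgn (i * j) (sweedler H (\<lambda>h3 h4. ?G h1 h2 h3 h4) y)) x) h"
  proof -
    have "hP y (f (aP (hact (T h2) a) (hP (T h1) m))) = ksgn (i * j) (sweedler H (\<lambda>h3 h4. ?G h1 h2 h3 h4) y)" for h1 h2 y
    proof -
      have "f (aP (hact (T h2) a) (hP (T h1) m)) = ksgn (i * j) (aP (hact (T h2) a) (f (hP (T h1) m)))"
        by (rule AP.E.hom_grD(4)[OF f A.hact_gr[OF a]]) (intro intros)
      then have "hP y (f (aP (hact (T h2) a) (hP (T h1) m))) =
          ksgn (i * j) (hP y (aP (hact (T h2) a) (f (hP (T h1) m))))"
        using linear_on_ksgn[OF V P.M.carr_subspace hP_linear]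
        by (simp add: carr_intros lin_P_carr[where f=f] ac fl m)
      then show ?thesis
        by (simp add: hP_aP carr_intros lin_P_carr[where f=f] ac fl m A.hact_mult[OF ac])
    qed
    then show ?thesis by simp
  qed
  also have "\<dots> = ksgn (i * j) (sweedler H (\<lambda>x y. sweedler H (\<lambda>h1 h2. sweedler H (\<lambda>h3 h4. ?G h1 h2 h3 h4) y) x) h)"
    by (subst sweedler_lin[OF V V kl], (intro intros refl)+)
      (subst sweedler_lin[OF V V kl], (intro intros refl)+)
  also have "sweedler H (\<lambda>x y. sweedler H (\<lambda>h1 h2. sweedler H (\<lambda>h3 h4. ?G h1 h2 h3 h4) y) x) h =
      sweedler H (\<lambda>h1 r. sweedler H (\<lambda>h2 y. sweedler H (\<lambda>h3 h4. ?G h1 h2 h3 h4) y) r) h"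
    by (subst sweedler_coassoc[OF V]) (intro intros refl)+
  also have "\<dots> = sweedler H (\<lambda>h1 r. aP (hact 1 a) (hP r (f (hP (T h1) m)))) h"
    by (subst T_right_contract_left(1)[OF V]) (intro intros refl)+
  also have "\<dots> = aP a (hh h f m)"
    unfolding hh_apply[OF m] A.hact_one[OF ac]
    by (subst sweedler_linear_on[OF V V P.M.carr_subspace aP_linear[OF ac]]) (intro intros refl)+
  finally show ?thesis .
qed

text \<open>Since \<open>T\<close> is anti-multiplicative, the left side contains T(g_2) g_1, which
  contracts to the counit and leaves only the last leg of g outside. This is the source of the
  H-linearity of \<open>phi1 f h\<close>.\<close>

lemma hh_hP:
  assumes f: "lin_P f" and m: "m \<in> carr P"
  shows "sweedler H (\<lambda>g1 g2. hh (g2 * w) f (hP g1 m)) g = hP g (hh w f m)"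
proof -
  note intros = lin_intros hlin_lin_P[where f=f] carr_intros lin_P_carr[where f=f] f m
  note V = P.M.vector_space_axioms
  let ?G = "\<lambda>w1 w2 x y. hP (y * w2) (f (hP (T w1 * x) m))"
  have "sweedler H (\<lambda>g1 g2. hh (g2 * w) f (hP g1 m)) g =
    sweedler H (\<lambda>g1 r. sweedler H (\<lambda>g2 g3. sweedler H (\<lambda>w1 w2. ?G w1 w2 (T g2 * g1) g3) w) r) g"
    unfolding hh_apply[OF hP_carr[OF m]]
    by (subst sweedler_mult[OF V]) (intro intros refl | simp add: hP_mult[symmetric] m T_mult mult.assoc)+
  also have "\<dots> = sweedler H (\<lambda>w1 w2. ?G w1 w2 1 g) w"
    by (rule T_left_contract_left(1)[OF V]) (intro intros)
  also have "\<dots> = hP g (hh w f m)"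
    unfolding hh_apply[OF m]
    by (subst sweedler_linear_on[OF V V P.M.carr_subspace hP_linear])
      (intro intros refl | simp add: hP_mult carr_intros lin_P_carr[where f=f] f m)+
  finally show ?thesis .
qed

lemma hh_mem:
  assumes "f \<in> AP.E.homs i"
  shows "hh h f \<in> AP.E.homs i"
  unfolding hom_gr_def
  by (intro CollectI conjI allI ballI impI hh_lin_P hom_lin_P[OF assms] hh_outside hh_gr[OF assms]
      hh_aP[OF assms])

lemma total_induct [consumes 1, case_names homs zero add]:
  assumes "f \<in> AP.E.total" "\<And>i f. f \<in> AP.E.homs i \<Longrightarrow> Q f" "Q 0"
    "\<And>f g. f \<in> AP.E.total \<Longrightarrow> g \<in> AP.E.total \<Longrightarrow> Q f \<Longrightarrow> Q g \<Longrightarrow> Q (f + g)"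
  shows "Q f"
  using dg_space.carr_induct[OF AP.dg_space_End, of f Q] assms by simp

lemma total_lin_P: "f \<in> AP.E.total \<Longrightarrow> lin_P f"
proof (induction rule: total_induct)
  case (homs i f)
  then show ?case by (rule hom_lin_P)
qed (auto simp: linear_on_def zero_fun_apply plus_fun_apply P.M.carr_add P.M.scale_right_distrib)

lemma total_outside: "f \<in> AP.E.total \<Longrightarrow> m \<notin> carr P \<Longrightarrow> f m = 0"
  by (induction rule: total_induct) (auto simp: AP.E.hom_grD(2) zero_fun_apply plus_fun_apply)

abbreviation "sE \<equiv> \<lambda>c (f :: 'p \<Rightarrow> 'p) x. scl P c (f x)"

lemma hh_linear_right: "linear_on sE AP.E.total sE AP.E.total (hh h)"
proof -
  have "linear_on sE AP.E.total (scl P) UNIV (\<lambda>f. hh h f m)" for m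
  proof (cases "m \<in> carr P")
    case True
    have 1: "linear_on sE AP.E.total (scl P) UNIV (\<lambda>f. hf f m p q)" for p q
      by (simp add: linear_on_def[of _ _ _ _ "\<lambda>f. hf f m p q"] plus_fun_apply
          linear_onD(2,3)[OF hP_linear] linear_onD(1)[OF total_lin_P] hP_carr[OF True])
    have "linear_on sE AP.E.total (scl P) UNIV (\<lambda>f. sweedler H (hf f m) h)"
      by (intro sm.sweedler_param_linear_on P.M.vector_space_axioms AP.E.hom_scl AP.E.total_subspace
          hf_bil total_lin_P True 1)
    then show ?thesis by (simp add: hh_apply[OF True])
  qed (simp add: hh_outside linear_on_def)
  then have lin: "hh h (f + g) = hh h f + hh h g" "hh h (sE c f) = sE c (hh h f)"
    if "f \<in> AP.E.total" "g \<in> AP.E.total" for f g c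
    using that by (auto simp: linear_on_def fun_eq_iff plus_fun_apply)
  have z: "0 \<in> AP.E.total" using P.E.subspace_0[OF AP.E.total_subspace] .
  have "hh h f \<in> AP.E.total" if "f \<in> AP.E.total" for f
    using that
  proof (induction rule: total_induct)
    case (homs i f)
    then show ?case using hh_mem AP.E.G_total by blast
  next
    case zero
    have "hh h 0 = 0" using lin(1)[OF z z] by simp
    then show ?case using z by simp
  next
    case (add f g)
    then show ?case using P.E.subspace_add[OF AP.E.total_subspace] by (simp add: lin)
  qed
  then show ?thesis using lin by (simp add: linear_on_def)
qed

lemma hh_bilinear: "bilinear_on (hscl H) UNIV sE AP.E.total sE AP.E.total hh"
proof (rule bilinear_onI[OF hh_linear_right])
  fix f assume f: "f \<in> AP.E.total"
  have "hlin H (scl P) (\<lambda>h. hh h f m)" for m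
    by (cases "m \<in> carr P") (auto simp: hh_outside linear_on_def[of _ _ _ _ "\<lambda>_. 0"] intro!: lin_intros total_lin_P[OF f])
  then show "linear_on (hscl H) UNIV sE AP.E.total (\<lambda>h. hh h f)"
    using linear_onD(1)[OF hh_linear_right f] by (auto simp: linear_on_def fun_eq_iff plus_fun_apply)
qed

sublocale ES: smash_product H Bs "AP.End" hh
proof (intro smash_product.intro smash_product_axioms.intro dg_tensor.intro)
  show "fd_hopf_algebra H Bs" by (rule fd_hopf_algebra_axioms)
  show "dg_space AP.End" by (rule AP.dg_space_End)
  show "bilinear_on (scl AP.End) (carr AP.End) (scl AP.End) (carr AP.End) (scl AP.End) (carr AP.End) (mul AP.End)"
    by (rule AP.End_mul_bilinear)
  show "bilinear_on (hscl H) UNIV (scl AP.End) (carr AP.End) (scl AP.End) (carr AP.End) hh"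
    unfolding AP.End_simps by (rule hh_bilinear)
qed

end

section \<open>Isomorphisms of complexes and of dg algebras\<close>

text \<open>A chain map that is bijective in every degree matches cocycles with cocycles and
  coboundaries with coboundaries, hence classes with classes.\<close>

lemma induces_iso_if_bijective:
  assumes hom: "dgs_hom V W f" and inj: "inj_on f (carr V)" and surj: "\<And>n. gr W n \<subseteq> f ` gr V n"
  shows "induces_iso V W f"
  unfolding induces_iso_def
proof
  fix n
  interpret V: dg_space V using hom by (simp add: dgs_hom_def)
  interpret W: dg_space W using hom by (simp add: dgs_hom_def)
  have lin: "linear_on (scl V) (carr V) (scl W) (carr W) f"
    and fgr: "\<And>n x. x \<in> gr V n \<Longrightarrow> f x \<in> gr W n"
    and fdif: "\<And>x. x \<in> carr V \<Longrightarrow> f (dif V x) = dif W (f x)"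
    using hom by (auto simp: dgs_hom_def)
  have f0: "f 0 = 0" using linear_on_zero[OF lin] by simp
  have inj0: "x = 0" if "f x = 0" "x \<in> carr V" for x
    using inj_onD[OF inj, of x 0] that f0 by simp
  have coc: "f x \<in> cocycles W n \<longleftrightarrow> x \<in> cocycles V n" if "x \<in> gr V n" for x
    using that fgr fdif[symmetric] inj0 V.dif_carr V.gr_carr f0 by (auto simp: cocycles_def)
  have cocW: "cocycles W n = f ` cocycles V n"
  proof -
    have "y \<in> f ` cocycles V n" if y: "y \<in> cocycles W n" for y
    proof -
      obtain x where "x \<in> gr V n" "y = f x" using y surj[of n] by (auto simp: cocycles_def)
      then show ?thesis using y coc by blast
    qed
    moreover have "f x \<in> cocycles W n" if "x \<in> cocycles V n" for x
      using that coc[of x] by (simp add: cocycles_def)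
    ultimately show ?thesis by blast
  qed
  have ccarr: "x \<in> carr V" if "x \<in> cocycles V n" for x
    using that V.gr_carr by (auto simp: cocycles_def)
  have fdiff: "f (x - y) = f x - f y" if "x \<in> carr V" "y \<in> carr V" for x y
    by (rule linear_on_diff[OF V.vector_space_axioms V.carr_subspace lin that])
  have cob: "f x - f y \<in> coboundaries W n \<longleftrightarrow> x - y \<in> coboundaries V n"
    if xy: "x \<in> cocycles V n" "y \<in> cocycles V n" for x y
  proof
    assume "f x - f y \<in> coboundaries W n"
    then obtain w where w: "w \<in> gr W (n - 1)" "f (x - y) = dif W w"
      using fdiff[OF ccarr[OF xy(1)] ccarr[OF xy(2)]] by (auto simp: coboundaries_def)
    then obtain z where z: "z \<in> gr V (n - 1)" "w = f z" using surj[of "n - 1"] by blast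
    then have "f (x - y) = f (dif V z)" using w fdif V.gr_carr by simp
    then have "x - y = dif V z"
      using inj_onD[OF inj] V.carr_diff ccarr xy V.dif_carr V.gr_carr z(1) by blast
    then show "x - y \<in> coboundaries V n" using z(1) by (auto simp: coboundaries_def)
  next
    assume "x - y \<in> coboundaries V n"
    then obtain z where z: "z \<in> gr V (n - 1)" "x - y = dif V z" by (auto simp: coboundaries_def)
    then have "f x - f y = dif W (f z)"
      using fdiff[OF ccarr[OF xy(1)] ccarr[OF xy(2)]] fdif[OF V.gr_carr[OF z(1)]] by simp
    then show "f x - f y \<in> coboundaries W n"
      using fgr[OF z(1)] by (simp add: coboundaries_def)
  qed
  have "coboundaries V n = dif V ` gr V (n - 1)" by (simp add: coboundaries_def)
  then have cob_add: "a + b \<in> coboundaries V n" if "a \<in> coboundaries V n" "b \<in> coboundaries V n" for a b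
    using that V.dif_add[OF V.gr_carr V.gr_carr, symmetric] V.subspace_add[OF V.gr_subspace]
    by (auto simp: coboundaries_def)
  let ?R = "cohomologous V n" and ?S = "cohomologous W n"
  have RS: "(f x, f y) \<in> ?S \<longleftrightarrow> (x, y) \<in> ?R" if "x \<in> cocycles V n" "y \<in> cocycles V n" for x y
    using that cob cocW by (auto simp: cohomologous_def)
  have trans: "(x, z) \<in> ?R" if "(x, y) \<in> ?R" "(y, z) \<in> ?R" for x y z
    using that cob_add[of "x - y" "y - z"] by (auto simp: cohomologous_def)
  \<comment> \<open>The image of a class is already a full class, so the saturation in
    \<open>induces_iso\<close> may be dropped and plain images compared.\<close>
  have img: "?S `` (f ` X) = f ` X" "X \<subseteq> cocycles V n" if X: "X \<in> cohomology V n" for X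
  proof -
    obtain x where x: "x \<in> cocycles V n" "X = ?R `` {x}" using X by (auto simp: cohomology_def quotient_def)
    then show XC: "X \<subseteq> cocycles V n" by (auto simp: cohomologous_def)
    have "0 \<in> coboundaries V n"
      using V.subspace_0[OF V.gr_subspace] V.dif_0 unfolding coboundaries_def by (metis imageI)
    then have refl: "(y, y) \<in> ?R" if "y \<in> X" for y using that XC by (auto simp: cohomologous_def)
    show "?S `` (f ` X) = f ` X"
    proof
      show "f ` X \<subseteq> ?S `` (f ` X)" using refl RS XC by blast
      show "?S `` (f ` X) \<subseteq> f ` X"
      proof
        fix z assume "z \<in> ?S `` (f ` X)"
        then obtain y where y: "y \<in> X" "(f y, z) \<in> ?S" by blast
        then obtain z' where z': "z' \<in> cocycles V n" "z = f z'" using cocW by (auto simp: cohomologous_def)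
        then have "(y, z') \<in> ?R" using RS XC y by blast
        then show "z \<in> f ` X" using trans y(1) x(2) z' by blast
      qed
    qed
  qed
  have "bij_betw (\<lambda>X. f ` X) (cohomology V n) (cohomology W n)"
    unfolding bij_betw_def
  proof
    show "inj_on (\<lambda>X. f ` X) (cohomology V n)"
    proof (rule inj_onI)
      fix X Y assume XY: "X \<in> cohomology V n" "Y \<in> cohomology V n" "f ` X = f ` Y"
      have "inj_on f (X \<union> Y)" using img(2)[OF XY(1)] img(2)[OF XY(2)] ccarr by (intro inj_on_subset[OF inj]) blast
      then show "X = Y" using XY(3) by (rule inj_on_Un_image_eq_iff[THEN iffD1])
    qed
    have cl: "f ` (?R `` {x}) = ?S `` {f x}" if x: "x \<in> cocycles V n" for x
    proof
      show "f ` (?R `` {x}) \<subseteq> ?S `` {f x}" using RS x by (auto simp: cohomologous_def)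
      show "?S `` {f x} \<subseteq> f ` (?R `` {x})"
      proof
        fix z assume "z \<in> ?S `` {f x}"
        then obtain z' where z': "z' \<in> cocycles V n" "z = f z'" "(f x, z) \<in> ?S" using cocW by (auto simp: cohomologous_def)
        then show "z \<in> f ` (?R `` {x})" using RS x by blast
      qed
    qed
    have "cohomology W n = (\<lambda>x. ?S `` {f x}) ` cocycles V n"
      unfolding cohomology_def cocW quotient_def by blast
    also have "\<dots> = (\<lambda>x. f ` (?R `` {x})) ` cocycles V n" using cl by auto
    also have "\<dots> = (\<lambda>X. f ` X) ` cohomology V n" unfolding cohomology_def quotient_def by blast
    finally show "(\<lambda>X. f ` X) ` cohomology V n = cohomology W n" ..
  qed
  then show "bij_betw (\<lambda>X. ?S `` (f ` X)) (cohomology V n) (cohomology W n)"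
    using bij_betw_cong[of "cohomology V n" "\<lambda>X. ?S `` (f ` X)" "\<lambda>X. f ` X"] img(1) by simp
qed

text \<open>Transport of structure: each equation is verified after applying the injective f. It
  supplies the dg algebra axioms of Hom_A(P, P) # H.\<close>

lemma dg_algebra_if_bijective_hom:
  assumes B: "dg_algebra B" and hom: "dgs_hom A B f" and inj: "inj_on f (carr A)"
    and surj: "\<And>n. gr B n \<subseteq> f ` gr A n"
    and bil: "bilinear_on (scl A) (carr A) (scl A) (carr A) (scl A) (carr A) (mul A)"
    and mul: "\<And>x y. x \<in> carr A \<Longrightarrow> y \<in> carr A \<Longrightarrow> f (mul A x y) = mul B (f x) (f y)"
    and unt: "unt A \<in> gr A 0" "f (unt A) = unt B"
  shows "dg_algebra A"
proof -
  interpret A: dg_space A using hom by (simp add: dgs_hom_def)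
  interpret B: dg_algebra B by fact
  have lin: "linear_on (scl A) (carr A) (scl B) (carr B) f"
    and fgr: "\<And>n x. x \<in> gr A n \<Longrightarrow> f x \<in> gr B n"
    and fdif: "\<And>x. x \<in> carr A \<Longrightarrow> f (dif A x) = dif B (f x)"
    using hom by (auto simp: dgs_hom_def)
  note fc = linear_onD(1)[OF lin] and eq = inj_onD[OF inj]
  have mc: "mul A x y \<in> carr A" if "x \<in> carr A" "y \<in> carr A" for x y
    using bilinear_onD(1)[OF bil that(1)] that(2) by (rule linear_onD(1))
  have uc: "unt A \<in> carr A" by (rule A.gr_carr[OF unt(1)])
  show ?thesis
  proof (intro dg_algebra.intro dg_algebra_axioms.intro A.dg_space_axioms bil unt(1))
    show "mul A a b \<in> gr A (i + j)" if ab: "a \<in> gr A i" "b \<in> gr A j" for a b i j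
    proof -
      note abc = A.gr_carr[OF ab(1)] A.gr_carr[OF ab(2)]
      have "f (mul A a b) \<in> gr B (i + j)"
        using B.mul_gr[OF fgr[OF ab(1)] fgr[OF ab(2)]] mul[OF abc] by simp
      \<comment> \<open>Degrees are not reflected by injectivity alone; surjectivity in degree i + j
        provides an element of that degree with the same image.\<close>
      then obtain z where z: "z \<in> gr A (i + j)" "f (mul A a b) = f z" using surj[of "i + j"] by blast
      then have "mul A a b = z" using eq mc[OF abc] A.gr_carr by blast
      then show ?thesis using z(1) by simp
    qed
    show "mul A (mul A a b) c = mul A a (mul A b c)" if "a \<in> carr A" "b \<in> carr A" "c \<in> carr A" for a b c
      by (rule eq) (simp_all add: that mc mul fc B.mul_assoc)
    show "mul A (unt A) a = a" if "a \<in> carr A" for a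
      by (rule eq) (simp_all add: that mc uc mul fc unt(2) B.unt_left)
    show "mul A a (unt A) = a" if "a \<in> carr A" for a
      by (rule eq) (simp_all add: that mc uc mul fc unt(2) B.unt_right)
    show "dif A (mul A a b) = mul A (dif A a) b + ksgn i (mul A a (dif A b))"
      if "a \<in> gr A i" "b \<in> carr A" for a b i
    proof (rule eq)
      note ac = A.gr_carr[OF that(1)]
      show "f (dif A (mul A a b)) = f (mul A (dif A a) b + ksgn i (mul A a (dif A b)))"
        using linear_on_ksgn[OF A.vector_space_axioms A.carr_subspace lin]
        by (simp add: fdif mc ac that(2) mul B.leibniz[OF fgr[OF that(1)] fc[OF that(2)]]
            linear_onD(2)[OF lin] A.dif_carr A.carr_ksgn)
    qed (simp_all add: that A.gr_carr[OF that(1)] A.dif_carr mc A.carr_add A.carr_ksgn)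
  qed
qed

section \<open>The isomorphism\<close>

context smash_module
begin

abbreviation "EH \<equiv> smash H AP.End hh"
abbreviation "BB \<equiv> TP.End"
abbreviation "sB \<equiv> \<lambda>c (F :: ('p, 'h, 'k) tensor \<Rightarrow> ('p, 'h, 'k) tensor) x. tscl c (F x)"

lemma vector_space_sB [lin_intros]: "vector_space sB"
  by (rule vector_space_fun[OF vector_space_tscl])

section \<open>The A # H-linear map attached to f # h\<close>

definition phi0 where
  "phi0 f h m w = sweedler H (\<lambda>w1 w2. PH.ts (hh w1 f m) (w2 * h)) w"

text \<open>The guard makes \<open>phi1 f h\<close> vanish off the carrier, as \<open>hom_gr\<close>
  demands of its elements.\<close>

definition phi1 where
  "phi1 f h t = (if t \<in> PH.VH then tlift (scl P) (carr P) (hscl H) UNIV (phi0 f h) t else 0)"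

lemma phi0_bil: "lin_P f \<Longrightarrow> m \<in> carr P \<Longrightarrow> hbil H tscl (\<lambda>w1 w2. PH.ts (hh w1 f m) (w2 * h))"
  by (intro lin_intros)

lemma phi0_mem: "lin_P f \<Longrightarrow> m \<in> carr P \<Longrightarrow> phi0 f h m w \<in> PH.VH"
  unfolding phi0_def
  by (intro sweedler_mem[OF vector_space_tscl subspace_tspan] phi0_bil tens_in_tspan hh_carr UNIV_I)

lemma phi0_bilinear: "lin_P f \<Longrightarrow> bilinear_on (scl P) (carr P) (hscl H) UNIV tscl PH.VH (phi0 f h)"
proof (rule bilinear_onI; rule linear_on_restr[where W=UNIV])
  assume f: "lin_P f"
  show "hlin H tscl (phi0 f h m)" if "m \<in> carr P" for m
    unfolding phi0_def by (intro lin_intros f that)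
  show "linear_on (scl P) (carr P) tscl UNIV (\<lambda>m. phi0 f h m w)" for w
    unfolding phi0_def
    by (intro sm.sweedler_param_linear_on vector_space_tscl P.M.vector_space_axioms P.M.carr_subspace
        phi0_bil tens_linear_on hh_lin_P[OF f] f)
qed (auto intro: phi0_mem)

lemma phi0_bilinear': "lin_P f \<Longrightarrow> bilinear_on (scl P) (carr P) (hscl H) UNIV tscl UNIV (phi0 f h)"
  using phi0_bilinear[of f h] by (auto simp: bilinear_on_def intro: linear_on_codom)

lemma phi1_tens: "lin_P f \<Longrightarrow> m \<in> carr P \<Longrightarrow> phi1 f h (PH.ts m w) = phi0 f h m w"
  unfolding phi1_def by (simp add: tens_in_tspan PH.VH.tlift_tens[OF vector_space_tscl phi0_bilinear'])

text \<open>1 is grouplike and acts trivially on f, so on the generators m \<otimes> 1 nothing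
  remains of the twist by w.\<close>

lemma phi1_tens_one: "lin_P f \<Longrightarrow> m \<in> carr P \<Longrightarrow> phi1 f h (PH.ts m 1) = PH.ts (f m) h"
  by (simp add: phi1_tens phi0_def sweedler_one[OF vector_space_tscl phi0_bil] hh_one)

lemma phi1_linear: "lin_P f \<Longrightarrow> linear_on tscl PH.VH tscl PH.VH (phi1 f h)"
proof -
  assume f: "lin_P f"
  have "linear_on tscl PH.VH tscl PH.VH (phi1 f h) \<longleftrightarrow>
      linear_on tscl PH.VH tscl PH.VH (tlift (scl P) (carr P) (hscl H) UNIV (phi0 f h))"
    by (intro linear_on_cong vector_space_tscl subspace_tspan) (simp add: phi1_def)
  then show ?thesis
    by (simp add: PH.VH.tlift_linear_on vector_space_tscl subspace_tspan phi0_bilinear f)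
qed

text \<open>Linearity over A, with its sign, is \<open>hh_aP\<close>. For H, coassociativity groups
  g_1 with g_2, and \<open>hh_hP\<close> then moves the first leg of g out of the argument of
  f.\<close>

lemma phi1_tact_tens:
  assumes f: "f \<in> AP.E.homs i" and a: "a \<in> gr A j" and m: "m \<in> carr P"
  shows "phi1 f h (tact (sm.ts a g) (PH.ts m w)) = ksgn (i * j) (tact (sm.ts a g) (phi1 f h (PH.ts m w)))"
proof -
  note ac = A.A.gr_carr[OF a] and fl = hom_lin_P[OF f]
  note intros = lin_intros carr_intros hh_carr hh_lin_P ac fl m
  note V = vector_space_tscl
  let ?J = "\<lambda>g1 g2 g3 w1 w2. PH.ts (aP a (hh (g2 * w1) f (hP g1 m))) (g3 * (w2 * h))"
  have kl: "lin tscl tscl (ksgn n)" for n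
    by (simp add: linear_on_def ksgn_scale[OF V])
  have "phi1 f h (tact (sm.ts a g) (PH.ts m w)) =
      sweedler H (\<lambda>g1 r. phi0 f h (aP a (hP g1 m)) (r * w)) g"
    unfolding tact_tens[OF ac m] tact0_def
    by (subst sweedler_linear_on[OF V V subspace_tspan phi1_linear[OF fl]])
      (auto intro!: tact0_bil tens_in_tspan intros simp: phi1_tens fl act_ts ac m)
  also have "\<dots> = sweedler H (\<lambda>g1 r. ksgn (i * j) (sweedler H (\<lambda>g2 g3. sweedler H (\<lambda>w1 w2. ?J g1 g2 g3 w1 w2) w) r)) g"
  proof -
    have "phi0 f h (aP a (hP g1 m)) (r * w) = ksgn (i * j) (sweedler H (\<lambda>g2 g3. sweedler H (\<lambda>w1 w2. ?J g1 g2 g3 w1 w2) w) r)" for g1 r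
    proof -
      have "phi0 f h (aP a (hP g1 m)) (r * w) =
          sweedler H (\<lambda>w1 w2. ksgn (i * j) (PH.ts (aP a (hh w1 f (hP g1 m))) (w2 * h))) (r * w)"
        unfolding phi0_def by (simp add: hh_aP[OF f a] m tens_ksgn_left)
      also have "\<dots> = ksgn (i * j) (sweedler H (\<lambda>w1 w2. PH.ts (aP a (hh w1 f (hP g1 m))) (w2 * h)) (r * w))"
        by (rule sweedler_lin[OF V V kl, symmetric]) (intro intros)
      also have "\<dots> = ksgn (i * j) (sweedler H (\<lambda>g2 g3. sweedler H (\<lambda>w1 w2. ?J g1 g2 g3 w1 w2) w) r)"
        by (subst sweedler_mult[OF V]) (intro intros | simp add: mult.assoc)+
      finally show ?thesis .
    qed
    then show ?thesis by simp
  qed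
  also have "\<dots> = ksgn (i * j) (sweedler H (\<lambda>g1 r. sweedler H (\<lambda>g2 g3. sweedler H (\<lambda>w1 w2. ?J g1 g2 g3 w1 w2) w) r) g)"
    by (rule sweedler_lin[OF V V kl, symmetric]) (intro intros)
  also have "sweedler H (\<lambda>g1 r. sweedler H (\<lambda>g2 g3. sweedler H (\<lambda>w1 w2. ?J g1 g2 g3 w1 w2) w) r) g =
    sweedler H (\<lambda>r g3. sweedler H (\<lambda>g1 g2. sweedler H (\<lambda>w1 w2. ?J g1 g2 g3 w1 w2) w) r) g"
    by (subst sweedler_coassoc[OF V, symmetric]) (intro intros refl)+
  also have "\<dots> = sweedler H (\<lambda>r g3. sweedler H (\<lambda>w1 w2. sweedler H (\<lambda>g1 g2. ?J g1 g2 g3 w1 w2) r) w) g"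
    by (subst sweedler_swap[OF V]) (intro intros refl)+
  also have "\<dots> = sweedler H (\<lambda>r g3. sweedler H (\<lambda>w1 w2.
      PH.ts (aP a (hP r (hh w1 f m))) (g3 * (w2 * h))) w) g"
  proof -
    have "sweedler H (\<lambda>g1 g2. PH.ts (aP a (hh (g2 * w1) f (hP g1 m))) z) r = PH.ts (aP a (hP r (hh w1 f m))) z"
      for w1 r z
      unfolding hh_hP[OF fl m, symmetric]
      by (rule sweedler_linear_on[OF P.M.vector_space_axioms V P.M.carr_subspace
            tens_linear_on[OF aP_linear[OF ac]], symmetric]) (intro intros)+
    then show ?thesis by simp
  qed
  also have "\<dots> = sweedler H (\<lambda>w1 w2. sweedler H (\<lambda>r g3.
      PH.ts (aP a (hP r (hh w1 f m))) (g3 * (w2 * h))) g) w"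
    by (rule sweedler_swap[OF V]) (intro intros)+
  also have "\<dots> = tact (sm.ts a g) (phi1 f h (PH.ts m w))"
    unfolding phi1_tens[OF fl m] phi0_def
    by (subst sweedler_linear_on[OF V V subspace_tspan tact_linear(1)])
      (auto intro!: tens_in_tspan phi0_bil intros simp: tact_tens tact0_def act_ts ac m hh_carr fl)
  finally show ?thesis .
qed

lemma phi1_mem:
  assumes f: "f \<in> AP.E.homs i"
  shows "phi1 f h \<in> TP.E.homs i"
  unfolding hom_gr_def
proof (intro CollectI conjI allI impI ballI)
  note fl = hom_lin_P[OF f]
  note L = phi1_linear[OF fl, of h]
  show "linear_on (scl PtH) (carr PtH) (scl PtH) (carr PtH) (phi1 f h)" using L by simp
  show "phi1 f h t = 0" if "t \<notin> carr PtH" for t using that by (simp add: phi1_def)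
  show "phi1 f h t \<in> gr PtH (i + j)" if "t \<in> gr PtH j" for t j
    using that unfolding PH.tensor_simps
  proof (induction rule: PH.gr.tspan_induct)
    case (tens m w)
    note mc = P.M.gr_carr[OF tens(1)]
    show ?case
      unfolding phi1_tens[OF fl mc] phi0_def
      by (intro sweedler_mem[OF vector_space_tscl subspace_tspan] phi0_bil fl mc tens_in_tspan UNIV_I
          hh_gr[OF f] tens)
  next
    case zero
    then show ?case using linear_on_zero[OF L PH.VH.tspan_0] PH.gr.tspan_0 by simp
  next
    case (add s t)
    then show ?case using linear_onD(2)[OF L PH.gr_VH PH.gr_VH] PH.gr.tspan_add by simp
  qed
  show "phi1 f h (tact x t) = ksgn (i * j) (tact x (phi1 f h t))" if "x \<in> gr AH j" "t \<in> carr PtH" for x t j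
  proof -
    note ksl = linear_on_ksgn_comp[OF vector_space_tscl subspace_tspan, where n="i * j"]
    from that(1) have x: "x \<in> tspan (scl A) (gr A j) (hscl H) UNIV" "x \<in> sm.VH" using sm.gr_VH by auto
    show ?thesis
    proof (rule PH.VH.linear_on_tspan_eqI[OF _ _ _ that(2)[unfolded PH.carr_tensor]])
      show "linear_on tscl PH.VH tscl PH.VH (\<lambda>t. phi1 f h (tact x t))"
        by (rule linear_on_compose[OF tact_linear(1)[OF x(2)] L])
      show "linear_on tscl PH.VH tscl PH.VH (\<lambda>t. ksgn (i * j) (tact x (phi1 f h t)))"
        by (rule ksl[OF linear_on_compose[OF L tact_linear(1)[OF x(2)]]])
      fix m w assume m: "m \<in> carr P"
      then have mw: "PH.ts m w \<in> PH.VH" by (simp add: tens_in_tspan)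
      have L1: "linear_on tscl (tspan (scl A) (gr A j) (hscl H) UNIV) tscl PH.VH (\<lambda>x. phi1 f h (tact x (PH.ts m w)))"
        by (rule linear_on_dom[OF linear_on_compose[OF tact_linear(2)[OF mw] L]]) (auto intro: sm.gr_VH)
      have L2: "linear_on tscl (tspan (scl A) (gr A j) (hscl H) UNIV) tscl PH.VH
          (\<lambda>x. ksgn (i * j) (tact x (phi1 f h (PH.ts m w))))"
        by (rule linear_on_dom[OF ksl[OF tact_linear(2)[OF linear_onD(1)[OF L mw]]]]) (auto intro: sm.gr_VH)
      show "phi1 f h (tact x (PH.ts m w)) = ksgn (i * j) (tact x (phi1 f h (PH.ts m w)))"
        by (rule sm.gr.linear_on_tspan_eqI[OF L1 L2 _ x(1)]) (rule phi1_tact_tens[OF f _ m])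
    qed
  qed
qed

section \<open>Endomorphisms of P \<otimes> H are determined on the generators m \<otimes> 1\<close>

lemma BB_total_induct [consumes 1, case_names homs zero add]:
  assumes "F \<in> TP.E.total" "\<And>i F. F \<in> TP.E.homs i \<Longrightarrow> Q F" "Q 0"
    "\<And>F G. F \<in> TP.E.total \<Longrightarrow> G \<in> TP.E.total \<Longrightarrow> Q F \<Longrightarrow> Q G \<Longrightarrow> Q (F + G)"
  shows "Q F"
  using dg_space.carr_induct[OF TP.dg_space_End, of F Q] assms by simp

lemma BB_apply: "(0 :: ('p, 'h, 'k) tensor \<Rightarrow> ('p, 'h, 'k) tensor) t = 0"
  "(F + G) t = F t + G t" for F G :: "('p, 'h, 'k) tensor \<Rightarrow> ('p, 'h, 'k) tensor"
  by (rule zero_fun_apply plus_fun_apply)+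

lemma BB_total_linear: "F \<in> TP.E.total \<Longrightarrow> linear_on tscl PH.VH tscl PH.VH F"
proof (induction rule: BB_total_induct)
  case (homs i F)
  then show ?case using TP.E.hom_grD(1)[OF homs] by simp
qed (auto simp: linear_on_def BB_apply PH.VH.tspan_0 PH.VH.tspan_add
    PH.VH.T.scale_right_distrib)

lemma BB_total_outside: "F \<in> TP.E.total \<Longrightarrow> t \<notin> PH.VH \<Longrightarrow> F t = 0"
proof (induction rule: BB_total_induct)
  case (homs i F)
  then show ?case using TP.E.hom_grD(2)[OF homs(1)] by simp
qed (auto simp: BB_apply)

text \<open>The elements 1 # h have degree 0, so no Koszul sign arises and the relation extends from
  homogeneous to arbitrary \<open>F\<close>.\<close>

lemma BB_total_hopf:
  "F \<in> TP.E.total \<Longrightarrow> t \<in> PH.VH \<Longrightarrow> F (tact (sm.ts (unt A) h) t) = tact (sm.ts (unt A) h) (F t)"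
proof (induction rule: BB_total_induct)
  case (homs i F)
  then show ?case using TP.E.hom_grD(4)[OF homs(1) ts_AH_gr[OF A.A.unt_gr]] by simp
next
  case zero
  then show ?case
    using linear_on_zero[OF tact_linear(1) PH.VH.tspan_0] by (simp add: BB_apply tens_in_tspan)
next
  case (add F G)
  then show ?case
    using linear_onD(2)[OF tact_linear(1)] linear_onD(1)[OF BB_total_linear]
    by (simp add: BB_apply tens_in_tspan)
qed

lemma hlin_act_right:
  "hlin H (scl P) f \<Longrightarrow> (\<And>x. f x \<in> carr P) \<Longrightarrow> hlin H (scl P) (\<lambda>x. act (sm.ts (unt A) h) (f x))"
  using hlin_hP_right by (simp add: res_hopf_def)

text \<open>The left side expands to w_2 T(w_1) m \<otimes> w_3, where w_2 T(w_1) contracts to the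
  counit.\<close>

lemma tens_generated:
  assumes m: "m \<in> carr P"
  shows "sweedler H (\<lambda>w1 w2. tact (sm.ts (unt A) w2) (PH.ts (hP (T w1) m) 1)) w = PH.ts m w"
proof -
  note intros = lin_intros carr_intros m
  have "tact (sm.ts (unt A) w2) (PH.ts (hP (T w1) m) 1) =
      sweedler H (\<lambda>p q. PH.ts (hP (p * T w1) m) q) w2" for w1 w2
    by (simp add: tact_tens m tact0_def act_ts aP_unt hP_mult)
  then have "sweedler H (\<lambda>w1 w2. tact (sm.ts (unt A) w2) (PH.ts (hP (T w1) m) 1)) w =
      sweedler H (\<lambda>w1 r. sweedler H (\<lambda>p q. PH.ts (hP (p * T w1) m) q) r) w"
    by simp
  also have "\<dots> = PH.ts (hP 1 m) w"
    by (rule T_right_contract_left(1)[OF vector_space_tscl]) (intro intros)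
  finally show ?thesis by (simp add: hP_one m)
qed

text \<open>Every later equality of endomorphisms of P \<otimes> H, whether for linearity in h, the
  differential, the product, the unit or surjectivity, is checked through this criterion.\<close>

lemma BB_eqI:
  assumes F: "F \<in> TP.E.total" and G: "G \<in> TP.E.total"
    and eq: "\<And>m. m \<in> carr P \<Longrightarrow> F (PH.ts m 1) = G (PH.ts m 1)"
  shows "F = G"
proof
  fix t
  show "F t = G t"
  proof (cases "t \<in> PH.VH")
    case True
    show ?thesis
    proof (rule PH.VH.linear_on_tspan_eqI[OF BB_total_linear[OF F] BB_total_linear[OF G] _ True])
      fix m w assume m: "m \<in> carr P"
      have tb: "hbil H tscl (\<lambda>w1 w2. tact (sm.ts (unt A) w2) (PH.ts (hP (T w1) m) 1))"
        by (simp add: tact_tens m tact0_def) (intro lin_intros hlin_act_right carr_intros m unt_carr)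
      have tm: "tact (sm.ts (unt A) w2) (PH.ts (hP (T w1) m) 1) \<in> PH.VH" for w1 w2
        by (intro tact_carr tens_in_tspan unt_carr hP_carr m UNIV_I)
      have ev: "F (PH.ts m w) = sweedler H (\<lambda>w1 w2. tact (sm.ts (unt A) w2) (F (PH.ts (hP (T w1) m) 1))) w"
        if F: "F \<in> TP.E.total" for F
        unfolding tens_generated[OF m, symmetric, of w]
        by (subst sweedler_linear_on[OF vector_space_tscl vector_space_tscl subspace_tspan
              BB_total_linear[OF F] tb tm])
          (simp add: BB_total_hopf[OF F] tens_in_tspan m)
      show "F (PH.ts m w) = G (PH.ts m w)"
        unfolding ev[OF F] ev[OF G] by (simp add: eq m)
    qed
  next
    case False
    show ?thesis unfolding BB_total_outside[OF F False] BB_total_outside[OF G False] ..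
  qed
qed

lemma phi1_linear_left: "linear_on sE AP.E.total sB TP.E.total (\<lambda>f. phi1 f h)"
proof -
  have "linear_on sE AP.E.total tscl UNIV (\<lambda>f. phi1 f h t)" for t
  proof (cases "t \<in> PH.VH")
    case True
    have lf: "linear_on sE AP.E.total tscl UNIV (\<lambda>f. phi0 f h m w)" if m: "m \<in> carr P" for m w
    proof -
      have "linear_on sE AP.E.total tscl UNIV (\<lambda>f. PH.ts (hh w1 f m) z)" for w1 z
        using linear_onD(2,3)[OF hh_linear_right]
        by (simp add: linear_on_def plus_fun_apply tens_add_left tens_scl_left)
      then show ?thesis
        unfolding phi0_def
        by (intro sm.sweedler_param_linear_on vector_space_tscl AP.E.hom_scl AP.E.total_subspace
            phi0_bil total_lin_P m)
    qed
    have "linear_on sE AP.E.total tscl UNIV (\<lambda>f. tlift (scl P) (carr P) (hscl H) UNIV (phi0 f h) t)"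
      by (intro PH.VH.tlift_param_linear[OF vector_space_tscl True AP.E.hom_scl AP.E.total_subspace]
          phi0_bilinear' total_lin_P lf)
    then show ?thesis using True by (simp add: phi1_def)
  qed (simp add: phi1_def linear_on_def)
  then have lin: "phi1 (f + g) h = phi1 f h + phi1 g h" "phi1 (sE c f) h = sB c (phi1 f h)"
    if "f \<in> AP.E.total" "g \<in> AP.E.total" for f g c
    using that by (auto simp: linear_on_def fun_eq_iff plus_fun_apply)
  have z: "0 \<in> AP.E.total" "0 \<in> TP.E.total"
    using dg_space.carr_0[OF AP.dg_space_End] dg_space.carr_0[OF TP.dg_space_End] by simp_all
  have "phi1 f h \<in> TP.E.total" if "f \<in> AP.E.total" for f
    using that
  proof (induction rule: total_induct)
    case (homs i f)
    then show ?case using phi1_mem TP.E.G_total by blast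
  next
    case zero
    have "phi1 0 h = 0" using lin(1)[OF z(1) z(1)] by simp
    then show ?case using z by simp
  next
    case (add f g)
    then show ?case using dg_space.carr_add[OF TP.dg_space_End] by (simp add: lin)
  qed
  then show ?thesis using lin by (simp add: linear_on_def)
qed

lemma phi1_total: "f \<in> AP.E.total \<Longrightarrow> phi1 f h \<in> TP.E.total"
  by (rule linear_onD(1)[OF phi1_linear_left])

text \<open>On the generators the value is \<open>f m \<otimes> h\<close>, visibly linear in
  h.\<close>

lemma phi1_linear_right:
  assumes f: "f \<in> AP.E.total"
  shows "linear_on (hscl H) UNIV sB TP.E.total (phi1 f)"
proof -
  have T: "F + G \<in> TP.E.total" "sB c F \<in> TP.E.total" if "F \<in> TP.E.total" "G \<in> TP.E.total" for F G c
    using dg_space.carr_add[OF TP.dg_space_End] dg_space.carr_scale[OF TP.dg_space_End, of F c] that by simp_all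
  have 1: "phi1 f (h + h') = phi1 f h + phi1 f h'" for h h'
    by (rule BB_eqI[OF phi1_total[OF f] T(1)[OF phi1_total[OF f] phi1_total[OF f]]])
      (simp add: phi1_tens_one total_lin_P[OF f] BB_apply tens_add_right)
  have 2: "phi1 f (hscl H c h) = sB c (phi1 f h)" for c h
    by (rule BB_eqI[OF phi1_total[OF f] T(2)[OF phi1_total[OF f] phi1_total[OF f]]])
      (simp add: phi1_tens_one total_lin_P[OF f] tens_scl_right)
  show ?thesis
    unfolding linear_on_def
    by (intro conjI ballI allI) (rule phi1_total[OF f] 1 2)+
qed

lemma phi1_bilinear: "bilinear_on sE AP.E.total (hscl H) UNIV sB TP.E.total phi1"
  unfolding bilinear_on_def by (intro conjI ballI) (rule phi1_linear_right, assumption, rule phi1_linear_left)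

section \<open>The map from Hom_A(P, P) # H: differential, product, unit and bijectivity\<close>

definition phi where
  "phi = tlift sE AP.E.total (hscl H) UNIV phi1"


lemma carr_End: "carr AP.End = AP.E.total" "scl AP.End = sE" "carr BB = TP.E.total" "scl BB = sB"
  by simp_all

lemma phi_bilinear:
  "bilinear_on (scl AP.End) (carr AP.End) (hscl H) UNIV sB TP.E.total phi1"
  "bilinear_on (scl AP.End) (carr AP.End) (hscl H) UNIV sB UNIV phi1"
  using phi1_bilinear unfolding carr_End by (auto simp: bilinear_on_def intro: linear_on_codom)

lemma total_subspace_BB: "module.subspace sB TP.E.total"
  using dg_space.carr_subspace[OF TP.dg_space_End] unfolding carr_End .

lemma phi_eq: "phi = tlift (scl AP.End) (carr AP.End) (hscl H) UNIV phi1"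
  unfolding phi_def carr_End ..

lemma phi_linear: "linear_on tscl ES.VH sB TP.E.total phi"
  unfolding phi_eq
  by (rule ES.VH.tlift_linear_on[OF vector_space_sB total_subspace_BB phi_bilinear(1)])

lemma phi_tens: "f \<in> AP.E.total \<Longrightarrow> phi (ES.ts f h) = phi1 f h"
  unfolding phi_eq carr_End(1)[symmetric]
  by (rule ES.VH.tlift_tens[OF vector_space_sB phi_bilinear(2) _ UNIV_I])

lemma phi_gr:
  assumes "x \<in> tspan (scl AP.End) (gr AP.End n) (hscl H) UNIV"
  shows "phi x \<in> TP.E.homs n"
  using assms
proof (induction rule: ES.gr.tspan_induct)
  case (tens f h)
  then have f: "f \<in> AP.E.homs n" by simp
  show ?case unfolding phi_tens[OF AP.E.G_total[OF f]] by (rule phi1_mem[OF f])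
next
  case zero
  show ?case
    unfolding linear_on_zero[OF phi_linear ES.VH.tspan_0] by (rule TP.E.subspace_0[OF TP.E.G_subspace])
next
  case (add x y)
  show ?case
    unfolding linear_onD(2)[OF phi_linear ES.gr_VH[OF add(1)] ES.gr_VH[OF add(2)]]
    by (rule TP.E.subspace_add[OF TP.E.G_subspace add(3,4)])
qed

lemma phi_total: "x \<in> ES.VH \<Longrightarrow> phi x \<in> TP.E.total"
  by (rule linear_onD(1)[OF phi_linear])

text \<open>The differential of m \<otimes> 1 is dm \<otimes> 1, so on generators both sides are the
  commutator of f with d, tensored with h.\<close>

lemma phi_dif:
  assumes "x \<in> ES.VH"
  shows "phi (dif EH x) = dif BB (phi x)"
proof -
  note dB = dg_space.dif_linear[OF TP.dg_space_End, unfolded carr_End]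
  note dE = ES.dif_tensor_linear
  have L1: "linear_on tscl ES.VH sB TP.E.total (\<lambda>x. phi (dif EH x))"
    unfolding ES.smash_simps by (rule linear_on_compose[OF dE phi_linear])
  have L2: "linear_on tscl ES.VH sB TP.E.total (\<lambda>x. dif BB (phi x))"
    by (rule linear_on_compose[OF phi_linear dB])
  show "phi (dif EH x) = dif BB (phi x)"
    using assms
  proof (induction rule: ES.VH_induct)
    case (tens f h i)
    then have f: "f \<in> AP.E.homs i" by simp
    note fl = hom_lin_P[OF f] and ft = AP.E.G_total[OF f] and f' = AP.E.hdif_mem[OF f]
    note F = phi1_mem[OF f, of h]
    have "phi (dif EH (ES.ts f h)) = phi1 (AP.E.hdif i f) h"
      using ES.dif_tens[of f h] ft phi_tens[OF AP.E.G_total[OF f']]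
      by (simp add: AP.E.dif_Hom[OF f])
    also have "\<dots> = TP.E.hdif i (phi1 f h)"
    proof (rule BB_eqI[OF phi1_total[OF AP.E.G_total[OF f']] TP.E.G_total[OF TP.E.hdif_mem[OF F]]])
      fix m assume m: "m \<in> carr P"
      have "phi1 (AP.E.hdif i f) h (PH.ts m 1) = PH.ts (dif P (f m) - ksgn i (f (dif P m))) h"
        unfolding phi1_tens_one[OF hom_lin_P[OF f'] m] by (simp add: AP.E.hdif_def m)
      moreover have "TP.E.hdif i (phi1 f h) (PH.ts m 1) = PH.ts (dif P (f m)) h - ksgn i (PH.ts (f (dif P m)) h)"
        using m by (simp add: TP.E.hdif_def tens_in_tspan phi1_tens_one[OF fl] PH.dif_tens
            P.M.dif_carr linear_onD(1)[OF fl])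
      moreover have "PH.ts (v - w) h = PH.ts v h - PH.ts w h" for v w
        using tens_add_left[of "scl P" "hscl H" "v - w" w h] by (simp add: eq_diff_eq)
      ultimately show "phi1 (AP.E.hdif i f) h (PH.ts m 1) = TP.E.hdif i (phi1 f h) (PH.ts m 1)"
        by (simp add: tens_ksgn_left)
    qed
    also have "\<dots> = dif BB (phi (ES.ts f h))"
      by (simp only: phi_tens[OF ft] TP.End_simps TP.E.dif_Hom[OF F])
    finally show ?case .
  next
    case zero
    show ?case using linear_on_zero[OF L1 ES.VH.tspan_0] linear_on_zero[OF L2 ES.VH.tspan_0] by simp
  next
    case (add x y)
    show ?case
      using linear_onD(2)[OF L1 add(1,2)] linear_onD(2)[OF L2 add(1,2)] add(3,4) by simp
  qed
qed

text \<open>At m \<otimes> 1 the left side is, up to the sign (-1)^(i j), the sum of (h_1 acting on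
  g)(f m) \<otimes> h_2 h'. This is the image of g # h' evaluated at f m \<otimes> h, and f m
  \<otimes> h is the image of f # h at m \<otimes> 1. The reversed composition in both endomorphism
  algebras is exactly what makes the orders agree.\<close>

lemma phi_mul_tens:
  assumes f: "f \<in> AP.E.homs i" and g: "g \<in> AP.E.homs j"
  shows "phi (mul EH (ES.ts f h) (ES.ts g h')) = mul BB (phi (ES.ts f h)) (phi (ES.ts g h'))"
proof -
  note fl = hom_lin_P[OF f] and ft = AP.E.G_total[OF f]
  note gl = hom_lin_P[OF g] and gt = AP.E.G_total[OF g]
  note F = phi1_mem[OF f, of h] and G = phi1_mem[OF g, of h']
  note V = vector_space_tscl
  let ?p = "\<lambda>h1. AP.emul i j f (hh h1 g)"
  have pm: "?p h1 \<in> AP.E.homs (i + j)" for h1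
    by (rule AP.emul_mem[OF f hh_mem[OF g]])
  have mulEH: "mul EH (ES.ts f h) (ES.ts g h') = ES.smul f h g h'"
    by (rule ES.smash_mul_tens) (use ft gt in simp_all)
  have sm: "ES.smul f h g h' = sweedler H (\<lambda>h1 h2. ES.ts (?p h1) (h2 * h')) h"
    unfolding ES.smul_def by (simp only: AP.End_mul[OF f hh_mem[OF g]])
  have sb: "hbil H tscl (\<lambda>h1 h2. ES.ts (?p h1) (h2 * h'))"
    using ES.smul_bil[of f g h'] ft gt by (simp add: AP.End_mul[OF f hh_mem[OF g]])
  have tm: "ES.ts (?p h1) (h2 * h') \<in> ES.VH" for h1 h2
    using AP.E.G_total[OF pm] by (simp add: tens_in_tspan)
  have phis: "phi (ES.smul f h g h') = sweedler H (\<lambda>h1 h2. phi1 (?p h1) (h2 * h')) h"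
    unfolding sm
    by (subst sweedler_linear_on[OF V vector_space_sB subspace_tspan phi_linear sb tm])
      (simp only: phi_tens[OF AP.E.G_total[OF pm]])
  have pb: "hbil H sB (\<lambda>h1 h2. phi1 (?p h1) (h2 * h'))"
    using hbil_compose[OF sb tm phi_linear] unfolding phi_tens[OF AP.E.G_total[OF pm]] .
  have kl: "lin tscl tscl (ksgn n)" for n
    by (simp add: linear_on_def ksgn_scale[OF V])
  have FG: "mul BB (phi1 f h) (phi1 g h') = TP.emul i j (phi1 f h) (phi1 g h')"
    by (rule TP.End_mul[OF F G])
  have smem: "ES.smul f h g h' \<in> ES.VH"
    by (rule ES.smul_mem) (use ft gt in simp_all)
  have "phi (ES.smul f h g h') = TP.emul i j (phi1 f h) (phi1 g h')"
  proof (rule BB_eqI[OF phi_total[OF smem] TP.E.G_total[OF TP.emul_mem[OF F G]]])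
    fix m assume m: "m \<in> carr P"
    have fm: "f m \<in> carr P" by (rule linear_onD(1)[OF fl m])
    have "phi (ES.smul f h g h') (PH.ts m 1) = sweedler H (\<lambda>h1 h2. phi1 (?p h1) (h2 * h') (PH.ts m 1)) h"
      unfolding phis
      by (rule sweedler_lin[OF vector_space_sB V _ pb, of "\<lambda>F. F (PH.ts m 1)"])
        (simp add: linear_on_def BB_apply)
    also have "\<dots> = sweedler H (\<lambda>h1 h2. ksgn (i * j) (PH.ts (hh h1 g (f m)) (h2 * h'))) h"
      by (simp add: phi1_tens_one[OF hom_lin_P[OF pm] m] AP.emul_apply tens_ksgn_left)
    also have "\<dots> = ksgn (i * j) (phi0 g h' (f m) h)"
      unfolding phi0_def by (rule sweedler_lin[OF V V kl phi0_bil[OF gl fm], symmetric])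
    also have "\<dots> = TP.emul i j (phi1 f h) (phi1 g h') (PH.ts m 1)"
      by (simp add: TP.emul_apply phi1_tens_one[OF fl m] phi1_tens[OF gl fm])
    finally show "phi (ES.smul f h g h') (PH.ts m 1) = TP.emul i j (phi1 f h) (phi1 g h') (PH.ts m 1)" .
  qed
  then show ?thesis
    unfolding mulEH phi_tens[OF ft] phi_tens[OF gt] FG .
qed

lemma phi_mul:
  assumes x: "x \<in> ES.VH" and y: "y \<in> ES.VH"
  shows "phi (mul EH x y) = mul BB (phi x) (phi y)"
proof -
  note mE = bilinear_onD[OF ES.smash_mul_bilinear]
  note mB = bilinear_onD[OF TP.End_mul_bilinear, unfolded carr_End]
  have L1: "linear_on tscl ES.VH sB TP.E.total (\<lambda>x. phi (mul EH x y))" if "y \<in> ES.VH" for y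
    by (rule linear_on_compose[OF mE(2)[OF that] phi_linear])
  have L1': "linear_on tscl ES.VH sB TP.E.total (\<lambda>y. phi (mul EH x y))" if "x \<in> ES.VH" for x
    by (rule linear_on_compose[OF mE(1)[OF that] phi_linear])
  have L2: "linear_on tscl ES.VH sB TP.E.total (\<lambda>x. mul BB (phi x) (phi y))" if "y \<in> ES.VH" for y
    by (rule linear_on_compose[OF phi_linear mB(2)[OF phi_total[OF that]]])
  have L2': "linear_on tscl ES.VH sB TP.E.total (\<lambda>y. mul BB (phi x) (phi y))" if "x \<in> ES.VH" for x
    by (rule linear_on_compose[OF phi_linear mB(1)[OF phi_total[OF that]]])
  have 1: "phi (mul EH (ES.ts f h) y) = mul BB (phi (ES.ts f h)) (phi y)" if f: "f \<in> AP.E.homs i" for f h i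
  proof -
    have fh: "ES.ts f h \<in> ES.VH" using AP.E.G_total[OF f] by (simp add: tens_in_tspan)
    show ?thesis
    proof (rule ES.VH_induct[where Q="\<lambda>y. phi (mul EH (ES.ts f h) y) = mul BB (phi (ES.ts f h)) (phi y)", OF y])
      show "phi (mul EH (ES.ts f h) (ES.ts g h')) = mul BB (phi (ES.ts f h)) (phi (ES.ts g h'))"
        if "g \<in> gr AP.End j" for g h' j
        using phi_mul_tens[OF f] that unfolding AP.End_simps .
      show "phi (mul EH (ES.ts f h) 0) = mul BB (phi (ES.ts f h)) (phi 0)"
        using linear_on_zero[OF L1'[OF fh] ES.VH.tspan_0] linear_on_zero[OF L2'[OF fh] ES.VH.tspan_0] by simp
      show "phi (mul EH (ES.ts f h) (s + t)) = mul BB (phi (ES.ts f h)) (phi (s + t))"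
        if "s \<in> ES.VH" "t \<in> ES.VH" "phi (mul EH (ES.ts f h) s) = mul BB (phi (ES.ts f h)) (phi s)"
          "phi (mul EH (ES.ts f h) t) = mul BB (phi (ES.ts f h)) (phi t)" for s t
        using linear_onD(2)[OF L1'[OF fh] that(1,2)] linear_onD(2)[OF L2'[OF fh] that(1,2)] that(3,4) by simp
    qed
  qed
  show ?thesis
  proof (rule ES.VH_induct[where Q="\<lambda>x. phi (mul EH x y) = mul BB (phi x) (phi y)", OF x])
    show "phi (mul EH (ES.ts f h) y) = mul BB (phi (ES.ts f h)) (phi y)" if "f \<in> gr AP.End i" for f h i
      using 1 that unfolding AP.End_simps .
    show "phi (mul EH 0 y) = mul BB (phi 0) (phi y)"
      using linear_on_zero[OF L1[OF y] ES.VH.tspan_0] linear_on_zero[OF L2[OF y] ES.VH.tspan_0] by simp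
    show "phi (mul EH (s + t) y) = mul BB (phi (s + t)) (phi y)"
      if "s \<in> ES.VH" "t \<in> ES.VH" "phi (mul EH s y) = mul BB (phi s) (phi y)"
        "phi (mul EH t y) = mul BB (phi t) (phi y)" for s t
      using linear_onD(2)[OF L1[OF y] that(1,2)] linear_onD(2)[OF L2[OF y] that(1,2)] that(3,4) by simp
  qed
qed

lemma unt_End: "unt AP.End \<in> AP.E.homs 0" "unt BB \<in> TP.E.homs 0"
  using dg_algebra.unt_gr[OF AP.dg_algebra_End] dg_algebra.unt_gr[OF TP.dg_algebra_End]
  unfolding AP.End_simps(2) TP.End_simps(2) .

lemma phi_unt: "phi (unt EH) = unt BB"
proof -
  note u = AP.E.G_total[OF unt_End(1)]
  have "phi1 (unt AP.End) 1 = unt BB"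
  proof (rule BB_eqI[OF phi1_total[OF u] TP.E.G_total[OF unt_End(2)]])
    fix m assume m: "m \<in> carr P"
    show "phi1 (unt AP.End) 1 (PH.ts m 1) = unt BB (PH.ts m 1)"
      unfolding phi1_tens_one[OF hom_lin_P[OF unt_End(1)] m]
      using m by (simp add: tens_in_tspan)
  qed
  then show ?thesis unfolding ES.smash_simps(5) phi_tens[OF u] .
qed

text \<open>The coordinates of the value at m \<otimes> 1 are the coordinates of t evaluated at m.
  Injectivity and surjectivity are both read off from this.\<close>

lemma phi_eval:
  assumes t: "t \<in> ES.VH" and m: "m \<in> carr P"
  shows "phi t (PH.ts m 1) = (\<Sum>b\<in>Bs. PH.ts (ES.co b t m) b)"
proof -
  have c: "ES.co b t \<in> AP.E.total" for b
    using linear_onD(1)[OF ES.co_linear t] unfolding carr_End .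
  have "phi t = phi (\<Sum>b\<in>Bs. ES.ts (ES.co b t) b)"
    using ES.tensor_expand[OF t] by (rule arg_cong)
  also have "\<dots> = (\<Sum>b\<in>Bs. phi (ES.ts (ES.co b t) b))"
    by (rule linear_on_sum[OF vector_space_tscl subspace_tspan phi_linear])
      (use c in \<open>simp add: tens_in_tspan\<close>)
  finally show ?thesis
    by (simp only: sum_apply phi_tens[OF c] phi1_tens_one[OF total_lin_P[OF c] m])
qed

lemma phi_inj: "inj_on phi ES.VH"
proof (rule inj_onI)
  fix s t assume s: "s \<in> ES.VH" and t: "t \<in> ES.VH" and eq: "phi s = phi t"
  have c: "ES.co b t \<in> AP.E.total" if "t \<in> ES.VH" for b t
    using linear_onD(1)[OF ES.co_linear that] unfolding carr_End .
  have "ES.co b s = ES.co b t" if b: "b \<in> Bs" for b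
  proof
    fix m
    show "ES.co b s m = ES.co b t m"
    proof (cases "m \<in> carr P")
      case True
      have "ES.co b t m = PH.co b (phi t (PH.ts m 1))" if t: "t \<in> ES.VH" for t
        unfolding phi_eval[OF t True]
        by (rule PH.co_sum[OF _ b, symmetric]) (rule linear_onD(1)[OF total_lin_P[OF c[OF t]] True])
      then show ?thesis using s t eq by simp
    next
      case False
      show ?thesis unfolding total_outside[OF c[OF s] False] total_outside[OF c[OF t] False] ..
    qed
  qed
  then have "(\<Sum>b\<in>Bs. ES.ts (ES.co b s) b) = (\<Sum>b\<in>Bs. ES.ts (ES.co b t) b)" by simp
  then show "s = t" unfolding ES.tensor_expand[OF s, symmetric] ES.tensor_expand[OF t, symmetric] .
qed

text \<open>a # 1 acts on the left factor only, hence commutes with coordinates in H. With it the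
  coordinate maps of an A # H-linear map are seen to be A-linear.\<close>

lemma co_tact_one:
  assumes a: "a \<in> carr A" and t: "t \<in> PH.VH"
  shows "PH.co b (tact (sm.ts a 1) t) = aP a (PH.co b t)"
proof (rule PH.VH.linear_on_tspan_eqI[OF _ _ _ t])
  have a1: "sm.ts a 1 \<in> sm.VH" using a by (simp add: tens_in_tspan)
  show "linear_on tscl PH.VH (scl P) (carr P) (\<lambda>t. PH.co b (tact (sm.ts a 1) t))"
    by (rule linear_on_compose[OF tact_linear(1)[OF a1] PH.co_linear])
  show "linear_on tscl PH.VH (scl P) (carr P) (\<lambda>t. aP a (PH.co b t))"
    by (rule linear_on_compose[OF PH.co_linear aP_linear[OF a]])
  fix m w assume m: "m \<in> carr P"
  have "tact (sm.ts a 1) (PH.ts m w) = PH.ts (act (sm.ts a 1) m) (1 * w)"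
    unfolding tact_tens[OF a m] tact0_def by (rule sweedler_one[OF vector_space_tscl tact0_bil[OF a m]])
  then show "PH.co b (tact (sm.ts a 1) (PH.ts m w)) = aP a (PH.co b (PH.ts m w))"
    using a m linear_onD(3)[OF aP_linear[OF a] m]
    by (simp add: PH.co_tens res_alg_def[symmetric, THEN fun_cong] act_ts hP_one)
qed

lemma tact_one_tens:
  assumes a: "a \<in> carr A" and m: "m \<in> carr P"
  shows "tact (sm.ts a 1) (PH.ts m 1) = PH.ts (aP a m) 1"
proof -
  have "tact (sm.ts a 1) (PH.ts m 1) = PH.ts (act (sm.ts a 1) m) (1 * 1)"
    unfolding tact_tens[OF a m] tact0_def by (rule sweedler_one[OF vector_space_tscl tact0_bil[OF a m]])
  then show ?thesis using a m by (simp add: act_ts hP_one)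
qed

lemma phi_surj: "gr BB n \<subseteq> phi ` gr EH n"
proof
  fix F assume "F \<in> gr BB n"
  then have F: "F \<in> TP.E.homs n" by simp
  note FL = BB_total_linear[OF TP.E.G_total[OF F]]
  \<comment> \<open>The b-th coordinate of m \<mapsto> F(m \<otimes> 1). The preimage of F is then
    the sum of f_b # b over the basis, as \<open>phi_eval\<close> dictates.\<close>
  define f where "f b m = (if m \<in> carr P then PH.co b (F (PH.ts m 1)) else 0)" for b m
  have ts1: "PH.ts m 1 \<in> PH.VH" if "m \<in> carr P" for m using that by (simp add: tens_in_tspan)
  note Fts = linear_onD(1)[OF FL ts1]
  have fL: "lin_P (f b)" for b
  proof -
    have "linear_on (scl P) (carr P) tscl PH.VH (\<lambda>m. PH.ts m 1)"
      by (simp add: linear_on_def tens_add_left tens_scl_left ts1)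
    then have "lin_P (\<lambda>m. PH.co b (F (PH.ts m 1)))"
      by (intro linear_on_compose[OF linear_on_compose[OF _ FL] PH.co_linear])
    then show ?thesis
      by (subst linear_on_cong[where g="\<lambda>m. PH.co b (F (PH.ts m 1))"])
        (simp_all add: f_def P.M.vector_space_axioms P.M.carr_subspace)
  qed
  have f: "f b \<in> AP.E.homs n" for b
    unfolding hom_gr_def
  proof (intro CollectI conjI allI impI ballI fL)
    show "f b m = 0" if "m \<notin> carr P" for m using that by (simp add: f_def)
    show "f b m \<in> gr P (n + j)" if m: "m \<in> gr P j" for m j
    proof -
      have "F (PH.ts m 1) \<in> gr PtH (n + j)"
        by (rule TP.E.hom_grD(3)[OF F]) (simp add: tens_in_tspan m)
      then show ?thesis using P.M.gr_carr[OF m] by (simp add: f_def PH.co_gr)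
    qed
    show "f b (aP a m) = ksgn (n * j) (aP a (f b m))" if a: "a \<in> gr A j" and m: "m \<in> carr P" for a m j
    proof -
      note ac = A.A.gr_carr[OF a]
      have "F (PH.ts (aP a m) 1) = ksgn (n * j) (tact (sm.ts a 1) (F (PH.ts m 1)))"
        unfolding tact_one_tens[OF ac m, symmetric]
        by (rule TP.E.hom_grD(4)[OF F ts_AH_gr[OF a]]) (simp add: ts1 m)
      moreover have "tact (sm.ts a 1) (F (PH.ts m 1)) \<in> PH.VH"
        using Fts[OF m] by (intro tact_carr tens_in_tspan ac UNIV_I)
      ultimately have "PH.co b (F (PH.ts (aP a m) 1)) = ksgn (n * j) (PH.co b (tact (sm.ts a 1) (F (PH.ts m 1))))"
        using linear_on_ksgn[OF vector_space_tscl subspace_tspan PH.co_linear] by simp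
      then show ?thesis using ac m by (simp add: f_def co_tact_one Fts)
    qed
  qed
  let ?t = "\<Sum>b\<in>Bs. ES.ts (f b) b"
  have tg: "?t \<in> gr EH n"
  proof -
    have "ES.ts (f b) b \<in> tspan (scl AP.End) (gr AP.End n) (hscl H) UNIV" for b
      by (rule tens_in_tspan) (simp_all add: f)
    then show ?thesis
      unfolding ES.smash_simps(2) by (intro ES.VH.T.subspace_sum subspace_tspan)
  qed
  have tVH: "?t \<in> ES.VH" using ES.gr_VH tg unfolding ES.smash_simps(2) by blast
  have "phi ?t = F"
  proof (rule BB_eqI[OF phi_total[OF tVH] TP.E.G_total[OF F]])
    fix m assume m: "m \<in> carr P"
    have "ES.co b ?t = f b" if "b \<in> Bs" for b
      by (rule ES.co_sum[OF _ that]) (use AP.E.G_total[OF f] in simp)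
    then have "phi ?t (PH.ts m 1) = (\<Sum>b\<in>Bs. PH.ts (f b m) b)"
      unfolding phi_eval[OF tVH m] by (intro sum.cong refl) simp
    also have "\<dots> = F (PH.ts m 1)"
      using PH.tensor_expand[OF Fts[OF m]] m by (simp add: f_def)
    finally show "phi ?t (PH.ts m 1) = F (PH.ts m 1)" .
  qed
  then show "F \<in> phi ` gr EH n" using tg by blast
qed

lemma phi_dgs_hom: "dgs_hom EH BB phi"
  unfolding dgs_hom_def
proof (intro conjI allI ballI)
  show "dg_space EH" by (rule ES.dg_space_smash)
  show "dg_space BB" by (rule TP.dg_space_End)
  show "linear_on (scl EH) (carr EH) (scl BB) (carr BB) phi"
    using phi_linear unfolding ES.smash_simps carr_End .
  show "phi x \<in> gr BB n" if "x \<in> gr EH n" for x n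
    using phi_gr that unfolding ES.smash_simps TP.End_simps .
  show "phi (dif EH x) = dif BB (phi x)" if "x \<in> carr EH" for x
    using that unfolding ES.smash_simps(3) by (rule phi_dif)
qed

lemma phi_quasi_iso: "dga_quasi_iso EH BB phi"
proof -
  have inj: "inj_on phi (carr EH)" unfolding ES.smash_simps by (rule phi_inj)
  have mul: "phi (mul EH x y) = mul BB (phi x) (phi y)" if "x \<in> carr EH" "y \<in> carr EH" for x y
    using that unfolding ES.smash_simps(3) by (rule phi_mul)
  \<comment> \<open>The target is a dg algebra as an endomorphism algebra; the source inherits the
    axioms along \<open>phi\<close>.\<close>
  have "dg_algebra EH"
  proof (rule dg_algebra_if_bijective_hom[OF TP.dg_algebra_End phi_dgs_hom inj])
    show "gr BB n \<subseteq> phi ` gr EH n" for n by (rule phi_surj)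
    show "phi (mul EH x y) = mul BB (phi x) (phi y)" if "x \<in> carr EH" "y \<in> carr EH" for x y
      by (rule mul[OF that])
    show "phi (unt EH) = unt BB" by (rule phi_unt)
    show "bilinear_on (scl EH) (carr EH) (scl EH) (carr EH) (scl EH) (carr EH) (mul EH)"
      unfolding ES.smash_simps by (rule ES.smash_mul_bilinear)
    show "unt EH \<in> gr EH 0"
      unfolding ES.smash_simps by (rule tens_in_tspan) (use unt_End(1) in simp_all)
  qed
  then show ?thesis
    using phi_dgs_hom mul phi_unt TP.dg_algebra_End
      induces_iso_if_bijective[OF phi_dgs_hom inj phi_surj]
    unfolding dga_quasi_iso_def dga_hom_def by blast
qed

end

lemma ex_basis:
  assumes "hopf_algebra H" "finite_dim H"
  obtains Bs where "fd_hopf_algebra H Bs"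
proof -
  interpret hopf_algebra H by fact
  obtain B where B: "finite B" "span B = UNIV" using assms(2) by (auto simp: finite_dim_def)
  obtain C where C: "C \<subseteq> B" "independent C" "B \<subseteq> span C"
    using maximal_independent_subset[of B] by blast
  have "span C = UNIV" using span_minimal[OF C(3) subspace_span] B(2) by blast
  then have "fd_hopf_algebra H C"
    using C finite_subset[OF C(1) B(1)] by unfold_locales
  then show ?thesis by (rule that)
qed

theorem theorem2p8:
  fixes H :: "('k::{alg_closed_field, field_char_0}, 'h::ring_1) hopf"
    and A :: "('k, 'a::ab_group_add) dga" and hact :: "'h \<Rightarrow> 'a \<Rightarrow> 'a"
    and M :: "('k, 'm::ab_group_add) dgs" and actM :: "('a, 'h, 'k) tensor \<Rightarrow> 'm \<Rightarrow> 'm"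
    and P :: "('k, 'p::ab_group_add) dgs" and actP :: "('a, 'h, 'k) tensor \<Rightarrow> 'p \<Rightarrow> 'p"
    and q :: "'p \<Rightarrow> 'm"
  assumes "hopf_algebra H" and "finite_dim H" and "semisimple_ring TYPE('h)"
    and "dg_module_algebra H A hact"
    and "dg_module (smash H A hact) M actM"
    and "K_projective_resolution (smash H A hact) P actP M actM q"
  shows "\<exists>\<Phi>. dga_quasi_iso
           (smash H (RHom_A H A P actP) (hom_hact H A P actP actP))
           (RHom_smash H A hact P actP) \<Phi>"
proof -
  obtain Bs where "fd_hopf_algebra H Bs" using ex_basis[OF assms(1,2)] .
  then interpret fd_hopf_algebra H Bs .
  have "dg_module (smash H A hact) P actP"
    using assms(6) by (simp add: K_projective_resolution_def K_projective_def)
  \<comment> \<open>Semisimplicity enters through the bijectivity of the antipode.\<close>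
  moreover have "fd_hopf_algebra_bij H Bs"
    by unfold_locales (rule bij_antip[OF assms(3)])
  ultimately interpret smash_module H Bs A hact P actP
    using assms(4) by (simp add: smash_module_def)
  show ?thesis
    unfolding RHom_A_def RHom_smash_def using phi_quasi_iso by blast
qed

end
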